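(* Let $D\subset\mathbb{C}^n$ be an open invariant set, let $\Omega_D\subset\mathbb{H}^n$ be its circularization and let $f\in\mathcal{S}(\Omega_D)$ be a slice function. Fix any $H\in\mathcal{P}(n)$. Then: 1. $f$ decomposes, for every $x\in\Omega_{D_H}$, as $$f(x)=\sum_{K\subset H}(-1)^{|H\setminus K|}\left[(\overline{x})_{H\setminus K}\odot\mathcal{S}^H_K(f)\right](x).$$ 2. For every $K\subset H$, $\mathcal{S}^H_K(f)\in\mathcal{S}_{c,H}(\Omega_{D_H})\cap\mathcal{S}_p(\Omega_{D_H})$, where $p=\min H^c$ (if $H=\{1,\dots,n\}$ the condition involving $p$ is void). 3. If $f\in\mathcal{SR}(\Omega_D)$, then $\Delta_h\mathcal{S}^H_K(f)=0$ on $\Omega_D$ for all $h\in H$ and all $K\subset H$. 4. $f\in\mathcal{SR}(\Omega_D)$ if and only if for every $H'\in\mathcal{P}(n)$ with $H'\neq\{1,\dots,n\}$ and every $K\subset H'$ one has $\mathcal{S}^{H'}_K(f)\in\mathcal{SR}_{p}(\Omega_D)$, where $p=\min (H')^c$. 5. $f\in\mathcal{S}_{\mathbb{R}}(\Omega_D)$ if and only if $\mathcal{S}^{\{1,\dots,n\}}_K(f)$ is real valued for every $K\in\mathcal{P}(n)$.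
   Context: Sets and products. $\mathbb{H}$ denotes the quaternions, $\mathbb{S}_\mathbb{H}=\{J\in\mathbb{H}: J^2=-1\}$, $\mathcal{P}(n)$ is the power set of $\{1,\dots,n\}$, and $H^c=\{1,\dots,n\}\setminus H$. For $K=\{k_1<\dots<k_p\}$ and quaternions $q_k$, $q_K:=q_{k_1}\cdots q_{k_p}$ (increasing order), $q_\emptyset:=1$. For $z\in\mathbb{C}^n$ write $z_h=\alpha_h+i\beta_h$ with $\alpha_h,\beta_h\in\mathbb{R}$, and let $\overline z^h$ be $z$ with $z_h$ replaced by $\overline{z_h}$. Stem and slice functions. $D\subset\mathbb{C}^n$ is invariant if $z\in D\iff\overline z^h\in D$ for all $h$. Let $\{e_K\}_{K\in\mathcal{P}(n)}$ be a basis of $\mathbb{R}^{2^n}$, $e_\emptyset=1$, $e_h:=e_{\{h\}}$. A stem function on $D$ is a continuous $F=\sum_{K\in\mathcal{P}(n)}e_KF_K:D\to\mathbb{H}\otimes\mathbb{R}^{2^n}$ ($F_K$ $\mathbb{H}$-valued) with $F_K(\overline z^h)=(-1)^{|K\cap\{h\}|}F_K(z)$ for all $K,h$. The circularization of $D$ is $\Omega_D=\{(\alpha_1+J_1\beta_1,\dots,\alpha_n+J_n\beta_n): (\alpha_1+i\beta_1,\dots,\alpha_n+i\beta_n)\in D,\ J_1,\dots,J_n\in\mathbb{S}_\mathbb{H}\}$. $F$ induces the slice function $f=\mathcal{I}(F):\Omega_D\to\mathbb{H}$, $f(x)=\sum_{K}J_KF_K(z)$ for $x=(\alpha_h+J_h\beta_h)_h$,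 $z=(\alpha_h+i\beta_h)_h$; the stem function $F$ is determined by $f$. $\mathcal{S}(\Omega_D)$ is the set of slice functions on $\Omega_D$; $\mathcal{S}_\mathbb{R}(\Omega_D)$ is the set of slice preserving functions, i.e. those whose inducing $F$ has all $F_K$ real valued. Product: $(F\otimes G)(z)=\sum_{H,K}(-1)^{|H\cap K|}e_{K\Delta H}F_K(z)G_H(z)$ ($\Delta$ = symmetric difference) and $\mathcal{I}(F)\odot\mathcal{I}(G):=\mathcal{I}(F\otimes G)$. The coordinate function $x_j$ is the slice function induced by $Z_j(z)=\alpha_j+e_j\beta_j$, its conjugate $\overline x_j$ is induced by $\overline Z_j(z)=\alpha_j-e_j\beta_j$; $x_K$ and $(\overline x)_K$ are the ordered products of the $x_k$, resp. $\overline x_k$, $k\in K$. Regularity. $\mathcal{J}_h(q\otimes e_K)=(-1)^{|K\cap\{h\}|}q\otimes e_{K\Delta\{h\}}$ and $\overline\partial_h=\frac12(\partial/\partial\alpha_h+\mathcal{J}_h\,\partial/\partial\beta_h)$. A $C^1$ stem function $F$ is holomorphic if $\overline\partial_hF=0$ for every $h=1,\dots,n$; $f=\mathcal{I}(F)$ is slice regular if $F$ is holomorphic. $\mathcal{SR}(\Omega_D)$ is the set of slice regular functions. Partial properties. For $y\in\Omega_D$ let $\Omega_{D,h}(y)=\{x\in\mathbb{H}:(y_1,\dots,y_{h-1},x,y_{h+1},\dots,y_n)\in\Omega_D\}$ and $f^y_h(x)=f(y_1,\dots,y_{h-1},x,y_{h+1},\dots,y_n)$. A function $f\in\mathcal{S}(\Omega_D)$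 is slice (resp. slice regular) w.r.t. $x_h$ if for every $y\in\Omega_D$ the function $f^y_h$ is slice (resp. slice regular) in the sense above with $n=1$; it is circular w.r.t. $x_h$ if each $f^y_h$ is constant on every sphere $\{\alpha+J\beta:J\in\mathbb{S}_\mathbb{H}\}$ contained in its domain. The corresponding subsets of $\mathcal{S}(\Omega_D)$ are $\mathcal{S}_h(\Omega_D)$, $\mathcal{SR}_h(\Omega_D)$, $\mathcal{S}_{c,h}(\Omega_D)$, and $\mathcal{S}_{c,H}(\Omega_D)=\bigcap_{h\in H}\mathcal{S}_{c,h}(\Omega_D)$. Spherical derivatives and components. For $H\in\mathcal{P}(n)$ let $D_H=\{z\in D:\beta_h\ne0\ \forall h\in H\}$, $\Omega_{D_H}$ its circularization, and for $f=\mathcal{I}(F)\in\mathcal{S}(\Omega_D)$ let $f'_{s,H}=\mathcal{I}(F'_H)\in\mathcal{S}(\Omega_{D_H})$, where $F'_H(z)=\big(\prod_{h\in H}\beta_h\big)^{-1}\sum_{K\subset H^c}e_KF_{K\cup H}(z)$. For $K\subset H$ define $\mathcal{S}^H_K(f):=(x_K\odot f)'_{s,H}$ on $\Omega_{D_H}$; in particular $\mathcal{S}^\emptyset_\emptyset(f)=f$. When $f$ is slice regular, $\mathcal{S}^H_K(f)$ extends continuously (in a unique way) to $\Omega_D$ and the extension is denoted by the same symbol. In general, "$\mathcal{S}^H_K(f)\in\mathcal{SR}_p(\Omega_D)$" means that $\mathcal{S}^H_K(f)$ is the restriction of a (necessarily unique) element of $\mathcal{SR}_p(\Omega_D)$.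 $\Delta_h$ is the Laplacian of $\mathbb{R}^4$ in the four real coordinates of the quaternionic variable $x_h$. *)

theory Defs
  imports "HOL-Analysis.Analysis"
begin

section \<open>Quaternions\<close>

datatype quat = Quat (qRe: real) (qI: real) (qJ: real) (qK: real)

lemma quat_eq_iff: "x = y \<longleftrightarrow> qRe x = qRe y \<and> qI x = qI y \<and> qJ x = qJ y \<and> qK x = qK y"
  by (cases x; cases y) auto

instantiation quat :: ring_1
begin

definition zero_quat where "zero_quat = Quat 0 0 0 0"
definition one_quat where "one_quat = Quat 1 0 0 0"
definition plus_quat where
  "plus_quat x y = Quat (qRe x + qRe y) (qI x + qI y) (qJ x + qJ y) (qK x + qK y)"
definition minus_quat where
  "minus_quat x y = Quat (qRe x - qRe y) (qI x - qI y) (qJ x - qJ y) (qK x - qK y)"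
definition uminus_quat where
  "uminus_quat x = Quat (- qRe x) (- qI x) (- qJ x) (- qK x)"
definition times_quat where
  "times_quat x y = Quat
     (qRe x * qRe y - qI x * qI y - qJ x * qJ y - qK x * qK y)
     (qRe x * qI y + qI x * qRe y + qJ x * qK y - qK x * qJ y)
     (qRe x * qJ y - qI x * qK y + qJ x * qRe y + qK x * qI y)
     (qRe x * qK y + qI x * qJ y - qJ x * qI y + qK x * qRe y)"

instance
  by standard
    (simp_all add: zero_quat_def one_quat_def plus_quat_def minus_quat_def uminus_quat_def
      times_quat_def algebra_simps quat_eq_iff)

end

lemma quat_sel [simp]:
  "qRe 0 = 0" "qI 0 = 0" "qJ 0 = 0" "qK 0 = 0"
  "qRe 1 = 1" "qI 1 = 0" "qJ 1 = 0" "qK 1 = 0"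
  "qRe (x + y) = qRe x + qRe y" "qI (x + y) = qI x + qI y"
  "qJ (x + y) = qJ x + qJ y" "qK (x + y) = qK x + qK y"
  "qRe (x - y) = qRe x - qRe y" "qI (x - y) = qI x - qI y"
  "qJ (x - y) = qJ x - qJ y" "qK (x - y) = qK x - qK y"
  "qRe (- x) = - qRe x" "qI (- x) = - qI x" "qJ (- x) = - qJ x" "qK (- x) = - qK x"
  "qRe (x * y) = qRe x * qRe y - qI x * qI y - qJ x * qJ y - qK x * qK y"
  "qI (x * y) = qRe x * qI y + qI x * qRe y + qJ x * qK y - qK x * qJ y"
  "qJ (x * y) = qRe x * qJ y - qI x * qK y + qJ x * qRe y + qK x * qI y"
  "qK (x * y) = qRe x * qK y + qI x * qJ y - qJ x * qI y + qK x * qRe y"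
  by (simp_all add: zero_quat_def one_quat_def plus_quat_def minus_quat_def uminus_quat_def
      times_quat_def)

instantiation quat :: real_algebra_1
begin

definition scaleR_quat where
  "scaleR_quat r x = Quat (r * qRe x) (r * qI x) (r * qJ x) (r * qK x)"

instance
  by standard (simp_all add: scaleR_quat_def algebra_simps quat_eq_iff)

end

lemma quat_sel_scaleR [simp]:
  "qRe (r *\<^sub>R x) = r * qRe x" "qI (r *\<^sub>R x) = r * qI x"
  "qJ (r *\<^sub>R x) = r * qJ x" "qK (r *\<^sub>R x) = r * qK x"
  by (simp_all add: scaleR_quat_def)

lemma quat_sel_of_real [simp]:
  "qRe (of_real r) = r" "qI (of_real r) = 0" "qJ (of_real r) = 0" "qK (of_real r) = 0"
  by (simp_all add: of_real_def)

instantiation quat :: real_inner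
begin

definition inner_quat :: "quat \<Rightarrow> quat \<Rightarrow> real" where
  "inner_quat x y = qRe x * qRe y + qI x * qI y + qJ x * qJ y + qK x * qK y"
definition norm_quat :: "quat \<Rightarrow> real" where
  "norm_quat x = sqrt (inner x x)"
definition sgn_quat :: "quat \<Rightarrow> quat" where
  "sgn_quat x = x /\<^sub>R norm x"
definition dist_quat :: "quat \<Rightarrow> quat \<Rightarrow> real" where
  "dist_quat x y = norm (x - y)"
definition uniformity_quat :: "(quat \<times> quat) filter" where
  "uniformity_quat = (INF e\<in>{0 <..}. principal {(x, y). dist x y < e})"
definition open_quat :: "quat set \<Rightarrow> bool" where
  "open_quat U \<longleftrightarrow> (\<forall>x\<in>U. eventually (\<lambda>(x', y). x' = x \<longrightarrow> y \<in> U) uniformity)"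

instance
proof
  fix x :: quat
  show "inner x x = 0 \<longleftrightarrow> x = 0"
    by (simp add: inner_quat_def quat_eq_iff add_nonneg_eq_0_iff)
qed (simp_all add: inner_quat_def norm_quat_def sgn_quat_def dist_quat_def
      uniformity_quat_def open_quat_def algebra_simps)

end

lemma quat_mult_conj:
  "Quat (qRe x) (- qI x) (- qJ x) (- qK x) * x = inner x x *\<^sub>R 1"
  "x * Quat (qRe x) (- qI x) (- qJ x) (- qK x) = inner x x *\<^sub>R 1"
  by (simp_all add: quat_eq_iff inner_quat_def algebra_simps)

instantiation quat :: division_ring
begin

definition inverse_quat :: "quat \<Rightarrow> quat" where
  "inverse_quat x = Quat (qRe x) (- qI x) (- qJ x) (- qK x) /\<^sub>R (inner x x)"
definition divide_quat :: "quat \<Rightarrow> quat \<Rightarrow> quat" where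
  "divide_quat x y = x * inverse y"

instance
  by standard (simp_all add: inverse_quat_def divide_quat_def quat_mult_conj)

end

instance quat :: real_normed_div_algebra
proof
  fix x y :: quat
  show "norm (x * y) = norm x * norm y"
    unfolding norm_quat_def real_sqrt_mult [symmetric]
    by (rule arg_cong [of _ _ sqrt]) (simp add: inner_quat_def algebra_simps)
qed

instantiation quat :: euclidean_space
begin

definition Basis_quat :: "quat set" where
  "Basis_quat = {Quat 1 0 0 0, Quat 0 1 0 0, Quat 0 0 1 0, Quat 0 0 0 1}"

instance
proof
  fix x u v :: quat
  show "u \<in> Basis \<Longrightarrow> v \<in> Basis \<Longrightarrow> inner u v = (if u = v then 1 else 0)"
    unfolding Basis_quat_def by (elim insertE emptyE) (simp_all add: inner_quat_def)
  show "(\<forall>u\<in>Basis. inner x u = 0) \<longleftrightarrow> x = 0"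
    unfolding quat_eq_iff [of x] by (simp add: Basis_quat_def inner_quat_def)
qed (simp_all add: Basis_quat_def)

end

definition imag_units :: "quat set" where
  "imag_units = {J. J\<^sup>2 = -1}"

section \<open>Invariant sets and circularizations\<close>

text \<open>The index set \<open>{1,\<dots>,n}\<close> is a finite linearly ordered type \<^typ>\<open>'n\<close>, so
  \<open>\<P>(n)\<close> is \<^typ>\<open>'n set\<close>, and the tensor product of the quaternions with \<open>\<real>\<close>\<open>^(2^n)\<close> is
  \<open>quat ^ ('n set)\<close>: the component \<open>F z $ K\<close> is \<open>F_K(z)\<close>, and \<open>axis K q\<close> is \<open>q \<otimes> e_K\<close>.
  One-variable notions are the instance \<^typ>\<open>1\<close> of \<^typ>\<open>'n\<close>.\<close>

type_synonym 'n cvec = "(complex, 'n) vec"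
type_synonym 'n qvec = "(quat, 'n) vec"
type_synonym 'n stem_val = "(quat, 'n set) vec"

definition ordered_prod :: "('n::{finite,linorder} \<Rightarrow> quat) \<Rightarrow> 'n set \<Rightarrow> quat" where
  "ordered_prod q K = prod_list (map q (sorted_list_of_set K))"

definition conj_at :: "'n::finite \<Rightarrow> 'n cvec \<Rightarrow> 'n cvec" where
  "conj_at h z = (\<chi> k. if k = h then cnj (z $ k) else z $ k)"

definition invariant :: "'n::finite cvec set \<Rightarrow> bool" where
  "invariant D \<longleftrightarrow> (\<forall>z h. z \<in> D \<longleftrightarrow> conj_at h z \<in> D)"

definition embed :: "'n::finite qvec \<Rightarrow> 'n cvec \<Rightarrow> 'n qvec" where
  "embed J z = (\<chi> h. of_real (Re (z $ h)) + J $ h * of_real (Im (z $ h)))"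

definition circularization :: "'n::finite cvec set \<Rightarrow> 'n qvec set" where
  "circularization D = {embed J z | J z. z \<in> D \<and> (\<forall>h. J $ h \<in> imag_units)}"

section \<open>Stem functions and slice functions\<close>

definition stem :: "'n::finite cvec set \<Rightarrow> ('n cvec \<Rightarrow> 'n stem_val) \<Rightarrow> bool" where
  "stem D F \<longleftrightarrow> continuous_on D F \<and>
     (\<forall>z\<in>D. \<forall>K h. F (conj_at h z) $ K = (-1) ^ card (K \<inter> {h}) * F z $ K)"

text \<open>\<open>\<I>(F)\<close> at \<open>x\<close> is the common value of the sums over all representations \<open>x = embed J z\<close>
  with \<open>z \<in> D\<close>; see \<open>slice_fun_embed\<close> below for the independence of the representation. Outside
  the circularization of \<open>D\<close> the value is unspecified.\<close>

definition slice_fun ::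
    "'n::{finite,linorder} cvec set \<Rightarrow> ('n cvec \<Rightarrow> 'n stem_val) \<Rightarrow> 'n qvec \<Rightarrow> quat" where
  "slice_fun D F x = (THE q. \<forall>z\<in>D. \<forall>J. (\<forall>h. J $ h \<in> imag_units) \<and> x = embed J z \<longrightarrow>
     q = (\<Sum>K\<in>UNIV. ordered_prod (($) J) K * F z $ K))"

lemma imag_unitsD:
  assumes "J \<in> imag_units"
  shows "qRe J = 0" "norm J = 1"
proof -
  have "J * J = -1" using assms by (simp add: imag_units_def power2_eq_square)
  then have e: "qRe J * qRe J - qI J * qI J - qJ J * qJ J - qK J * qK J = -1"
    "qRe J * qI J = 0" "qRe J * qJ J = 0" "qRe J * qK J = 0"
    by (auto simp: quat_eq_iff)
  show 0: "qRe J = 0"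
  proof (rule ccontr)
    assume "qRe J \<noteq> 0"
    with e have "qRe J * qRe J = -1" by simp
    then show False using zero_le_square [of "qRe J"] by linarith
  qed
  show "norm J = 1"
    using e(1) 0 by (simp add: norm_quat_def inner_quat_def)
qed

lemma embed_component_eq:
  assumes J: "J \<in> imag_units" "J' \<in> imag_units"
    and eq: "of_real a + J * of_real b = (of_real a' + J' * of_real b' :: quat)"
  shows "a' = a \<and> (b = 0 \<and> b' = 0 \<or> b' = b \<and> J' = J \<or> b' = - b \<and> J' = - J)"
proof -
  have "qRe (of_real a + J * of_real b) = a" "qRe (of_real a' + J' * of_real b') = a'"
    using imag_unitsD(1) [OF J(1)] imag_unitsD(1) [OF J(2)] by simp_all
  with eq have a: "a' = a" by simp
  with eq have m: "J * of_real b = J' * of_real b'" by simp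
  then have "norm (J * of_real b) = norm (J' * of_real b')" by simp
  then have "\<bar>b\<bar> = \<bar>b'\<bar>"
    using imag_unitsD(2) [OF J(1)] imag_unitsD(2) [OF J(2)] by (simp add: norm_mult)
  then consider "b = 0" "b' = 0" | "b \<noteq> 0" "b' = b" | "b \<noteq> 0" "b' = - b" by linarith
  then show ?thesis
  proof cases
    case 3
    with m have "J * of_real b = (- J') * of_real b" by simp
    with 3 have "J = - J'" by (metis mult_right_cancel of_real_eq_0_iff)
    with 3 a show ?thesis by simp
  qed (use a m in auto)
qed

lemma ordered_prod_flip:
  assumes "\<And>k. k \<noteq> h \<Longrightarrow> q' k = q k" "q' h = - q h"
  shows "ordered_prod q' K = (-1) ^ card (K \<inter> {h}) * ordered_prod q K"
proof -
  have 0: "prod_list (map q' xs) = prod_list (map q xs)" if "h \<notin> set xs" for xs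
    using that assms(1) by (induction xs) auto
  have *: "prod_list (map q' xs) = (if h \<in> set xs then - prod_list (map q xs) else prod_list (map q xs))"
    if "distinct xs" for xs
    using that
  proof (induction xs)
    case (Cons a xs)
    then show ?case using 0 [of xs] assms by (cases "a = h") auto
  qed simp
  show ?thesis
    using * [of "sorted_list_of_set K"] by (simp add: ordered_prod_def)
qed

lemma ordered_prod_cong:
  "(\<And>k. k \<in> K \<Longrightarrow> q' k = q k) \<Longrightarrow> ordered_prod q' K = ordered_prod q K"
  unfolding ordered_prod_def
  by (metis (mono_tags, lifting) finite map_cong set_sorted_list_of_set)

lemma stem_eq_0:
  assumes "stem D F" "z \<in> D" "h \<in> K" "Im (z $ h) = 0"
  shows "F z $ K = 0"
proof -
  have "conj_at h z = z"
    using assms(4) by (simp add: conj_at_def vec_eq_iff complex_eq_iff)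
  moreover have "F (conj_at h z) $ K = (-1) ^ card (K \<inter> {h}) * F z $ K"
    using assms(1,2) unfolding stem_def by blast
  ultimately have "F z $ K = - F z $ K" using assms(3) by simp
  then show ?thesis by (simp add: quat_eq_iff)
qed

lemma slice_sum_step:
  fixes J J' :: "'n::{finite,linorder} qvec"
  assumes F: "stem D F" and D: "invariant D" and z: "z \<in> D"
    and J: "\<forall>h. J $ h \<in> imag_units" "\<forall>h. J' $ h \<in> imag_units"
    and eq: "embed J z = embed J' z'"
    and other: "\<And>k. k \<noteq> h \<Longrightarrow> J' $ k = J $ k \<and> z' $ k = z $ k"
  shows "z' \<in> D"
    "(\<Sum>K\<in>UNIV. ordered_prod (($) J) K * F z $ K) = (\<Sum>K\<in>UNIV. ordered_prod (($) J') K * F z' $ K)"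
proof -
  have "of_real (Re (z $ h)) + J $ h * of_real (Im (z $ h)) =
        of_real (Re (z' $ h)) + J' $ h * of_real (Im (z' $ h))"
    using eq by (simp add: embed_def vec_eq_iff)
  from embed_component_eq [OF J(1)[rule_format] J(2)[rule_format] this]
  consider (zero) "z' $ h = z $ h" "Im (z $ h) = 0" | (same) "z' $ h = z $ h" "J' $ h = J $ h"
    | (flip) "z' $ h = cnj (z $ h)" "J' $ h = - J $ h"
    by (auto simp: complex_eq_iff)
  then have "z' \<in> D \<and> (\<forall>K. ordered_prod (($) J) K * F z $ K = ordered_prod (($) J') K * F z' $ K)"
  proof cases
    case zero
    then have zz: "z' = z" using other by (metis vec_eq_iff)
    have "ordered_prod (($) J) K * F z $ K = ordered_prod (($) J') K * F z' $ K" for K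
    proof (cases "h \<in> K")
      case True
      then show ?thesis using stem_eq_0 [OF F z True zero(2)] zz by simp
    next
      case False
      then have "ordered_prod (($) J') K = ordered_prod (($) J) K"
        by (intro ordered_prod_cong) (metis other)
      then show ?thesis using zz by simp
    qed
    then show ?thesis using zz z by simp
  next
    case same
    then have "z' = z" "J' = J" using other by (metis vec_eq_iff)+
    then show ?thesis using z by simp
  next
    case flip
    then have zz: "z' = conj_at h z"
      using other by (simp add: vec_eq_iff conj_at_def)
    have s: "F z' $ K = (-1) ^ card (K \<inter> {h}) * F z $ K" for K
      using F z unfolding stem_def zz by blast
    have p: "ordered_prod (($) J') K = (-1) ^ card (K \<inter> {h}) * ordered_prod (($) J) K" for K
      using other flip(2) by (intro ordered_prod_flip) auto
    have "ordered_prod (($) J) K * F z $ K = ordered_prod (($) J') K * F z' $ K" for K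
      unfolding s p by (cases "h \<in> K") simp_all
    moreover have "z' \<in> D" using D z zz unfolding invariant_def by blast
    ultimately show ?thesis by blast
  qed
  then show "z' \<in> D"
    "(\<Sum>K\<in>UNIV. ordered_prod (($) J) K * F z $ K) = (\<Sum>K\<in>UNIV. ordered_prod (($) J') K * F z' $ K)"
    by (auto intro: sum.cong)
qed

lemma slice_sum_unique:
  fixes J J' :: "'n::{finite,linorder} qvec"
  assumes F: "stem D F" and D: "invariant D"
    and J': "\<forall>h. J' $ h \<in> imag_units"
    and "finite A"
    and "z \<in> D" "\<forall>h. J $ h \<in> imag_units" "embed J z = embed J' z'"
    and "\<And>k. k \<notin> A \<Longrightarrow> J' $ k = J $ k \<and> z' $ k = z $ k"
  shows "(\<Sum>K\<in>UNIV. ordered_prod (($) J) K * F z $ K) = (\<Sum>K\<in>UNIV. ordered_prod (($) J') K * F z' $ K)"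
  using assms(4-)
proof (induction A arbitrary: J z rule: finite_induct)
  case empty
  then have "J' = J" "z' = z" by (auto simp: vec_eq_iff)
  then show ?case by simp
next
  case (insert h A)
  define J1 where "J1 = (\<chi> k. if k = h then J' $ k else J $ k)"
  define z1 where "z1 = (\<chi> k. if k = h then z' $ k else z $ k)"
  have J1: "\<forall>k. J1 $ k \<in> imag_units" using insert.prems J' by (simp add: J1_def)
  have e: "embed J z = embed J1 z1" "embed J1 z1 = embed J' z'"
    using insert.prems(3) by (auto simp: embed_def vec_eq_iff J1_def z1_def)
  note step = slice_sum_step [OF F D insert.prems(1,2) J1 e(1), of h]
  have "z1 \<in> D" by (rule step) (auto simp: J1_def z1_def)
  moreover have "J' $ k = J1 $ k \<and> z' $ k = z1 $ k" if "k \<notin> A" for k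
    using insert.prems(4) [of k] that by (auto simp: J1_def z1_def)
  ultimately have "(\<Sum>K\<in>UNIV. ordered_prod (($) J1) K * F z1 $ K) = (\<Sum>K\<in>UNIV. ordered_prod (($) J') K * F z' $ K)"
    using insert.IH J1 e(2) by blast
  moreover have "(\<Sum>K\<in>UNIV. ordered_prod (($) J) K * F z $ K) = (\<Sum>K\<in>UNIV. ordered_prod (($) J1) K * F z1 $ K)"
    by (rule step) (auto simp: J1_def z1_def)
  ultimately show ?case by simp
qed

lemma slice_fun_embed:
  assumes "stem D F" "invariant D" "z \<in> D" "\<forall>h. J $ h \<in> imag_units"
  shows "slice_fun D F (embed J z) = (\<Sum>K\<in>UNIV. ordered_prod (($) J) K * F z $ K)"
  unfolding slice_fun_def
proof (rule the_equality)
  show "\<forall>z'\<in>D. \<forall>J'. (\<forall>h. J' $ h \<in> imag_units) \<and> embed J z = embed J' z' \<longrightarrow>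
     (\<Sum>K\<in>UNIV. ordered_prod (($) J) K * F z $ K) = (\<Sum>K\<in>UNIV. ordered_prod (($) J') K * F z' $ K)"
    using slice_sum_unique [OF assms(1,2) _ finite_class.finite_UNIV assms(3,4)] by blast
qed (use assms in blast)

definition induces ::
    "'n::{finite,linorder} cvec set \<Rightarrow> ('n cvec \<Rightarrow> 'n stem_val)
      \<Rightarrow> ('n qvec \<Rightarrow> quat) \<Rightarrow> bool" where
  "induces D F f \<longleftrightarrow> (\<forall>x\<in>circularization D. f x = slice_fun D F x)"

text \<open>Functions on the circularization of \<open>D\<close> are total functions of which only the values there
  are constrained; the set \<open>D\<close> is passed instead of its circularization.\<close>

definition slice_functions ::
    "'n::{finite,linorder} cvec set \<Rightarrow> ('n qvec \<Rightarrow> quat) set" where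
  "slice_functions D = {f. \<exists>F. stem D F \<and> induces D F f}"

definition slice_preserving_functions ::
    "'n::{finite,linorder} cvec set \<Rightarrow> ('n qvec \<Rightarrow> quat) set" where
  "slice_preserving_functions D =
     {f. \<exists>F. stem D F \<and> induces D F f \<and> (\<forall>z\<in>D. \<forall>K. F z $ K \<in> \<real>)}"

text \<open>The values on \<open>D\<close> of the stem function of a slice function are unique.\<close>

definition stem_of ::
    "'n::{finite,linorder} cvec set \<Rightarrow> ('n qvec \<Rightarrow> quat) \<Rightarrow> 'n cvec \<Rightarrow> 'n stem_val"
  where
  "stem_of D f = (SOME F. stem D F \<and> induces D F f)"

definition stem_mult ::
    "('n::finite cvec \<Rightarrow> 'n stem_val) \<Rightarrow> ('n cvec \<Rightarrow> 'n stem_val)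
      \<Rightarrow> 'n cvec \<Rightarrow> 'n stem_val" where
  "stem_mult F G z =
     (\<Sum>H\<in>UNIV. \<Sum>K\<in>UNIV. axis (sym_diff K H) ((-1) ^ card (H \<inter> K) * (F z $ K * G z $ H)))"

definition slice_mult ::
    "'n::{finite,linorder} cvec set \<Rightarrow> ('n qvec \<Rightarrow> quat) \<Rightarrow> ('n qvec \<Rightarrow> quat)
      \<Rightarrow> 'n qvec \<Rightarrow> quat" where
  "slice_mult D f g = slice_fun D (stem_mult (stem_of D f) (stem_of D g))"

definition coord :: "'n::{finite,linorder} cvec set \<Rightarrow> 'n \<Rightarrow> 'n qvec \<Rightarrow> quat" where
  "coord D j =
     slice_fun D (\<lambda>z. axis {} (of_real (Re (z $ j))) + axis {j} (of_real (Im (z $ j))))"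

lemma coord_eq:
  assumes "invariant D" "x \<in> circularization D"
  shows "coord D j x = x $ j"
proof -
  obtain J z where x: "x = embed J z" "z \<in> D" and J: "\<forall>h. J $ h \<in> imag_units"
    using assms(2) unfolding circularization_def by blast
  let ?Z = "\<lambda>z::'a cvec. axis {} (of_real (Re (z $ j))) + axis {j} (of_real (Im (z $ j))) :: 'a stem_val"
  have "stem D ?Z"
    unfolding stem_def
  proof (intro conjI ballI allI)
    show "continuous_on D ?Z"
      unfolding axis_def
    proof (intro continuous_on_add continuous_on_vec_lambda)
      show "continuous_on D (\<lambda>z. if K = {} then of_real (Re (z $ j)) else 0 :: quat)" for K :: "'a set"
        by (cases "K = {}") (auto intro!: continuous_intros)
      show "continuous_on D (\<lambda>z. if K = {j} then of_real (Im (z $ j)) else 0 :: quat)" for K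
        by (cases "K = {j}") (auto intro!: continuous_intros)
    qed
  next
    fix z :: "'a cvec" and K h
    show "?Z (conj_at h z) $ K = (-1) ^ card (K \<inter> {h}) * ?Z z $ K"
      by (auto simp: axis_def conj_at_def)
  qed
  from slice_fun_embed [OF this assms(1) x(2) J]
  have "coord D j x = (\<Sum>K\<in>UNIV. ordered_prod (($) J) K * ?Z z $ K)"
    by (simp add: coord_def x(1))
  also have "\<dots> = (\<Sum>K\<in>{{}, {j}}. ordered_prod (($) J) K * ?Z z $ K)"
    by (rule sum.mono_neutral_right) (auto simp: axis_def)
  also have "\<dots> = x $ j"
    by (simp add: x(1) embed_def axis_def ordered_prod_def)
  finally show ?thesis .
qed
definition conj_coord :: "'n::{finite,linorder} cvec set \<Rightarrow> 'n \<Rightarrow> 'n qvec \<Rightarrow> quat" where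
  "conj_coord D j =
     slice_fun D (\<lambda>z. axis {} (of_real (Re (z $ j))) - axis {j} (of_real (Im (z $ j))))"

definition coord_prod ::
    "'n::{finite,linorder} cvec set \<Rightarrow> 'n set \<Rightarrow> 'n qvec \<Rightarrow> quat" where
  "coord_prod D K x = ordered_prod (\<lambda>k. coord D k x) K"

definition conj_coord_prod ::
    "'n::{finite,linorder} cvec set \<Rightarrow> 'n set \<Rightarrow> 'n qvec \<Rightarrow> quat" where
  "conj_coord_prod D K x = ordered_prod (\<lambda>k. conj_coord D k x) K"

section \<open>Slice regularity\<close>

definition stem_J :: "'n::finite \<Rightarrow> 'n stem_val \<Rightarrow> 'n stem_val" where
  "stem_J h w = (\<Sum>K\<in>UNIV. axis (sym_diff K {h}) ((-1) ^ card (K \<inter> {h}) * w $ K))"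

definition directional_deriv ::
    "'a::real_normed_vector \<Rightarrow> ('a \<Rightarrow> 'b::real_normed_vector) \<Rightarrow> 'a \<Rightarrow> 'b" where
  "directional_deriv v F z = vector_derivative (\<lambda>t. F (z + t *\<^sub>R v)) (at 0)"

definition dbar ::
    "'n::finite \<Rightarrow> ('n cvec \<Rightarrow> 'n stem_val) \<Rightarrow> 'n cvec \<Rightarrow> 'n stem_val" where
  "dbar h F z = (1/2) *\<^sub>R
     (directional_deriv (axis h 1) F z + stem_J h (directional_deriv (axis h \<i>) F z))"

definition C1_on ::
    "'a::real_normed_vector set \<Rightarrow> ('a \<Rightarrow> 'b::real_normed_vector) \<Rightarrow> bool" where
  "C1_on D F \<longleftrightarrow> (\<exists>F' :: 'a \<Rightarrow> 'a \<Rightarrow>\<^sub>L 'b.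
     (\<forall>z\<in>D. (F has_derivative blinfun_apply (F' z)) (at z)) \<and> continuous_on D F')"

definition holomorphic_stem ::
    "'n::finite cvec set \<Rightarrow> ('n cvec \<Rightarrow> 'n stem_val) \<Rightarrow> bool" where
  "holomorphic_stem D F \<longleftrightarrow> stem D F \<and> C1_on D F \<and> (\<forall>z\<in>D. \<forall>h. dbar h F z = 0)"

definition slice_regular_functions ::
    "'n::{finite,linorder} cvec set \<Rightarrow> ('n qvec \<Rightarrow> quat) set" where
  "slice_regular_functions D = {f. \<exists>F. holomorphic_stem D F \<and> induces D F f}"

section \<open>Properties with respect to a single variable\<close>

definition replace_at :: "'n::finite qvec \<Rightarrow> 'n \<Rightarrow> quat \<Rightarrow> 'n qvec" where
  "replace_at y h x = (\<chi> k. if k = h then x else y $ k)"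

definition section_dom :: "'n::finite cvec set \<Rightarrow> 'n \<Rightarrow> 'n qvec \<Rightarrow> quat set" where
  "section_dom D h y = {x. replace_at y h x \<in> circularization D}"

text \<open>A one-variable domain \<open>\<Omega>\<close> is the circularization of a (unique) invariant plane set \<open>E\<close>.\<close>

definition slice_functions_1 :: "quat set \<Rightarrow> (quat \<Rightarrow> quat) set" where
  "slice_functions_1 \<Omega> = {g. \<exists>E :: (1 cvec) set. invariant E \<and>
     circularization E = {v. v $ 1 \<in> \<Omega>} \<and> (\<lambda>v. g (v $ 1)) \<in> slice_functions E}"

definition slice_regular_functions_1 :: "quat set \<Rightarrow> (quat \<Rightarrow> quat) set" where
  "slice_regular_functions_1 \<Omega> = {g. \<exists>E :: (1 cvec) set. invariant E \<and>
     circularization E = {v. v $ 1 \<in> \<Omega>} \<and> (\<lambda>v. g (v $ 1)) \<in> slice_regular_functions E}"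

definition slice_functions_wrt ::
    "'n::{finite,linorder} cvec set \<Rightarrow> 'n \<Rightarrow> ('n qvec \<Rightarrow> quat) set" where
  "slice_functions_wrt D h = {f \<in> slice_functions D. \<forall>y\<in>circularization D.
     (\<lambda>x. f (replace_at y h x)) \<in> slice_functions_1 (section_dom D h y)}"

definition slice_regular_functions_wrt ::
    "'n::{finite,linorder} cvec set \<Rightarrow> 'n \<Rightarrow> ('n qvec \<Rightarrow> quat) set" where
  "slice_regular_functions_wrt D h = {f \<in> slice_functions D. \<forall>y\<in>circularization D.
     (\<lambda>x. f (replace_at y h x)) \<in> slice_regular_functions_1 (section_dom D h y)}"

definition quat_sphere :: "real \<Rightarrow> real \<Rightarrow> quat set" where
  "quat_sphere \<alpha> \<beta> = {of_real \<alpha> + J * of_real \<beta> | J. J \<in> imag_units}"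

definition circular_functions_wrt ::
    "'n::{finite,linorder} cvec set \<Rightarrow> 'n \<Rightarrow> ('n qvec \<Rightarrow> quat) set" where
  "circular_functions_wrt D h = {f \<in> slice_functions D. \<forall>y\<in>circularization D. \<forall>\<alpha> \<beta>.
     quat_sphere \<alpha> \<beta> \<subseteq> section_dom D h y \<longrightarrow>
     (\<lambda>x. f (replace_at y h x)) constant_on quat_sphere \<alpha> \<beta>}"

text \<open>For \<open>H = {}\<close> the intersection is taken inside the set of all slice functions.\<close>

definition circular_functions_wrt_set ::
    "'n::{finite,linorder} cvec set \<Rightarrow> 'n set \<Rightarrow> ('n qvec \<Rightarrow> quat) set" where
  "circular_functions_wrt_set D H =
     slice_functions D \<inter> (\<Inter>h\<in>H. circular_functions_wrt D h)"

section \<open>Spherical derivatives and components\<close>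

definition nonreal_part :: "'n::finite cvec set \<Rightarrow> 'n set \<Rightarrow> 'n cvec set" where
  "nonreal_part D H = {z \<in> D. \<forall>h\<in>H. Im (z $ h) \<noteq> 0}"

definition spherical_deriv ::
    "'n::{finite,linorder} cvec set \<Rightarrow> 'n set \<Rightarrow> ('n qvec \<Rightarrow> quat) \<Rightarrow> 'n qvec \<Rightarrow> quat"
  where
  "spherical_deriv D H f = slice_fun (nonreal_part D H)
     (\<lambda>z. inverse (\<Prod>h\<in>H. Im (z $ h)) *\<^sub>R (\<Sum>K\<in>Pow (- H). axis K (stem_of D f z $ (K \<union> H))))"

definition spherical_component ::
    "'n::{finite,linorder} cvec set \<Rightarrow> 'n set \<Rightarrow> 'n set \<Rightarrow> ('n qvec \<Rightarrow> quat)
      \<Rightarrow> 'n qvec \<Rightarrow> quat" where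
  "spherical_component D H K f = spherical_deriv D H (slice_mult D (coord_prod D K) f)"

definition continuous_extension ::
    "'a::topological_space set \<Rightarrow> 'a set \<Rightarrow> ('a \<Rightarrow> 'b::topological_space) \<Rightarrow> ('a \<Rightarrow> 'b) \<Rightarrow> bool"
  where
  "continuous_extension A B f g \<longleftrightarrow> continuous_on B g \<and> (\<forall>x\<in>A. g x = f x)"

text \<open>The Laplacian in the four real coordinates of \<open>x_h\<close>, as a relation: the second partial
  derivatives are required to exist. (With a total derivative operator, a nowhere differentiable
  function would get a constant first and hence a vanishing second derivative.)\<close>

definition has_laplacian_wrt ::
    "'n::finite \<Rightarrow> ('n qvec \<Rightarrow> quat) \<Rightarrow> quat \<Rightarrow> 'n qvec \<Rightarrow> bool" where
  "has_laplacian_wrt h g L x \<longleftrightarrow> (\<exists>g1 :: quat \<Rightarrow> real \<Rightarrow> quat. \<exists>g2 :: quat \<Rightarrow> quat.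
     (\<forall>b\<in>Basis.
        (\<forall>\<^sub>F s in nhds 0.
           ((\<lambda>t. g (x + t *\<^sub>R axis h b)) has_vector_derivative g1 b s) (at s)) \<and>
        (g1 b has_vector_derivative g2 b) (at 0)) \<and>
     L = (\<Sum>b\<in>Basis. g2 b))"

end

theory Submission
  imports Defs "HOL-Complex_Analysis.Cauchy_Integral_Formula"
begin

text \<open>Stem functions replace slice functions throughout; this makes the statements without regularity
algebraic. A stem function is determined by its slice function, because averaging the values
at \<open>(\<plusminus>J_1,\<dots>,\<plusminus>J_n)\<close> against the sign characters isolates one summand \<open>J_K F_K\<close>. The component
\<open>\<S>^H_K(f)\<close> has the stem function which at \<open>e_L\<close>, for \<open>L\<close> disjoint from \<open>H\<close>, equals
\<open>\<beta>_H\<^sup>-\<^sup>1 (\<Sum>M\<subseteq>K. \<alpha>_{K-M} \<beta>_M F_{L \<union> (H-M)})\<close> and which vanishes at every other \<open>e_L\<close>. Hence it is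
circular in the variables of \<open>H\<close>, and it is slice in the first remaining variable \<open>x_p\<close>, since there
\<open>J_p\<close> is the leftmost imaginary unit of every ordered product that occurs. Moebius inversion over the
subsets of \<open>H\<close> expresses \<open>F\<close> through the components (\<open>stem_from_components\<close>), with coefficients that
are real polynomials in \<open>\<alpha>_k, \<beta>_k\<close> for \<open>k \<in> H\<close>; this is the decomposition formula, and with
\<open>H = {1,\<dots>,n}\<close> it also shows that real components force real \<open>F_K\<close>.

The analytic statements rest on the remark that on an open set a stem function \<open>F\<close> is holomorphic exactly when it is
continuous and, for each \<open>h\<close> and each \<open>L\<close> not containing \<open>h\<close>, the real components of
\<open>F_L + i F_{L \<union> {h}}\<close> are holomorphic in \<open>z_h\<close> alone (\<open>holo_var\<close>). The passage from separate to joint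
regularity is Osgood's argument: Cauchy's inequality makes the partial derivatives continuous.
Dividing by \<open>\<beta>_h\<close> the part of a stem function that is odd in \<open>\<beta>_h\<close> extends continuously across
\<open>\<beta>_h = 0\<close>, where the quotient becomes a derivative, and the extension is still holomorphic in the
other variables, as a locally uniform limit. Iteration over \<open>H\<close> extends \<open>\<S>^H_K(f)\<close> to a slice function on
all of the domain which is regular in \<open>x_p\<close>. Its harmonicity in \<open>x_h\<close> for \<open>h \<in> H\<close>, real points included,
comes from Cauchy's formula: \<open>Im \<phi>(w) / Im w\<close> is the real part of a contour integral of \<open>\<phi>(\<zeta>)\<close> against
the kernel \<open>1 / ((\<zeta> - Re x)\<^sup>2 + |Im x|\<^sup>2)\<close>, up to a constant factor, and this kernel is the complexified
fundamental solution of the Laplacian of \<open>\<real>\<^sup>4\<close>.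

Conversely, let the components be regular in their first free variable. For each \<open>h\<close> the choice
\<open>H = {k. k < h}\<close> makes \<open>h\<close> that variable. The inversion formula, extended from the dense set
where \<open>\<beta>_k \<noteq> 0\<close> for all \<open>k < h\<close> to the whole of \<open>D\<close> by continuity, has coefficients that do not depend on
\<open>z_h\<close>; so it shows that \<open>F\<close> is holomorphic in \<open>z_h\<close>.\<close>

section \<open>Holomorphy in one of several complex variables\<close>

definition holo_along :: "'n::finite \<Rightarrow> ('n cvec \<Rightarrow> complex) \<Rightarrow> 'n cvec \<Rightarrow> bool" where
  "holo_along h \<phi> z \<longleftrightarrow> (\<lambda>u. \<phi> (z + axis h u)) field_differentiable at 0"

definition cderiv :: "'n::finite \<Rightarrow> ('n cvec \<Rightarrow> complex) \<Rightarrow> 'n cvec \<Rightarrow> complex" where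
  "cderiv h \<phi> z = deriv (\<lambda>u. \<phi> (z + axis h u)) 0"

lemma axis_zero [simp]: "axis h 0 = (0 :: 'a::zero ^ 'n::finite)"
  by (simp add: axis_def vec_eq_iff)

lemma axis_plus: "axis h (u + v) = axis h u + (axis h v :: 'a::monoid_add ^ 'n::finite)"
  by (simp add: axis_def vec_eq_iff)

lemma norm_axis_eq [simp]: "norm (axis h u :: 'a::real_normed_vector ^ 'n::finite) = norm u"
proof -
  have "norm (axis h u :: 'a ^ 'n) = L2_set (\<lambda>i. if i = h then norm u else 0) UNIV"
    unfolding norm_vec_def by (rule L2_set_cong) (auto simp: axis_def)
  also have "\<dots> = norm u" by (simp add: L2_set_def if_distrib [where f = "\<lambda>x. x\<^sup>2"] cong: if_cong)
  finally show ?thesis .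
qed

lemma bounded_linear_axis: "bounded_linear (axis h :: 'a::real_normed_vector \<Rightarrow> 'a ^ 'n::finite)"
proof (rule bounded_linear_intro [where K = 1])
  show "axis h (r *\<^sub>R x) = r *\<^sub>R (axis h x :: 'a ^ 'n)" for r x
    by (simp add: vec_eq_iff axis_def)
qed (auto simp: axis_plus)

lemmas continuous_on_axis [continuous_intros] = bounded_linear.continuous_on [OF bounded_linear_axis]

lemma open_axis_section:
  fixes z :: "'a::real_normed_vector ^ 'n::finite"
  shows "open D \<Longrightarrow> open {u. z + axis h u \<in> D}"
proof -
  assume "open D"
  have "continuous_on UNIV (\<lambda>u. z + axis h u)" by (intro continuous_intros)
  from open_vimage [OF \<open>open D\<close> this] show ?thesis by (simp add: vimage_def)
qed

lemma holo_along_has_derivative: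
  assumes "holo_along h \<phi> (z + axis h u)"
  shows "((\<lambda>u. \<phi> (z + axis h u)) has_field_derivative cderiv h \<phi> (z + axis h u)) (at u)"
proof -
  have "((\<lambda>v. \<phi> (z + axis h u + axis h v)) has_field_derivative cderiv h \<phi> (z + axis h u)) (at 0)"
    using assms unfolding holo_along_def cderiv_def by (simp add: DERIV_deriv_iff_field_differentiable)
  then have "((\<lambda>v. \<phi> (z + axis h (v + u))) has_field_derivative cderiv h \<phi> (z + axis h u)) (at 0)"
    by (simp add: axis_plus add_ac)
  then show ?thesis using DERIV_shift [of "\<lambda>v. \<phi> (z + axis h v)" _ 0 u] by simp
qed

lemma holo_along_holomorphic_on:
  assumes "\<And>z. z \<in> D \<Longrightarrow> holo_along h \<phi> z" "\<And>u. u \<in> S \<Longrightarrow> z + axis h u \<in> D"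
  shows "(\<lambda>u. \<phi> (z + axis h u)) holomorphic_on S"
  unfolding holomorphic_on_def
  by (metis assms field_differentiable_at_within field_differentiable_def holo_along_has_derivative)

lemma holo_along_cong:
  assumes "open D" "z \<in> D" "\<And>z. z \<in> D \<Longrightarrow> \<phi> z = \<psi> z" "holo_along h \<psi> z"
  shows "holo_along h \<phi> z"
proof -
  obtain d where d: "((\<lambda>u. \<psi> (z + axis h u)) has_field_derivative d) (at 0)"
    using assms(4) unfolding holo_along_def field_differentiable_def by blast
  have "((\<lambda>u. \<phi> (z + axis h u)) has_field_derivative d) (at 0)"
    by (rule has_field_derivative_transform_within_open [OF d open_axis_section [OF assms(1), of z h]])
       (use assms(2,3) in auto)
  then show ?thesis unfolding holo_along_def field_differentiable_def by blast
qed

text \<open>The derivative in one variable is a Cauchy integral over a circle whose radius can be kept fixed near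
a given point, so it depends on the base point as continuously as \<open>\<phi>\<close> does. Cauchy's inequality for the
difference of two translates of \<open>\<phi>\<close> gives this without writing the integral.\<close>

lemma continuous_on_cderiv:
  fixes \<phi> :: "'n::finite cvec \<Rightarrow> complex"
  assumes D: "open D" and cont: "continuous_on D \<phi>" and hol: "\<And>z. z \<in> D \<Longrightarrow> holo_along h \<phi> z"
  shows "continuous_on D (cderiv h \<phi>)"
  unfolding continuous_on_iff
proof (intro ballI allI impI)
  fix z0 and e :: real assume z0: "z0 \<in> D" and e: "e > 0"
  obtain R where R: "R > 0" "cball z0 R \<subseteq> D" using D z0 open_contains_cball by blast
  define r where "r = R/3"
  have r: "r > 0" using R by (simp add: r_def)
  have "uniformly_continuous_on (cball z0 R) \<phi>"
    using cont R by (intro compact_uniformly_continuous) (auto intro: continuous_on_subset)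
  moreover have "e * r / 2 > 0" using e r by simp
  ultimately obtain d where d: "d > 0" "\<And>x x'. x \<in> cball z0 R \<Longrightarrow> x' \<in> cball z0 R \<Longrightarrow> dist x' x < d \<Longrightarrow> dist (\<phi> x') (\<phi> x) < e * r / 2"
    unfolding uniformly_continuous_on_def by meson
  show "\<exists>d>0. \<forall>z\<in>D. dist z z0 < d \<longrightarrow> dist (cderiv h \<phi> z) (cderiv h \<phi> z0) < e"
  proof (intro exI conjI ballI impI)
    show "min d r > 0" using d r by simp
    fix z assume z: "z \<in> D" "dist z z0 < min d r"
    have in_R: "y + axis h u \<in> cball z0 R" if "y = z \<or> y = z0" "norm u \<le> 2 * r" for u y
    proof -
      have "norm (z0 - (y + axis h u)) \<le> norm (z0 - y) + norm (axis h u :: 'n cvec)"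
        by (metis diff_diff_add norm_triangle_ineq4)
      also have "\<dots> \<le> r + 2 * r" using that z r by (auto simp: dist_norm norm_minus_commute)
      finally show ?thesis by (simp add: r_def dist_norm)
    qed
    let ?f = "\<lambda>u. \<phi> (z + axis h u) - \<phi> (z0 + axis h u)"
    have hol': "(\<lambda>u. \<phi> (y + axis h u)) holomorphic_on ball 0 (2 * r)" if "y = z \<or> y = z0" for y
      using in_R [OF that] R(2) by (intro holo_along_holomorphic_on [OF hol]) auto
    \<comment> \<open>Half of \<open>e r\<close> in the choice of \<open>d\<close> turns the weak Cauchy bound into a strict one.\<close>
    have "cmod ((deriv ^^ 1) ?f 0) \<le> fact 1 * (e * r / 2) / r ^ 1"
    proof (rule Cauchy_inequality)
      have "?f holomorphic_on ball 0 (2 * r)" by (intro holomorphic_intros hol') auto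
      then show "?f holomorphic_on ball 0 r" "continuous_on (cball 0 r) ?f"
        using r by (auto intro: holomorphic_on_subset holomorphic_on_imp_continuous_on continuous_on_subset)
      fix u assume "cmod (0 - u) = r"
      then have u: "norm u \<le> 2 * r" using r by simp
      have "dist (z + axis h u) (z0 + axis h u) < d" using z by (simp add: dist_norm)
      from d(2) [OF in_R in_R this] u
      show "cmod (?f u) \<le> e * r / 2" by (simp add: dist_norm)
    qed (use r in simp)
    moreover have "deriv ?f 0 = cderiv h \<phi> z - cderiv h \<phi> z0"
      unfolding cderiv_def using hol [OF z(1)] hol [OF z0]
      by (intro deriv_diff) (auto simp: holo_along_def)
    ultimately show "dist (cderiv h \<phi> z) (cderiv h \<phi> z0) < e"
      using r e by (simp add: dist_norm)
  qed
qed

text \<open>By continuity, holomorphy in \<open>z_k\<close> survives on the slices \<open>Im z_h = 0\<close>: there the function is the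
locally uniform limit of its restrictions to \<open>Im z_h = t\<close> with \<open>t \<rightarrow> 0\<close>, so Weierstrass' theorem applies.\<close>

lemma holo_along_real_limit:
  fixes \<psi> :: "'n::finite cvec \<Rightarrow> complex"
  assumes D: "open D" and cont: "continuous_on D \<psi>" and kh: "k \<noteq> h"
    and hol: "\<And>z. z \<in> D \<Longrightarrow> Im (z $ h) \<noteq> 0 \<Longrightarrow> holo_along k \<psi> z" and z: "z \<in> D"
  shows "holo_along k \<psi> z"
proof (cases "Im (z $ h) = 0")
  case True
  obtain R where R: "R > 0" "cball z R \<subseteq> D" using D z open_contains_cball by blast
  define r where "r = R/2"
  have r: "r > 0" using R by (simp add: r_def)
  let ?f = "\<lambda>t u. \<psi> (z + axis h (complex_of_real t * \<i>) + axis k u)"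
  have in_R: "z + axis h (complex_of_real t * \<i>) + axis k u \<in> cball z R" if "\<bar>t\<bar> \<le> r" "cmod u \<le> r" for t u
  proof -
    have "dist z (z + axis h (complex_of_real t * \<i>) + axis k u)
       = norm (axis h (complex_of_real t * \<i>) + axis k u :: 'n cvec)"
      by (simp add: dist_norm norm_minus_commute flip: diff_diff_add)
         (metis add.commute minus_add_distrib norm_minus_cancel uminus_add_conv_diff)
    also have "\<dots> \<le> \<bar>t\<bar> + cmod u"
      using norm_triangle_ineq [of "axis h (complex_of_real t * \<i>) :: 'n cvec" "axis k u"] by (simp add: norm_mult)
    finally show ?thesis using that by (simp add: r_def)
  qed
  have unif: "uniformly_continuous_on (cball z R) \<psi>"
    using cont R by (intro compact_uniformly_continuous) (auto intro: continuous_on_subset)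
  have lim: "uniform_limit (cball 0 r) ?f (?f 0) (at_right 0)"
  proof (rule uniform_limitI)
    fix e :: real assume "e > 0"
    then obtain d where d: "d > 0" "\<And>x x'. x \<in> cball z R \<Longrightarrow> x' \<in> cball z R \<Longrightarrow> dist x' x < d \<Longrightarrow> dist (\<psi> x') (\<psi> x) < e"
      using unif unfolding uniformly_continuous_on_def by meson
    have "\<forall>\<^sub>F t in at_right (0::real). t \<in> {0<..<min d r}"
      using d r by (intro eventually_at_right_real) auto
    then show "\<forall>\<^sub>F t in at_right 0. \<forall>u\<in>cball 0 r. dist (?f t u) (?f 0 u) < e"
    proof eventually_elim
      case (elim t)
      show ?case
      proof
        fix u :: complex assume u: "u \<in> cball 0 r"
        show "dist (?f t u) (?f 0 u) < e"
          using u elim r by (intro d(2) in_R) (auto simp: dist_norm norm_mult)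
      qed
    qed
  qed
  have ev: "\<forall>\<^sub>F t in at_right 0. continuous_on (cball 0 r) (?f t) \<and> ?f t holomorphic_on ball 0 r"
  proof -
    have "\<forall>\<^sub>F t in at_right (0::real). t \<in> {0<..<r}"
      using r by (intro eventually_at_right_real) auto
    then show ?thesis
    proof eventually_elim
      case (elim t)
      have sub: "(\<lambda>u. z + axis h (complex_of_real t * \<i>) + axis k u) ` cball 0 r \<subseteq> D"
        using in_R [of t] elim R(2) by auto
      have "continuous_on (cball 0 r) (?f t)"
        by (intro continuous_on_compose2 [OF cont _ sub] continuous_intros)
      moreover have "?f t holomorphic_on ball 0 r"
      proof (rule holo_along_holomorphic_on [where D = "{w \<in> D. Im (w $ h) \<noteq> 0}"])
        show "z + axis h (complex_of_real t * \<i>) + axis k u \<in> {w \<in> D. Im (w $ h) \<noteq> 0}" if "u \<in> ball 0 r" for u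
          using that sub True elim kh by (auto simp: axis_def)
      qed (use hol in auto)
      ultimately show ?case ..
    qed
  qed
  have "?f 0 holomorphic_on ball 0 r"
    using holomorphic_uniform_limit [OF ev lim] by auto
  then have "(\<lambda>u. \<psi> (z + axis k u)) holomorphic_on ball 0 r" by simp
  then show ?thesis unfolding holo_along_def
    using r by (intro holomorphic_on_imp_differentiable_at [where s = "ball 0 r"]) auto
qed (use hol z in auto)

text \<open>The quotient \<open>Im \<phi>(z) / Im z_h\<close>, with the value that makes it continuous when \<open>Im \<phi>\<close> vanishes on
\<open>Im z_h = 0\<close>: the derivative of \<open>Im \<phi>\<close> in the direction of \<open>Im z_h\<close>, which by the Cauchy-Riemann
equations is the real part of the complex derivative.\<close>

definition Im_quotient :: "'n::finite \<Rightarrow> ('n cvec \<Rightarrow> complex) \<Rightarrow> 'n cvec \<Rightarrow> real" where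
  "Im_quotient h \<phi> z = (if Im (z $ h) = 0 then Re (cderiv h \<phi> z) else Im (\<phi> z) / Im (z $ h))"

text \<open>The mean value theorem on the vertical segment from the real axis to \<open>z_h\<close>. It reduces the
continuity of the quotient at real points to that of the complex derivative.\<close>

lemma Im_quotient_mean_value:
  fixes \<phi> :: "'n::finite cvec \<Rightarrow> complex"
  assumes hol: "\<And>z. z \<in> D \<Longrightarrow> holo_along h \<phi> z" and b: "Im (z $ h) \<noteq> 0"
    and sub: "\<And>t. t \<in> closed_segment 0 (Im (z $ h)) \<Longrightarrow> z + axis h (complex_of_real (t - Im (z $ h)) * \<i>) \<in> D"
    and zero: "Im (\<phi> (z + axis h (- complex_of_real (Im (z $ h)) * \<i>))) = 0"
  obtains t where "t \<in> closed_segment 0 (Im (z $ h))"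
    "Im (\<phi> z) / Im (z $ h) = Re (cderiv h \<phi> (z + axis h (complex_of_real (t - Im (z $ h)) * \<i>)))"
proof -
  let ?b = "Im (z $ h)"
  let ?p = "\<lambda>t. z + axis h (complex_of_real (t - ?b) * \<i>)"
  let ?v = "\<lambda>t. Im (\<phi> (?p t))"
  have der: "(?v has_real_derivative Re (cderiv h \<phi> (?p t))) (at t)" if "t \<in> closed_segment 0 ?b" for t
  proof -
    have "((\<lambda>u. \<phi> (z + axis h u)) has_field_derivative cderiv h \<phi> (?p t)) (at (complex_of_real (t - ?b) * \<i>))"
      by (rule holo_along_has_derivative [OF hol [OF sub [OF that]]])
    then have "((\<lambda>t. \<phi> (?p t)) has_vector_derivative \<i> * cderiv h \<phi> (?p t)) (at t)"
      by (intro field_vector_diff_chain_at [where g = "\<lambda>u. \<phi> (z + axis h u)" and f = "\<lambda>t. complex_of_real (t - ?b) * \<i>", unfolded o_def])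
         (auto intro!: derivative_eq_intros simp: scaleR_conv_of_real)
    then have "(?v has_vector_derivative Im (\<i> * cderiv h \<phi> (?p t))) (at t)"
      by (rule bounded_linear.has_vector_derivative [OF bounded_linear_Im])
    then show ?thesis by (simp add: has_real_derivative_iff_has_vector_derivative)
  qed
  have v0: "?v 0 = 0" using zero by simp
  have vb: "?v ?b = Im (\<phi> z)" by (simp add: axis_def vec_eq_iff zero_vec_def[symmetric])
  show ?thesis
  proof (cases "?b > 0")
    case True
    then obtain t where t: "0 < t" "t < ?b" "?v ?b - ?v 0 = (?b - 0) * Re (cderiv h \<phi> (?p t))"
      using MVT2 [of 0 ?b ?v "\<lambda>t. Re (cderiv h \<phi> (?p t))"] der by (auto simp: closed_segment_eq_real_ivl)
    show ?thesis by (rule that [of t]) (use t v0 vb b in \<open>auto simp: closed_segment_eq_real_ivl\<close>)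
  next
    case False
    with b have "?b < 0" by simp
    then obtain t where t: "?b < t" "t < 0" "?v 0 - ?v ?b = (0 - ?b) * Re (cderiv h \<phi> (?p t))"
      using MVT2 [of ?b 0 ?v "\<lambda>t. Re (cderiv h \<phi> (?p t))"] der by (auto simp: closed_segment_eq_real_ivl)
    show ?thesis by (rule that [of t]) (use t v0 vb b in \<open>auto simp: closed_segment_eq_real_ivl field_simps\<close>)
  qed
qed

lemma continuous_on_Im_quotient:
  fixes \<phi> :: "'n::finite cvec \<Rightarrow> complex"
  assumes D: "open D" and cont: "continuous_on D \<phi>" and hol: "\<And>z. z \<in> D \<Longrightarrow> holo_along h \<phi> z"
    and zero: "\<And>z. z \<in> D \<Longrightarrow> Im (z $ h) = 0 \<Longrightarrow> Im (\<phi> z) = 0"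
  shows "continuous_on D (Im_quotient h \<phi>)"
  unfolding continuous_on_eq_continuous_at [OF D]
proof
  fix z0 assume z0: "z0 \<in> D"
  show "isCont (Im_quotient h \<phi>) z0"
  proof (cases "Im (z0 $ h) = 0")
    case False
    have "isCont \<phi> z0" using cont D z0 continuous_on_eq_continuous_at by blast
    then have "isCont (\<lambda>z. Im (\<phi> z) / Im (z $ h)) z0" using False by (intro continuous_intros) auto
    moreover have "\<forall>\<^sub>F z in nhds z0. z \<in> {z. Im (z $ h) \<noteq> 0}"
    proof (rule eventually_nhds_in_open)
      have "open {z. Im (z $ h) \<noteq> Im 0}" by (intro open_Collect_neq continuous_intros)
      then show "open {z. Im (z $ h) \<noteq> 0}" by simp
    qed (use False in simp)
    then have "\<forall>\<^sub>F z in nhds z0. Im_quotient h \<phi> z = Im (\<phi> z) / Im (z $ h)"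
      by eventually_elim (simp add: Im_quotient_def)
    ultimately show ?thesis by (simp add: isCont_cong)
  next
    case True
    have cd: "continuous_on D (cderiv h \<phi>)" by (rule continuous_on_cderiv [OF D cont hol])
    show ?thesis
      unfolding continuous_at_eps_delta
    proof (intro allI impI)
      fix e :: real assume "e > 0"
      moreover have "isCont (cderiv h \<phi>) z0" using cd D z0 continuous_on_eq_continuous_at by blast
      ultimately obtain d1 where d1: "d1 > 0" "\<And>z. dist z z0 < d1 \<Longrightarrow> dist (cderiv h \<phi> z) (cderiv h \<phi> z0) < e"
        unfolding continuous_at_eps_delta by meson
      obtain d2 where d2: "d2 > 0" "ball z0 d2 \<subseteq> D" using D z0 open_contains_ball by blast
      define d where "d = min d1 d2"
      have Re_less: "\<bar>Re (cderiv h \<phi> z) - Re (cderiv h \<phi> z0)\<bar> < e" if "dist z z0 < d" for z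
        using d1(2) [of z] that abs_Re_le_cmod [of "cderiv h \<phi> z - cderiv h \<phi> z0"] by (simp add: d_def dist_norm)
      show "\<exists>d>0. \<forall>z. dist z z0 < d \<longrightarrow> dist (Im_quotient h \<phi> z) (Im_quotient h \<phi> z0) < e"
      proof (intro exI conjI allI impI)
        show "d > 0" using d1 d2 by (simp add: d_def)
        fix z assume z: "dist z z0 < d"
        show "dist (Im_quotient h \<phi> z) (Im_quotient h \<phi> z0) < e"
        proof (cases "Im (z $ h) = 0")
          case True
          then show ?thesis using Re_less [OF z] \<open>Im (z0 $ h) = 0\<close> by (simp add: Im_quotient_def dist_norm)
        next
          case False
          let ?b = "Im (z $ h)"
          let ?p = "\<lambda>t. z + axis h (complex_of_real (t - ?b) * \<i>)"
          have near: "dist (?p t) z0 < d" if t: "t \<in> closed_segment 0 ?b" for t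
          proof -
            have "dist (?p t) z0 \<le> dist z z0"
              unfolding dist_norm
            proof (rule norm_le_componentwise_cart)
              fix k
              show "norm ((?p t - z0) $ k) \<le> norm ((z - z0) $ k)"
              proof (cases "k = h")
                case True
                have "\<bar>t\<bar> \<le> \<bar>?b\<bar>" using t by (auto simp: closed_segment_eq_real_ivl split: if_splits)
                then show ?thesis
                  using True \<open>Im (z0 $ h) = 0\<close> by (simp add: axis_def cmod_def abs_le_square_iff)
              qed (simp add: axis_def)
            qed
            with z show ?thesis by simp
          qed
          have inD: "?p t \<in> D" if "t \<in> closed_segment 0 ?b" for t
            using near [OF that] d2(2) by (auto simp: d_def dist_commute)
          have "?p 0 \<in> D" by (rule inD) simp
          then have "Im (\<phi> (?p 0)) = 0" by (rule zero) (simp add: axis_def)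
          then have zz: "Im (\<phi> (z + axis h (- complex_of_real ?b * \<i>))) = 0" by simp
          obtain t where t: "t \<in> closed_segment 0 ?b" "Im (\<phi> z) / ?b = Re (cderiv h \<phi> (?p t))"
            by (rule Im_quotient_mean_value [OF hol False inD zz])
          then show ?thesis using Re_less [OF near [OF t(1)]] False \<open>Im (z0 $ h) = 0\<close>
            by (simp add: Im_quotient_def dist_norm)
        qed
      qed
    qed
  qed
qed

section \<open>Continuous partial derivatives\<close>

text \<open>An increment is followed one basis direction at a time. Along each edge of this path the mean value
inequality compares the true increment with the linear one, and continuity of the partial derivatives
keeps the error below any prescribed multiple of the increment.\<close>

lemma has_derivative_continuous_partials:
  fixes G :: "'a::euclidean_space \<Rightarrow> 'b::real_normed_vector"
  assumes D: "open D" and z: "z \<in> D"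
    and der: "\<And>z b. z \<in> D \<Longrightarrow> b \<in> Basis \<Longrightarrow> ((\<lambda>t. G (z + t *\<^sub>R b)) has_vector_derivative P b z) (at 0)"
    and cont: "\<And>b. b \<in> Basis \<Longrightarrow> continuous_on D (P b)"
  shows "(G has_derivative (\<lambda>v. \<Sum>b\<in>Basis. (v \<bullet> b) *\<^sub>R P b z)) (at z)"
proof -
  let ?pr = "\<lambda>B v. \<Sum>b\<in>B. (v \<bullet> b) *\<^sub>R b"
  have pr: "norm (?pr B v) \<le> DIM('a) * norm v" if "B \<subseteq> Basis" for B and v :: 'a
  proof -
    have "norm (?pr B v) \<le> (\<Sum>b\<in>B. norm v)"
    proof (rule sum_norm_le)
      fix b assume "b \<in> B"
      then have "b \<in> Basis" using that by blast
      then show "norm ((v \<bullet> b) *\<^sub>R b) \<le> norm v" by (simp add: Basis_le_norm)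
    qed
    also have "\<dots> \<le> DIM('a) * norm v"
      using card_mono [OF finite_Basis that] by (simp add: mult_right_mono)
    finally show ?thesis .
  qed
  have step: "\<exists>d>0. \<forall>v. norm v < d \<longrightarrow>
      norm (G (z + ?pr B v) - G z - (\<Sum>b\<in>B. (v \<bullet> b) *\<^sub>R P b z)) \<le> e * norm v"
    if "finite B" "B \<subseteq> Basis" "e > 0" for B e
    using that
  proof (induction B arbitrary: e rule: finite_induct)
    case empty
    then show ?case by (intro exI [of _ 1]) auto
  next
    case (insert b B)
    have b: "b \<in> Basis" and B: "B \<subseteq> Basis" using insert.prems by auto
    obtain d1 where d1: "d1 > 0" "\<And>v. norm v < d1 \<Longrightarrow>
        norm (G (z + ?pr B v) - G z - (\<Sum>b\<in>B. (v \<bullet> b) *\<^sub>R P b z)) \<le> e/2 * norm v"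
      using insert.IH [of "e/2"] B insert.prems by auto
    have "isCont (P b) z" using cont [OF b] D z continuous_on_eq_continuous_at by blast
    then obtain d2 where d2: "d2 > 0" "\<And>y. dist y z < d2 \<Longrightarrow> dist (P b y) (P b z) < e/2"
      using insert.prems unfolding continuous_at_eps_delta by (meson half_gt_zero)
    obtain d3 where d3: "d3 > 0" "ball z d3 \<subseteq> D" using D z open_contains_ball by blast
    define \<delta> where "\<delta> = min d2 d3"
    \<comment> \<open>Every point of the path is within \<open>n\<close> times the norm of the full increment.\<close>
    define n where "n = real DIM('a) + 1"
    have n: "n > 0" by (simp add: n_def)
    show ?case
    proof (intro exI conjI allI impI)
      show "min d1 (\<delta> / n) > 0" using d1 d2 d3 n by (simp add: \<delta>_def)
      fix v :: 'a assume v: "norm v < min d1 (\<delta> / n)"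
      define y where "y = z + ?pr B v"
      define g where "g = (\<lambda>s. G (y + s *\<^sub>R b) - s *\<^sub>R P b z)"
      have near: "dist (y + s *\<^sub>R b) z < \<delta>" if s: "s \<in> closed_segment 0 (v \<bullet> b)" for s
      proof -
        have "\<bar>s\<bar> \<le> \<bar>v \<bullet> b\<bar>" using s by (auto simp: closed_segment_eq_real_ivl split: if_splits)
        also have "\<dots> \<le> norm v" using b by (rule Basis_le_norm)
        finally have "norm (s *\<^sub>R b) \<le> norm v" using b by simp
        then have "norm (?pr B v + s *\<^sub>R b) \<le> n * norm v"
          using norm_triangle_ineq [of "?pr B v" "s *\<^sub>R b"] pr [OF B, of v] by (simp add: n_def algebra_simps)
        also have "\<dots> < \<delta>" using v n by (simp add: field_simps)
        finally show ?thesis by (simp add: y_def dist_norm)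
      qed
      have "norm (g (v \<bullet> b) - g 0) \<le> e/2 * norm (v \<bullet> b - 0)"
      proof (rule differentiable_bound [where S = "closed_segment 0 (v \<bullet> b)"])
        fix s assume s: "s \<in> closed_segment 0 (v \<bullet> b)"
        let ?x = "y + s *\<^sub>R b"
        have "?x \<in> D" using near [OF s] d3 by (auto simp: \<delta>_def dist_commute)
        from der [OF this b]
        have "((\<lambda>t. G (y + (t + s) *\<^sub>R b)) has_vector_derivative P b ?x) (at 0)"
          by (simp add: algebra_simps)
        moreover have "((\<lambda>t. t - s) has_vector_derivative 1) (at s)"
          by (auto intro!: derivative_eq_intros)
        ultimately have "((\<lambda>t. G (y + t *\<^sub>R b)) has_vector_derivative P b ?x) (at s)"
          using vector_diff_chain_at [of "\<lambda>t. t - s" 1 s "\<lambda>t. G (y + (t + s) *\<^sub>R b)" "P b ?x"]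
          by (simp add: o_def)
        then have "(g has_vector_derivative P b ?x - P b z) (at s)"
          unfolding g_def by (auto intro!: derivative_eq_intros)
        then show "(g has_derivative (\<lambda>t. t *\<^sub>R (P b ?x - P b z))) (at s within closed_segment 0 (v \<bullet> b))"
          unfolding has_vector_derivative_def by (rule has_derivative_at_withinI)
        have "norm (P b ?x - P b z) \<le> e/2"
          using d2(2) [of ?x] near [OF s] by (simp add: \<delta>_def dist_norm)
        then show "onorm (\<lambda>t. t *\<^sub>R (P b ?x - P b z)) \<le> e/2"
          using insert.prems(2) by (intro onorm_bound) (simp_all add: mult.commute [of "e/2"] mult_left_mono del: times_divide_eq_right times_divide_eq_left)
      qed auto
      also have "\<dots> \<le> e/2 * norm v"
        using Basis_le_norm [OF b, of v] insert.prems(2) by (simp add: mult_left_mono)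
      finally have 1: "norm (G (y + (v \<bullet> b) *\<^sub>R b) - (v \<bullet> b) *\<^sub>R P b z - G y) \<le> e/2 * norm v"
        by (simp add: g_def)
      have 2: "norm (G y - G z - (\<Sum>b\<in>B. (v \<bullet> b) *\<^sub>R P b z)) \<le> e/2 * norm v"
        using d1(2) [of v] v by (simp add: y_def)
      have "G (z + ?pr (insert b B) v) - G z - (\<Sum>b\<in>insert b B. (v \<bullet> b) *\<^sub>R P b z) =
        (G (y + (v \<bullet> b) *\<^sub>R b) - (v \<bullet> b) *\<^sub>R P b z - G y) + (G y - G z - (\<Sum>b\<in>B. (v \<bullet> b) *\<^sub>R P b z))"
        using insert.hyps by (simp add: y_def algebra_simps)
      also have "norm \<dots> \<le> e/2 * norm v + e/2 * norm v"
        using 1 2 norm_triangle_mono by blast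
      finally show "norm (G (z + ?pr (insert b B) v) - G z - (\<Sum>b\<in>insert b B. (v \<bullet> b) *\<^sub>R P b z)) \<le> e * norm v"
        by simp
    qed
  qed
  have "bounded_linear (\<lambda>v. \<Sum>b\<in>Basis. (v \<bullet> b) *\<^sub>R P b z)"
    by (intro bounded_linear_intros)
  moreover have "\<exists>d>0. \<forall>y. norm (y - z) < d \<longrightarrow>
      norm (G y - G z - (\<Sum>b\<in>Basis. ((y - z) \<bullet> b) *\<^sub>R P b z)) \<le> e * norm (y - z)" if e: "e > 0" for e
  proof -
    obtain d where d: "d > 0" "\<And>v. norm v < d \<Longrightarrow>
        norm (G (z + ?pr Basis v) - G z - (\<Sum>b\<in>Basis. (v \<bullet> b) *\<^sub>R P b z)) \<le> e * norm v"
      using step [OF finite_Basis subset_refl e] by blast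
    show ?thesis
    proof (intro exI conjI allI impI)
      fix y assume "norm (y - z) < d"
      from d(2) [OF this] show "norm (G y - G z - (\<Sum>b\<in>Basis. ((y - z) \<bullet> b) *\<^sub>R P b z)) \<le> e * norm (y - z)"
        by (simp add: euclidean_representation)
    qed (fact d(1))
  qed
  ultimately show ?thesis unfolding has_derivative_at_alt by blast
qed

lemma C1_on_continuous_partials:
  fixes G :: "'a::euclidean_space \<Rightarrow> 'b::real_normed_vector"
  assumes D: "open D"
    and der: "\<And>z b. z \<in> D \<Longrightarrow> b \<in> Basis \<Longrightarrow> ((\<lambda>t. G (z + t *\<^sub>R b)) has_vector_derivative P b z) (at 0)"
    and cont: "\<And>b. b \<in> Basis \<Longrightarrow> continuous_on D (P b)"
  shows "C1_on D G"
  unfolding C1_on_def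
proof (intro exI conjI ballI)
  let ?P = "\<lambda>z. Blinfun (\<lambda>v. \<Sum>b\<in>Basis. (v \<bullet> b) *\<^sub>R P b z)"
  have app: "blinfun_apply (?P z) v = (\<Sum>b\<in>Basis. (v \<bullet> b) *\<^sub>R P b z)" for z v
  proof -
    have "bounded_linear (\<lambda>v. \<Sum>b\<in>Basis. (v \<bullet> b) *\<^sub>R P b z)"
      by (intro bounded_linear_intros)
    then show ?thesis by (simp add: bounded_linear_Blinfun_apply)
  qed
  show "(G has_derivative blinfun_apply (?P z)) (at z)" if "z \<in> D" for z
    using has_derivative_continuous_partials [OF D that der cont] by (simp add: app[abs_def])
  show "continuous_on D ?P"
    using cont by (intro continuous_on_blinfun_componentwise) (auto simp: app intro!: continuous_intros)
qed

section \<open>Harmonic functions of a quaternion variable\<close>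

text \<open>The pointwise Laplace equation in the form used for several variables: the first partial derivatives
exist near \<open>y\<close> on the coordinate lines through \<open>y\<close>, and the second ones exist at \<open>y\<close>.\<close>

definition harmonic_at :: "(quat \<Rightarrow> 'a::real_normed_vector) \<Rightarrow> quat \<Rightarrow> bool" where
  "harmonic_at g y \<longleftrightarrow> (\<exists>g1 g2.
     (\<forall>b\<in>Basis.
        (\<forall>\<^sub>F s in nhds 0. ((\<lambda>t. g (y + t *\<^sub>R b)) has_vector_derivative g1 b s) (at s)) \<and>
        (g1 b has_vector_derivative g2 b) (at 0)) \<and>
     (\<Sum>b\<in>Basis. g2 b) = 0)"

lemma harmonic_atE:
  assumes "harmonic_at g y"
  obtains g1 g2 where "\<And>b. b \<in> Basis \<Longrightarrow> \<forall>\<^sub>F s in nhds 0. ((\<lambda>t. g (y + t *\<^sub>R b)) has_vector_derivative g1 b s) (at s)"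
    "\<And>b. b \<in> Basis \<Longrightarrow> (g1 b has_vector_derivative g2 b) (at 0)" "(\<Sum>b\<in>Basis. g2 b) = 0"
proof -
  from assms obtain g1 g2 where *: "\<forall>b\<in>Basis.
        (\<forall>\<^sub>F s in nhds 0. ((\<lambda>t. g (y + t *\<^sub>R b)) has_vector_derivative g1 b s) (at s)) \<and>
        (g1 b has_vector_derivative g2 b) (at 0)" "(\<Sum>b\<in>Basis. g2 b) = 0"
    unfolding harmonic_at_def by (elim exE conjE)
  show thesis by (rule that [of g1 g2]) (use * in simp_all)
qed

lemma harmonic_at_bounded_linear:
  assumes "bounded_linear f" "harmonic_at g y"
  shows "harmonic_at (\<lambda>x. f (g x)) y"
proof -
  obtain g1 g2 where g: "\<And>b. b \<in> Basis \<Longrightarrow> \<forall>\<^sub>F s in nhds 0. ((\<lambda>t. g (y + t *\<^sub>R b)) has_vector_derivative g1 b s) (at s)"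
    "\<And>b. b \<in> Basis \<Longrightarrow> (g1 b has_vector_derivative g2 b) (at 0)" "(\<Sum>b\<in>Basis. g2 b) = 0"
    by (rule harmonic_atE [OF assms(2)]) (rule that)
  interpret f: bounded_linear f by fact
  show ?thesis unfolding harmonic_at_def
  proof (intro exI conjI ballI)
    show "\<forall>\<^sub>F s in nhds 0. ((\<lambda>t. f (g (y + t *\<^sub>R b))) has_vector_derivative f (g1 b s)) (at s)" if "b \<in> Basis" for b
      using g(1) [OF that] by (rule eventually_mono) (rule f.has_vector_derivative)
    show "((\<lambda>s. f (g1 b s)) has_vector_derivative f (g2 b)) (at 0)" if "b \<in> Basis" for b
      using g(2) [OF that] by (rule f.has_vector_derivative)
    show "(\<Sum>b\<in>Basis. f (g2 b)) = 0" using g(3) by (simp flip: f.sum)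
  qed
qed

lemma harmonic_at_add:
  assumes "harmonic_at f y" "harmonic_at g y"
  shows "harmonic_at (\<lambda>x. f x + g x) y"
proof -
  obtain f1 f2 where f: "\<And>b. b \<in> Basis \<Longrightarrow> \<forall>\<^sub>F s in nhds 0. ((\<lambda>t. f (y + t *\<^sub>R b)) has_vector_derivative f1 b s) (at s)"
    "\<And>b. b \<in> Basis \<Longrightarrow> (f1 b has_vector_derivative f2 b) (at 0)" "(\<Sum>b\<in>Basis. f2 b) = 0"
    by (rule harmonic_atE [OF assms(1)]) (rule that)
  obtain g1 g2 where g: "\<And>b. b \<in> Basis \<Longrightarrow> \<forall>\<^sub>F s in nhds 0. ((\<lambda>t. g (y + t *\<^sub>R b)) has_vector_derivative g1 b s) (at s)"
    "\<And>b. b \<in> Basis \<Longrightarrow> (g1 b has_vector_derivative g2 b) (at 0)" "(\<Sum>b\<in>Basis. g2 b) = 0"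
    by (rule harmonic_atE [OF assms(2)]) (rule that)
  show ?thesis unfolding harmonic_at_def
  proof (intro exI conjI ballI)
    fix b :: quat assume b: "b \<in> Basis"
    show "\<forall>\<^sub>F s in nhds 0. ((\<lambda>t. f (y + t *\<^sub>R b) + g (y + t *\<^sub>R b)) has_vector_derivative f1 b s + g1 b s) (at s)"
      using f(1) [OF b] g(1) [OF b] by eventually_elim (rule has_vector_derivative_add)
    show "((\<lambda>s. f1 b s + g1 b s) has_vector_derivative f2 b + g2 b) (at 0)"
      using f(2) [OF b] g(2) [OF b] by (rule has_vector_derivative_add)
  qed (simp add: sum.distrib f(3) g(3))
qed

lemma harmonic_at_const: "harmonic_at (\<lambda>x. c) y"
  unfolding harmonic_at_def by (intro exI [of _ "\<lambda>b s. 0"] exI [of _ "\<lambda>b. 0"]) auto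

lemma harmonic_at_sum:
  assumes "finite A" "\<And>i. i \<in> A \<Longrightarrow> harmonic_at (g i) y"
  shows "harmonic_at (\<lambda>x. \<Sum>i\<in>A. g i x) y"
  using assms by (induction A rule: finite_induct) (auto intro: harmonic_at_add harmonic_at_const)

lemma harmonic_at_cong:
  assumes "harmonic_at g y" "\<forall>\<^sub>F x in nhds y. g' x = g x"
  shows "harmonic_at g' y"
proof -
  obtain g1 g2 where g: "\<And>b. b \<in> Basis \<Longrightarrow> \<forall>\<^sub>F s in nhds 0. ((\<lambda>t. g (y + t *\<^sub>R b)) has_vector_derivative g1 b s) (at s)"
    "\<And>b. b \<in> Basis \<Longrightarrow> (g1 b has_vector_derivative g2 b) (at 0)" "(\<Sum>b\<in>Basis. g2 b) = 0"
    by (rule harmonic_atE [OF assms(1)]) (rule that)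
  have "\<forall>\<^sub>F s in nhds 0. ((\<lambda>t. g' (y + t *\<^sub>R b)) has_vector_derivative g1 b s) (at s)" if "b \<in> Basis" for b
  proof -
    have "filterlim (\<lambda>s. y + s *\<^sub>R b) (nhds (y + 0 *\<^sub>R b)) (nhds 0)"
      by (intro tendsto_intros filterlim_ident)
    then have "\<forall>\<^sub>F s in nhds 0. g' (y + s *\<^sub>R b) = g (y + s *\<^sub>R b)"
      using eventually_compose_filterlim [OF assms(2), of "\<lambda>s. y + s *\<^sub>R b" "nhds 0"] by simp
    then have "\<forall>\<^sub>F s in nhds 0. \<forall>\<^sub>F t in nhds s. g' (y + t *\<^sub>R b) = g (y + t *\<^sub>R b)"
      by (simp add: eventually_eventually)
    with g(1) [OF that] show ?thesis
    proof eventually_elim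
      case (elim s)
      then show ?case using eventually_nhds_x_imp_x [OF elim(2)]
        by (subst has_vector_derivative_cong_ev [where g = "\<lambda>t. g (y + t *\<^sub>R b)"]) auto
    qed
  qed
  with g(2,3) show ?thesis unfolding harmonic_at_def
    by (intro exI [of _ g1] exI [of _ g2] conjI ballI)
qed

text \<open>Along a coordinate line the kernel denominator is a monic quadratic polynomial \<open>Q + 2 t m + t\<^sup>2\<close> in the
parameter, so both derivatives may be taken under the integral, by Leibniz' rule on an interval on
which the denominator has no zero.\<close>

lemma quadratic_kernel_derivatives:
  fixes \<psi> Q m :: "real \<Rightarrow> complex"
  assumes cont: "continuous_on {0..1} \<psi>" "continuous_on {0..1} Q" "continuous_on {0..1} m"
    and nz: "\<And>\<tau>. \<tau> \<in> {0..1} \<Longrightarrow> Q \<tau> \<noteq> 0"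
  defines "q \<equiv> \<lambda>t \<tau>. Q \<tau> + 2 * of_real t * m \<tau> + (of_real t)\<^sup>2"
  defines "I1 \<equiv> \<lambda>s. integral {0..1} (\<lambda>\<tau>. - \<psi> \<tau> * (2 * m \<tau> + 2 * of_real s) / (q s \<tau>)\<^sup>2)"
  shows "\<forall>\<^sub>F s in nhds 0. ((\<lambda>t. integral {0..1} (\<lambda>\<tau>. \<psi> \<tau> / q t \<tau>)) has_vector_derivative I1 s) (at s)"
    and "(I1 has_vector_derivative integral {0..1} (\<lambda>\<tau>. \<psi> \<tau> * (8 * (m \<tau>)\<^sup>2 - 2 * Q \<tau>) / (Q \<tau>) ^ 3)) (at 0)"
proof -
  let ?p = "\<lambda>t \<tau>. 2 * m \<tau> + 2 * of_real t"
  obtain \<kappa> where \<kappa>: "\<kappa> > 0" "\<And>\<tau>. \<tau> \<in> {0..1} \<Longrightarrow> norm (Q \<tau>) \<ge> \<kappa>"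
  proof -
    have "compact (Q ` {0..1})" using cont(2) by (intro compact_continuous_image) auto
    then have "closed (Q ` {0..1})" by (rule compact_imp_closed)
    moreover have "0 \<notin> Q ` {0..1}" using nz by force
    ultimately obtain d where "d > 0" "\<And>y. y \<in> Q ` {0..1} \<Longrightarrow> d \<le> dist 0 y"
      by (metis separate_point_closed)
    then show ?thesis by (intro that [of d]) (auto simp: dist_norm)
  qed
  have "bounded (m ` {0..1})" using cont(3) by (intro compact_imp_bounded compact_continuous_image) auto
  then obtain M where M: "M > 0" "\<And>\<tau>. \<tau> \<in> {0..1} \<Longrightarrow> norm (m \<tau>) \<le> M"
    unfolding bounded_pos by auto
  \<comment> \<open>For \<open>|t| < \<delta>\<close> the perturbation \<open>2 t m + t\<^sup>2\<close> is smaller than \<open>\<kappa> \<le> |Q|\<close>.\<close>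
  define \<delta> where "\<delta> = min 1 (\<kappa> / (2 * M + 1))"
  have \<delta>: "\<delta> > 0" using \<kappa> M by (simp add: \<delta>_def)
  have q: "q t \<tau> \<noteq> 0" if t: "t \<in> ball 0 \<delta>" and \<tau>: "\<tau> \<in> {0..1}" for t \<tau>
  proof
    assume "q t \<tau> = 0"
    then have "Q \<tau> = - (of_real t * (2 * m \<tau> + of_real t))"
      by (simp add: q_def algebra_simps power2_eq_square eq_neg_iff_add_eq_0)
    then have "norm (Q \<tau>) = \<bar>t\<bar> * norm (2 * m \<tau> + of_real t)"
      by (simp add: norm_mult)
    also have "\<dots> \<le> \<bar>t\<bar> * (2 * M + 1)"
    proof (rule mult_left_mono)
      have "norm (2 * m \<tau> + of_real t) \<le> 2 * norm (m \<tau>) + \<bar>t\<bar>"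
        using norm_triangle_ineq [of "2 * m \<tau>" "of_real t"] by (simp add: norm_mult)
      with M(2) [OF \<tau>] t show "norm (2 * m \<tau> + of_real t) \<le> 2 * M + 1" by (simp add: \<delta>_def)
    qed simp
    also have "\<dots> < \<kappa>"
      using t M(1) by (simp add: \<delta>_def field_simps)
    finally show False using \<kappa>(2) [OF \<tau>] by simp
  qed
  have c2: "continuous_on (ball 0 \<delta> \<times> {0..1}) (\<lambda>p. \<psi> (snd p))" "continuous_on (ball 0 \<delta> \<times> {0..1}) (\<lambda>p. Q (snd p))"
    "continuous_on (ball 0 \<delta> \<times> {0..1}) (\<lambda>p. m (snd p))" for \<delta> :: real
    by (auto intro!: continuous_on_compose2 [OF cont(1)] continuous_on_compose2 [OF cont(2)]
        continuous_on_compose2 [OF cont(3)] continuous_intros)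
  have qd: "((\<lambda>t. q t \<tau>) has_vector_derivative ?p t \<tau>) (at t within S)" for t \<tau> S
    unfolding q_def power2_eq_square by (auto intro!: derivative_eq_intros simp: algebra_simps)
  have d1: "((\<lambda>t. \<psi> \<tau> / q t \<tau>) has_vector_derivative - \<psi> \<tau> * ?p t \<tau> / (q t \<tau>)\<^sup>2) (at t within ball 0 \<delta>)"
    if t: "t \<in> ball 0 \<delta>" and \<tau>: "\<tau> \<in> cbox 0 1" for t \<tau>
  proof -
    have "q t \<tau> \<noteq> 0" using q t \<tau> by simp
    then have "((\<lambda>u. \<psi> \<tau> / u) has_field_derivative - \<psi> \<tau> / (q t \<tau>)\<^sup>2) (at (q t \<tau>) within (\<lambda>t. q t \<tau>) ` ball 0 \<delta>)"
      by (auto intro!: derivative_eq_intros simp: power2_eq_square)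
    from field_vector_diff_chain_within [OF qd this]
    show ?thesis by (simp add: o_def mult.commute)
  qed
  have d2: "((\<lambda>t. - \<psi> \<tau> * ?p t \<tau> / (q t \<tau>)\<^sup>2) has_vector_derivative
      \<psi> \<tau> * (2 * (?p t \<tau>)\<^sup>2 - 2 * q t \<tau>) / (q t \<tau>) ^ 3) (at t within ball 0 \<delta>)"
    if t: "t \<in> ball 0 \<delta>" and \<tau>: "\<tau> \<in> cbox 0 1" for t \<tau>
  proof -
    have nz: "q t \<tau> \<noteq> 0" using q t \<tau> by simp
    then have "((\<lambda>u. 1 / u\<^sup>2) has_field_derivative - 2 / (q t \<tau>) ^ 3) (at (q t \<tau>) within (\<lambda>t. q t \<tau>) ` ball 0 \<delta>)"
      by (auto intro!: derivative_eq_intros simp: field_simps eval_nat_numeral)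
    from field_vector_diff_chain_within [OF qd this]
    have "((\<lambda>t. 1 / (q t \<tau>)\<^sup>2) has_vector_derivative ?p t \<tau> * (- 2 / (q t \<tau>) ^ 3)) (at t within ball 0 \<delta>)"
      by (simp add: o_def)
    then have "((\<lambda>t. (- \<psi> \<tau> * ?p t \<tau>) * (1 / (q t \<tau>)\<^sup>2)) has_vector_derivative
       (- \<psi> \<tau> * ?p t \<tau>) * (?p t \<tau> * (- 2 / (q t \<tau>) ^ 3)) + (- \<psi> \<tau> * 2) * (1 / (q t \<tau>)\<^sup>2)) (at t within ball 0 \<delta>)"
      by (intro has_vector_derivative_mult) (auto intro!: derivative_eq_intros)
    moreover have "(- \<psi> \<tau> * ?p t \<tau>) * (?p t \<tau> * (- 2 / (q t \<tau>) ^ 3)) + (- \<psi> \<tau> * 2) * (1 / (q t \<tau>)\<^sup>2)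
      = \<psi> \<tau> * (2 * (?p t \<tau>)\<^sup>2 - 2 * q t \<tau>) / (q t \<tau>) ^ 3"
    proof -
      have "1 / (q t \<tau>)\<^sup>2 = q t \<tau> / (q t \<tau>) ^ 3"
        using nz by (simp add: power2_eq_square power3_eq_cube)
      then show ?thesis by (simp add: diff_divide_distrib add_divide_distrib algebra_simps power2_eq_square)
    qed
    ultimately show ?thesis by simp
  qed
  have cq: "continuous_on (ball 0 \<delta> \<times> {0..1}) (\<lambda>p. q (fst p) (snd p))"
    unfolding q_def by (intro continuous_intros c2)
  have e1: "continuous_on (ball 0 \<delta> \<times> cbox 0 1) (\<lambda>(t, \<tau>). - \<psi> \<tau> * ?p t \<tau> / (q t \<tau>)\<^sup>2)"
    using q by (auto simp: case_prod_beta intro!: continuous_intros c2 cq)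
  have e2: "continuous_on (ball 0 \<delta> \<times> cbox 0 1) (\<lambda>(t, \<tau>). \<psi> \<tau> * (2 * (?p t \<tau>)\<^sup>2 - 2 * q t \<tau>) / (q t \<tau>) ^ 3)"
    using q by (auto simp: case_prod_beta intro!: continuous_intros c2 cq)
  have cq1: "continuous_on {0..1} (q t)" for t
    unfolding q_def by (intro continuous_intros cont)
  have i1: "(\<lambda>\<tau>. \<psi> \<tau> / q t \<tau>) integrable_on cbox 0 1" if "t \<in> ball 0 \<delta>" for t
    using q [OF that] unfolding box_real by (intro integrable_continuous_real continuous_intros cont cq1) auto
  have i2: "(\<lambda>\<tau>. - \<psi> \<tau> * ?p t \<tau> / (q t \<tau>)\<^sup>2) integrable_on cbox 0 1" if "t \<in> ball 0 \<delta>" for t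
    using q [OF that] unfolding box_real by (intro integrable_continuous_real continuous_intros cont cq1) auto
  have "((\<lambda>t. integral (cbox 0 1) (\<lambda>\<tau>. \<psi> \<tau> / q t \<tau>)) has_vector_derivative I1 s) (at s)" if s: "s \<in> ball 0 \<delta>" for s
    using leibniz_rule_vector_derivative [OF d1 i1 e1 s convex_ball] s
    by (simp add: I1_def at_within_open [OF s open_ball])
  moreover have "\<forall>\<^sub>F s in nhds 0. s \<in> ball (0::real) \<delta>" using \<delta> by (intro eventually_nhds_in_open) auto
  ultimately show "\<forall>\<^sub>F s in nhds 0. ((\<lambda>t. integral {0..1} (\<lambda>\<tau>. \<psi> \<tau> / q t \<tau>)) has_vector_derivative I1 s) (at s)"
    by (auto elim: eventually_mono)
  have s: "0 \<in> ball (0::real) \<delta>" using \<delta> by simp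
  show "(I1 has_vector_derivative integral {0..1} (\<lambda>\<tau>. \<psi> \<tau> * (8 * (m \<tau>)\<^sup>2 - 2 * Q \<tau>) / (Q \<tau>) ^ 3)) (at 0)"
    using leibniz_rule_vector_derivative [OF d2 i2 e2 s convex_ball]
    by (simp add: I1_def at_within_open [OF s open_ball] q_def power_mult_distrib)
qed

text \<open>The point \<open>\<alpha> + i\<beta>\<close> of the closed upper half plane with \<open>x = \<alpha> + J\<beta>\<close> for some imaginary unit \<open>J\<close>.\<close>

definition slice_point :: "quat \<Rightarrow> complex" where
  "slice_point x = Complex (qRe x) (sqrt ((qI x)\<^sup>2 + (qJ x)\<^sup>2 + (qK x)\<^sup>2))"

lemma slice_point_factor:
  "(\<zeta> - of_real (qRe x))\<^sup>2 + of_real ((qI x)\<^sup>2 + (qJ x)\<^sup>2 + (qK x)\<^sup>2)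
     = (\<zeta> - slice_point x) * (\<zeta> - cnj (slice_point x))"
proof -
  have "(sqrt ((qI x)\<^sup>2 + (qJ x)\<^sup>2 + (qK x)\<^sup>2))\<^sup>2 = (qI x)\<^sup>2 + (qJ x)\<^sup>2 + (qK x)\<^sup>2" by simp
  then show ?thesis
    by (simp add: slice_point_def complex_eq_iff power2_eq_square algebra_simps)
qed

text \<open>In the direction \<open>b\<close> the linear coefficient \<open>m\<close> of the quadratic denominator is \<open>Re y - \<zeta>\<close> or an
imaginary coordinate of \<open>y\<close>. The squares of these four coefficients add up to the denominator \<open>Q\<close> itself,
so the second derivatives \<open>(8 m\<^sup>2 - 2 Q) / Q\<^sup>3\<close> of the kernel add up to \<open>(8 Q - 4 \<cdot> 2 Q) / Q\<^sup>3 = 0\<close>.\<close>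

lemma harmonic_at_kernel_integral:
  fixes \<psi> \<zeta> :: "real \<Rightarrow> complex"
  assumes cont: "continuous_on {0..1} \<psi>" "continuous_on {0..1} \<zeta>"
    and nz: "\<And>\<tau>. \<tau> \<in> {0..1} \<Longrightarrow> (\<zeta> \<tau> - slice_point y) * (\<zeta> \<tau> - cnj (slice_point y)) \<noteq> 0"
  shows "harmonic_at (\<lambda>x. integral {0..1} (\<lambda>\<tau>. \<psi> \<tau> / ((\<zeta> \<tau> - slice_point x) * (\<zeta> \<tau> - cnj (slice_point x))))) y"
proof -
  define Q where "Q = (\<lambda>\<tau>. (\<zeta> \<tau> - of_real (qRe y))\<^sup>2 + of_real ((qI y)\<^sup>2 + (qJ y)\<^sup>2 + (qK y)\<^sup>2))"
  define m where "m = (\<lambda>b \<tau>. if b = Quat 1 0 0 0 then - (\<zeta> \<tau> - of_real (qRe y)) else of_real (y \<bullet> b))"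
  define I1 where "I1 = (\<lambda>b s. integral {0..1} (\<lambda>\<tau>. - \<psi> \<tau> * (2 * m b \<tau> + 2 * of_real s) / (Q \<tau> + 2 * of_real s * m b \<tau> + (of_real s)\<^sup>2)\<^sup>2))"
  define I2 where "I2 = (\<lambda>b. integral {0..1} (\<lambda>\<tau>. \<psi> \<tau> * (8 * (m b \<tau>)\<^sup>2 - 2 * Q \<tau>) / (Q \<tau>) ^ 3))"
  have cQ: "continuous_on {0..1} Q" unfolding Q_def by (intro continuous_intros cont)
  have cm: "continuous_on {0..1} (m b)" for b
    unfolding m_def by (cases "b = Quat 1 0 0 0") (auto intro!: continuous_intros cont)
  have nzQ: "Q \<tau> \<noteq> 0" if "\<tau> \<in> {0..1}" for \<tau>
    using nz [OF that] unfolding Q_def slice_point_factor .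
  note ker = quadratic_kernel_derivatives [OF cont(1) cQ cm nzQ]
  have eq: "\<psi> \<tau> / ((\<zeta> \<tau> - slice_point (y + t *\<^sub>R b)) * (\<zeta> \<tau> - cnj (slice_point (y + t *\<^sub>R b))))
      = \<psi> \<tau> / (Q \<tau> + 2 * of_real t * m b \<tau> + (of_real t)\<^sup>2)" if "b \<in> Basis" for b t \<tau>
  proof -
    have "b = Quat 1 0 0 0 \<or> b = Quat 0 1 0 0 \<or> b = Quat 0 0 1 0 \<or> b = Quat 0 0 0 1"
      using that by (auto simp: Basis_quat_def)
    then have "(\<zeta> \<tau> - of_real (qRe (y + t *\<^sub>R b)))\<^sup>2 + of_real ((qI (y + t *\<^sub>R b))\<^sup>2 + (qJ (y + t *\<^sub>R b))\<^sup>2 + (qK (y + t *\<^sub>R b))\<^sup>2)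
        = Q \<tau> + 2 * of_real t * m b \<tau> + (of_real t)\<^sup>2"
      unfolding Q_def m_def
      by (elim disjE) (simp_all add: inner_quat_def power2_eq_square algebra_simps)
    then show ?thesis unfolding slice_point_factor by simp
  qed
  show ?thesis unfolding harmonic_at_def
  proof (intro exI conjI ballI)
    fix b :: quat assume b: "b \<in> Basis"
    show "\<forall>\<^sub>F s in nhds 0. ((\<lambda>t. integral {0..1} (\<lambda>\<tau>. \<psi> \<tau> / ((\<zeta> \<tau> - slice_point (y + t *\<^sub>R b)) * (\<zeta> \<tau> - cnj (slice_point (y + t *\<^sub>R b))))))
        has_vector_derivative I1 b s) (at s)"
      using ker(1) [of b] unfolding eq [OF b] I1_def .
    show "(I1 b has_vector_derivative I2 b) (at 0)"
      using ker(2) [of b] unfolding I1_def I2_def .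
  next
    have "(\<Sum>b\<in>Basis. I2 b) = integral {0..1} (\<lambda>\<tau>. \<Sum>b\<in>Basis. \<psi> \<tau> * (8 * (m b \<tau>)\<^sup>2 - 2 * Q \<tau>) / (Q \<tau>) ^ 3)"
      unfolding I2_def using nzQ
      by (intro integral_sum [symmetric] integrable_continuous_real continuous_intros cont cQ cm) auto
    also have "(\<lambda>\<tau>. \<Sum>b\<in>Basis. \<psi> \<tau> * (8 * (m b \<tau>)\<^sup>2 - 2 * Q \<tau>) / (Q \<tau>) ^ 3) = (\<lambda>\<tau>. 0)"
    proof
      fix \<tau>
      have "(\<Sum>b\<in>Basis. \<psi> \<tau> * (8 * (m b \<tau>)\<^sup>2 - 2 * Q \<tau>) / (Q \<tau>) ^ 3) = \<psi> \<tau> / (Q \<tau>) ^ 3 * (\<Sum>b\<in>Basis. 8 * (m b \<tau>)\<^sup>2 - 2 * Q \<tau>)"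
        by (simp add: sum_distrib_left)
      also have "(\<Sum>b\<in>Basis. 8 * (m b \<tau>)\<^sup>2 - 2 * Q \<tau>) = 0"
        by (simp add: Basis_quat_def m_def Q_def inner_quat_def power2_eq_square algebra_simps)
      finally show "(\<Sum>b\<in>Basis. \<psi> \<tau> * (8 * (m b \<tau>)\<^sup>2 - 2 * Q \<tau>) / (Q \<tau>) ^ 3) = 0" by simp
    qed
    finally show "(\<Sum>b\<in>Basis. I2 b) = 0" by simp
  qed
qed

definition kernel_integral :: "(complex \<Rightarrow> complex) \<Rightarrow> complex \<Rightarrow> real \<Rightarrow> complex \<Rightarrow> complex" where
  "kernel_integral \<phi> c r w = contour_integral (circlepath c r) (\<lambda>\<zeta>. \<phi> \<zeta> / ((\<zeta> - w) * (\<zeta> - cnj w)))"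

lemma harmonic_at_contour_kernel:
  assumes cont: "continuous_on (sphere c r) \<phi>" and r: "r > 0"
    and nz: "slice_point y \<notin> sphere c r" "cnj (slice_point y) \<notin> sphere c r"
  shows "harmonic_at (\<lambda>x. kernel_integral \<phi> c r (slice_point x)) y"
proof -
  let ?\<gamma> = "circlepath c r"
  let ?d = "\<lambda>\<tau>. 2 * of_real pi * \<i> * of_real r * exp (2 * of_real pi * \<i> * of_real \<tau>)"
  have sph: "?\<gamma> \<tau> \<in> sphere c r" for \<tau>
    using r by (simp add: circlepath dist_norm norm_mult norm_exp_eq_Re)
  have c\<gamma>: "continuous_on {0..1} ?\<gamma>"
    unfolding circlepath by (intro continuous_intros)
  have "harmonic_at (\<lambda>x. integral {0..1} (\<lambda>\<tau>. (\<phi> (?\<gamma> \<tau>) * ?d \<tau>) / ((?\<gamma> \<tau> - slice_point x) * (?\<gamma> \<tau> - cnj (slice_point x))))) y"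
  proof (rule harmonic_at_kernel_integral [OF _ c\<gamma>])
    show "continuous_on {0..1} (\<lambda>\<tau>. \<phi> (?\<gamma> \<tau>) * ?d \<tau>)"
      using sph by (intro continuous_intros continuous_on_compose2 [OF cont c\<gamma>]) auto
    show "(?\<gamma> \<tau> - slice_point y) * (?\<gamma> \<tau> - cnj (slice_point y)) \<noteq> 0" for \<tau>
      using nz sph [of \<tau>] by (metis mult_eq_0_iff right_minus_eq)
  qed
  then show ?thesis
    by (simp add: kernel_integral_def contour_integral_integral vector_derivative_circlepath mult_ac)
qed

text \<open>Partial fractions split the kernel into the two Cauchy kernels at \<open>w\<close> and \<open>cnj w\<close>.\<close>

lemma kernel_integral_symmetric:
  assumes hol: "\<phi> holomorphic_on S" and S: "cball c r \<subseteq> S" and r: "r > 0"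
    and w: "w \<in> ball c r" "cnj w \<in> ball c r" "Im w \<noteq> 0"
  shows "kernel_integral \<phi> c r w = 2 * of_real pi * \<i> * (\<phi> w - \<phi> (cnj w)) / (w - cnj w)"
proof -
  have hc: "\<phi> holomorphic_on cball c r" by (rule holomorphic_on_subset [OF hol S])
  note hb = holomorphic_on_subset [OF hc ball_subset_cball] holomorphic_on_imp_continuous_on [OF hc]
  have ne: "w \<noteq> cnj w" using w(3) by (metis complex_cnj_cancel_iff complex_eq_iff cnj.simps(2) equal_neg_zero)
  have "((\<lambda>\<zeta>. (\<phi> \<zeta> / (\<zeta> - w) - \<phi> \<zeta> / (\<zeta> - cnj w)) / (w - cnj w)) has_contour_integral
     (2 * of_real pi * \<i> * \<phi> w - 2 * of_real pi * \<i> * \<phi> (cnj w)) / (w - cnj w)) (circlepath c r)"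
    using w hb by (intro has_contour_integral_div has_contour_integral_diff Cauchy_integral_circlepath)
      (auto simp: dist_norm norm_minus_commute)
  then have "((\<lambda>\<zeta>. \<phi> \<zeta> / ((\<zeta> - w) * (\<zeta> - cnj w))) has_contour_integral
     (2 * of_real pi * \<i> * \<phi> w - 2 * of_real pi * \<i> * \<phi> (cnj w)) / (w - cnj w)) (circlepath c r)"
  proof (rule has_contour_integral_eq)
    fix \<zeta> assume "\<zeta> \<in> path_image (circlepath c r)"
    then have "\<zeta> \<noteq> w" "\<zeta> \<noteq> cnj w" using w r by (auto simp: path_image_circlepath)
    then show "(\<phi> \<zeta> / (\<zeta> - w) - \<phi> \<zeta> / (\<zeta> - cnj w)) / (w - cnj w) = \<phi> \<zeta> / ((\<zeta> - w) * (\<zeta> - cnj w))"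
      using ne by (simp add: divide_simps) (simp add: algebra_simps)
  qed
  then show ?thesis
    by (simp add: kernel_integral_def contour_integral_unique algebra_simps)
qed

lemma kernel_integral_real:
  assumes hol: "\<phi> holomorphic_on S" and S: "cball c r \<subseteq> S" and r: "r > 0"
    and w: "w \<in> ball c r" "Im w = 0"
  shows "kernel_integral \<phi> c r w = 2 * of_real pi * \<i> * deriv \<phi> w"
proof -
  have hc: "\<phi> holomorphic_on cball c r" by (rule holomorphic_on_subset [OF hol S])
  note hb = holomorphic_on_subset [OF hc ball_subset_cball] holomorphic_on_imp_continuous_on [OF hc]
  have "cnj w = w" using w by (simp add: complex_eq_iff)
  then have "kernel_integral \<phi> c r w = contour_integral (circlepath c r) (\<lambda>u. \<phi> u / (u - w)\<^sup>2)"
    by (simp add: kernel_integral_def power2_eq_square)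
  moreover have "deriv \<phi> w = 1 / (2 * of_real pi * \<i>) * contour_integral (circlepath c r) (\<lambda>u. \<phi> u / (u - w)\<^sup>2)"
    by (rule DERIV_imp_deriv [OF Cauchy_derivative_integral_circlepath(2) [OF hb(2,1) w(1)]])
  ultimately show ?thesis by simp
qed

text \<open>The conjugate pole lies outside the circle, so only the residue at \<open>w\<close> remains.\<close>

lemma kernel_integral_upper:
  assumes hol: "\<phi> holomorphic_on S" and S: "cball c r \<subseteq> S" and r: "r < Im c"
    and w: "w \<in> ball c r"
  shows "kernel_integral \<phi> c r w = 2 * of_real pi * \<i> * \<phi> w / (w - cnj w)"
proof -
  have pos: "Im u > 0" if "u \<in> cball c r" for u
  proof -
    have "\<bar>Im (c - u)\<bar> \<le> cmod (c - u)" by (rule abs_Im_le_cmod)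
    with that r show ?thesis by (simp add: dist_norm)
  qed
  have "Im (cnj w) < 0" using pos [of w] w by (simp add: less_imp_le)
  then have ne: "u - cnj w \<noteq> 0" if "u \<in> cball c r" for u
    using pos [OF that] by (metis eq_iff_diff_eq_0 less_asym)
  have hc: "(\<lambda>\<zeta>. \<phi> \<zeta> / (\<zeta> - cnj w)) holomorphic_on cball c r"
    using ne holomorphic_on_subset [OF hol S] by (intro holomorphic_intros) auto
  note hb = holomorphic_on_subset [OF hc ball_subset_cball] holomorphic_on_imp_continuous_on [OF hc]
  have "((\<lambda>\<zeta>. \<phi> \<zeta> / (\<zeta> - cnj w) / (\<zeta> - w)) has_contour_integral 2 * of_real pi * \<i> * (\<phi> w / (w - cnj w))) (circlepath c r)"
    using w by (intro Cauchy_integral_circlepath hb) (auto simp: dist_norm norm_minus_commute)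
  then show ?thesis
    by (simp add: kernel_integral_def contour_integral_unique mult.commute)
qed

lemma bounded_linear_quat_parts:
  "bounded_linear qRe" "bounded_linear qI" "bounded_linear qJ" "bounded_linear qK"
proof -
  have "bounded_linear (\<lambda>x. x \<bullet> b :: real)" for b :: quat by (rule bounded_linear_inner_left)
  from this [of "Quat 1 0 0 0"] this [of "Quat 0 1 0 0"] this [of "Quat 0 0 1 0"] this [of "Quat 0 0 0 1"]
  show "bounded_linear qRe" "bounded_linear qI" "bounded_linear qJ" "bounded_linear qK"
    by (simp_all add: inner_quat_def)
qed

lemmas continuous_on_quat_parts [continuous_intros] =
  bounded_linear_quat_parts [THEN bounded_linear.continuous_on]

lemma continuous_on_slice_point: "continuous_on A slice_point"
  unfolding slice_point_def Complex_eq by (intro continuous_intros)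

text \<open>Locally the quotient is a multiple of the real part of a kernel integral. Around a real point one
circle encloses both poles, and the integral gives \<open>(\<phi>(w) - cnj (\<phi>(w))) / (w - cnj w)\<close>. Away from the
real axis the circle encloses \<open>w\<close> only; the real part of \<open>\<phi>(w) / (w - cnj w)\<close> is half the
quotient, hence the factor 2.\<close>

lemma harmonic_at_Im_quotient_plane:
  assumes S: "open S" and hol: "\<phi> holomorphic_on S"
    and sym: "\<And>w. w \<in> S \<Longrightarrow> cnj w \<in> S" "\<And>w. w \<in> S \<Longrightarrow> \<phi> (cnj w) = cnj (\<phi> w)"
    and y: "slice_point y \<in> S"
  shows "harmonic_at (\<lambda>x. if Im (slice_point x) = 0 then Re (deriv \<phi> (slice_point x))
      else Im (\<phi> (slice_point x)) / Im (slice_point x)) y" (is "harmonic_at ?g y")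
proof -
  define c where "c = slice_point y"
  let ?k = "\<lambda>r x. kernel_integral \<phi> c r (slice_point x) / (2 * of_real pi * \<i>)"
  have ev: "\<forall>\<^sub>F x in nhds y. slice_point x \<in> ball c r" if "r > 0" for r
  proof -
    have "\<forall>\<^sub>F w in nhds (slice_point y). w \<in> ball c r"
      using that by (intro eventually_nhds_in_open) (auto simp: c_def)
    moreover have "filterlim slice_point (nhds (slice_point y)) (nhds y)"
      using continuous_on_slice_point [of UNIV] by (simp add: continuous_on_eq_continuous_at isCont_def tendsto_at_iff_tendsto_nhds)
    ultimately show ?thesis by (rule eventually_compose_filterlim)
  qed
  have Im0: "Im (slice_point x) \<ge> 0" for x by (simp add: slice_point_def)
  have harm: "harmonic_at (\<lambda>x. \<kappa> * Re (?k r x)) y"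
    if r: "r > 0" "cball c r \<subseteq> S" and out: "cnj c \<notin> sphere c r" for \<kappa> r
  proof -
    have "continuous_on (sphere c r) \<phi>"
      using r(2) hol by (meson holomorphic_on_imp_continuous_on holomorphic_on_subset sphere_cball subset_trans)
    then have "harmonic_at (\<lambda>x. kernel_integral \<phi> c r (slice_point x)) y"
      by (rule harmonic_at_contour_kernel) (use r out in \<open>auto simp: c_def\<close>)
    moreover have "bounded_linear (\<lambda>u. \<kappa> * Re (u / (2 * of_real pi * \<i>)))"
      by (intro bounded_linear_const_mult bounded_linear_compose [OF bounded_linear_Re] bounded_linear_divide)
    ultimately show ?thesis by (rule harmonic_at_bounded_linear [rotated])
  qed
  obtain R where R: "R > 0" "cball c R \<subseteq> S"
    using S y open_contains_cball unfolding c_def by blast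
  show ?thesis
  proof (cases "Im c = 0")
    case True
    then have cc: "cnj c = c" by (simp add: complex_eq_iff)
    have "harmonic_at (\<lambda>x. 1 * Re (?k R x)) y"
      by (rule harm) (use R cc in auto)
    then show ?thesis
    proof (rule harmonic_at_cong)
      show "\<forall>\<^sub>F x in nhds y. ?g x = 1 * Re (?k R x)"
        using ev [OF R(1)]
      proof eventually_elim
        case (elim x)
        let ?w = "slice_point x"
        show ?case
        proof (cases "Im ?w = 0")
          case True
          then show ?thesis using kernel_integral_real [OF hol R(2,1) elim True] by simp
        next
          case False
          have "dist (cnj c) (cnj ?w) = dist c ?w" by (simp add: dist_norm complex_mod_cnj flip: complex_cnj_diff)
          then have w': "cnj ?w \<in> ball c R" using elim cc by simp
          have "\<phi> (cnj ?w) = cnj (\<phi> ?w)" using elim R(2) by (intro sym) auto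
          then have "kernel_integral \<phi> c R ?w / (2 * of_real pi * \<i>) = (\<phi> ?w - cnj (\<phi> ?w)) / (?w - cnj ?w)"
            using kernel_integral_symmetric [OF hol R(2,1) elim w' False] by simp
          also have "\<dots> = of_real (Im (\<phi> ?w) / Im ?w)"
            using False by (simp add: complex_diff_cnj field_simps)
          finally show ?thesis using False by simp
        qed
      qed
    qed
  next
    case False
    with Im0 [of y] have pos: "Im c > 0" by (simp add: c_def)
    \<comment> \<open>The bound \<open>Im c / 2\<close> keeps the circle, and with it \<open>w\<close>, in the open upper half plane.\<close>
    define r where "r = min R (Im c / 2)"
    have r: "r > 0" "r < Im c" "cball c r \<subseteq> S" using R pos by (auto simp: r_def)
    have "Im (c - cnj c) \<le> cmod (c - cnj c)" by (rule abs_Im_le_cmod [THEN order_trans [OF abs_ge_self]])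
    then have "cnj c \<notin> sphere c r" using r by (auto simp: dist_norm)
    then have "harmonic_at (\<lambda>x. 2 * Re (?k r x)) y"
      using r by (intro harm) auto
    then show ?thesis
    proof (rule harmonic_at_cong)
      show "\<forall>\<^sub>F x in nhds y. ?g x = 2 * Re (?k r x)"
        using ev [OF r(1)]
      proof eventually_elim
        case (elim x)
        let ?w = "slice_point x"
        have "\<bar>Im (c - ?w)\<bar> \<le> cmod (c - ?w)" by (rule abs_Im_le_cmod)
        with elim r have p: "Im ?w > 0" by (simp add: dist_norm)
        have "kernel_integral \<phi> c r ?w / (2 * of_real pi * \<i>) = \<phi> ?w / (?w - cnj ?w)"
          using kernel_integral_upper [OF hol r(3,2) elim] by simp
        then show ?case using p by (simp add: complex_diff_cnj Re_divide power2_eq_square)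
      qed
    qed
  qed
qed

section \<open>Stem functions holomorphic in one variable\<close>

text \<open>The structure \<open>\<J>_h\<close> pairs the component at \<open>L\<close> with that at \<open>insert h L\<close>. The coordinate in direction
\<open>c\<close> of such a pair is a complex number, on which \<open>\<J>_h\<close> acts as multiplication by \<open>\<i>\<close>.\<close>

definition cpair :: "quat \<Rightarrow> 'n::finite \<Rightarrow> 'n set \<Rightarrow> 'n stem_val \<Rightarrow> complex" where
  "cpair c h L w = Complex (c \<bullet> (w $ L)) (c \<bullet> (w $ insert h L))"

lemma bounded_linear_cpair: "bounded_linear (cpair c h L)"
proof -
  have "bounded_linear (\<lambda>w. of_real (c \<bullet> (w $ L)) + \<i> * of_real (c \<bullet> (w $ insert h L)))"
    by (intro bounded_linear_add bounded_linear_const_mult bounded_linear_of_real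
        bounded_linear_compose [OF bounded_linear_of_real] bounded_linear_compose [OF bounded_linear_inner_right] bounded_linear_vec_nth)
  then show ?thesis by (simp add: cpair_def[abs_def] Complex_eq)
qed

lemmas continuous_on_cpair [continuous_intros] = bounded_linear.continuous_on [OF bounded_linear_cpair]

text \<open>The condition \<open>dbar h F = 0\<close> in a form that presupposes differentiability in \<open>z_h\<close> only.\<close>

definition holo_var :: "'n::finite cvec set \<Rightarrow> 'n \<Rightarrow> ('n cvec \<Rightarrow> 'n stem_val) \<Rightarrow> bool" where
  "holo_var D h F \<longleftrightarrow> (\<forall>z\<in>D. \<forall>L c. h \<notin> L \<longrightarrow> holo_along h (\<lambda>z. cpair c h L (F z)) z)"

lemma holo_var_cong:
  assumes "open D" "\<And>z. z \<in> D \<Longrightarrow> F z = G z" "holo_var D h G"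
  shows "holo_var D h F"
  unfolding holo_var_def
proof (intro ballI allI impI)
  fix z L c assume z: "z \<in> D" "h \<notin> L"
  show "holo_along h (\<lambda>z. cpair c h L (F z)) z"
  proof (rule holo_along_cong [OF assms(1) z(1)])
    show "holo_along h (\<lambda>z. cpair c h L (G z)) z" using assms(3) z by (simp add: holo_var_def)
  qed (simp add: assms(2))
qed

lemma stem_J_nth: "stem_J h w $ N = (if h \<in> N then w $ (N - {h}) else - w $ insert h N)"
proof -
  have "stem_J h w $ N = (\<Sum>K\<in>UNIV. if sym_diff K {h} = N then (-1) ^ card (K \<inter> {h}) * w $ K else 0)"
    by (simp add: stem_J_def axis_def eq_commute)
  also have "\<dots> = (\<Sum>K\<in>UNIV. if K = sym_diff N {h} then (-1) ^ card (K \<inter> {h}) * w $ K else 0)"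
    by (intro sum.cong if_cong) auto
  also have "\<dots> = (-1) ^ card (sym_diff N {h} \<inter> {h}) * w $ sym_diff N {h}" by simp
  also have "\<dots> = (if h \<in> N then w $ (N - {h}) else - w $ insert h N)"
  proof (cases "h \<in> N")
    case True
    then have "sym_diff N {h} = N - {h}" by auto
    then show ?thesis using True by simp
  next
    case False
    then have "sym_diff N {h} = insert h N" by auto
    then show ?thesis using False by simp
  qed
  finally show ?thesis .
qed

lemma cpair_stem_J: "h \<notin> L \<Longrightarrow> cpair c h L (stem_J h w) = \<i> * cpair c h L w"
  by (simp add: cpair_def stem_J_nth complex_eq_iff)

lemma stem_J_stem_J: "stem_J h (stem_J h w) = - w"
  by (auto simp: vec_eq_iff stem_J_nth insert_absorb)

lemma directional_deriv_has_derivative: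
  assumes "(F has_derivative F') (at z)"
  shows "directional_deriv v F z = F' v"
proof -
  have "((\<lambda>t. F (z + t *\<^sub>R v)) has_derivative (\<lambda>t. F' (t *\<^sub>R v))) (at 0)"
    by (rule has_derivative_compose [of "\<lambda>t. z + t *\<^sub>R v" "\<lambda>t. t *\<^sub>R v" 0 UNIV F F'])
       (use assms in \<open>auto intro!: derivative_eq_intros\<close>)
  moreover have "F' (t *\<^sub>R v) = t *\<^sub>R F' v" for t
    using assms has_derivative_linear linear_cmul by blast
  ultimately show ?thesis
    unfolding directional_deriv_def by (intro vector_derivative_at) (simp add: has_vector_derivative_def)
qed

text \<open>Applied to the pairing, \<open>dbar h F = 0\<close> says that the derivative in the direction \<open>\<i>\<close> is \<open>\<i>\<close> times the
derivative in the direction 1, that is, that the real derivative is complex linear.\<close>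

lemma holomorphic_stem_imp_holo_var:
  assumes "holomorphic_stem D F"
  shows "holo_var D h F"
  unfolding holo_var_def
proof (intro ballI allI impI)
  fix z L c assume z: "z \<in> D" and L: "h \<notin> L"
  interpret cp: bounded_linear "cpair c h L" by (rule bounded_linear_cpair)
  obtain F' where F': "(F has_derivative F') (at z)"
    using assms z unfolding holomorphic_stem_def C1_on_def by blast
  define A where "A = F' (axis h 1)"
  define B where "B = F' (axis h \<i>)"
  have "dbar h F z = 0" using assms z unfolding holomorphic_stem_def by blast
  then have "A + stem_J h B = 0"
    by (simp add: dbar_def directional_deriv_has_derivative [OF F'] A_def B_def)
  then have "cpair c h L (A + stem_J h B) = 0"
    by (simp add: cp.zero)
  then have AB: "cpair c h L B = \<i> * cpair c h L A"
    using L by (simp add: cp.add cpair_stem_J complex_eq_iff)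
  have "((\<lambda>u. cpair c h L (F (z + axis h u))) has_derivative (\<lambda>u. cpair c h L (F' (axis h u)))) (at 0)"
  proof (rule bounded_linear.has_derivative [OF bounded_linear_cpair])
    have "((\<lambda>u. z + axis h u) has_derivative axis h) (at 0)"
      using bounded_linear_imp_has_derivative [OF bounded_linear_axis] by (auto intro!: derivative_eq_intros)
    then show "((\<lambda>u. F (z + axis h u)) has_derivative (\<lambda>u. F' (axis h u))) (at 0)"
      by (rule has_derivative_compose) (use F' in simp)
  qed
  moreover have "cpair c h L (F' (axis h u)) = cpair c h L A * u" for u
  proof -
    have "axis h u = Re u *\<^sub>R axis h 1 + (Im u *\<^sub>R axis h \<i> :: 'a cvec)"
      by (simp add: vec_eq_iff axis_def complex_eq_iff)
    then have "F' (axis h u) = Re u *\<^sub>R A + Im u *\<^sub>R B"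
      using has_derivative_linear [OF F'] by (simp add: linear_add linear_cmul A_def B_def)
    then have "cpair c h L (F' (axis h u)) = Re u *\<^sub>R cpair c h L A + Im u *\<^sub>R cpair c h L B"
      by (simp add: cp.add cp.scaleR)
    then show ?thesis unfolding AB by (simp add: complex_eq_iff algebra_simps)
  qed
  ultimately have "((\<lambda>u. cpair c h L (F (z + axis h u))) has_field_derivative cpair c h L A) (at 0)"
    by (simp add: has_field_derivative_def)
  then show "holo_along h (\<lambda>z. cpair c h L (F z)) z"
    unfolding holo_along_def field_differentiable_def by blast
qed

text \<open>Osgood's lemma for stem functions: continuity and holomorphy in each variable separately make the
partial derivatives continuous, hence the function continuously differentiable.\<close>

lemma holo_var_imp_holomorphic_stem:
  fixes F :: "'n::finite cvec \<Rightarrow> 'n stem_val"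
  assumes D: "open D" and F: "stem D F" and hol: "\<And>h. holo_var D h F"
  shows "holomorphic_stem D F"
proof -
  have cont: "continuous_on D F" using F by (simp add: stem_def)
  define cd where "cd = (\<lambda>c h L. cderiv h (\<lambda>z. cpair c h L (F z)))"
  have ha: "holo_along h (\<lambda>z. cpair c h L (F z)) z" if "h \<notin> L" "z \<in> D" for c h L z
    using hol that unfolding holo_var_def by blast
  have ccd: "continuous_on D (cd c h L)" if "h \<notin> L" for c h L
    unfolding cd_def using that ha by (intro continuous_on_cderiv D continuous_intros cont) auto
  \<comment> \<open>The derivative of \<open>F\<close> in the direction \<open>Re z_h\<close>; the one in the direction \<open>Im z_h\<close> is \<open>stem_J h\<close> of it.\<close>
  define P where "P = (\<lambda>h z. \<chi> N. \<Sum>c\<in>Basis. (if h \<in> N then Im (cd c h (N - {h}) z) else Re (cd c h N z)) *\<^sub>R c)"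
  have P_inner: "P h z $ N \<bullet> c = (if h \<in> N then Im (cd c h (N - {h}) z) else Re (cd c h N z))" if "c \<in> Basis" for h z N c
    using that by (simp add: P_def inner_sum_left_Basis)
  have P_inner': "c \<bullet> P h z $ N = (if h \<in> N then Im (cd c h (N - {h}) z) else Re (cd c h N z))" if "c \<in> Basis" for h z N c
    using P_inner [OF that] by (simp add: inner_commute)
  have cP: "continuous_on D (P h)" for h
    unfolding P_def
  proof (intro continuous_on_vec_lambda continuous_on_sum continuous_on_scaleR continuous_on_const)
    show "continuous_on D (\<lambda>z. if h \<in> N then Im (cd c h (N - {h}) z) else Re (cd c h N z))" for N c
      by (cases "h \<in> N") (auto intro!: continuous_intros ccd)
  qed
  have cJP: "continuous_on D (\<lambda>z. stem_J h (P h z))" for h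
  proof -
    have "stem_J h (P h z) = (\<chi> N. if h \<in> N then P h z $ (N - {h}) else - P h z $ insert h N)" for z
      by (simp add: vec_eq_iff stem_J_nth)
    moreover have "continuous_on D (\<lambda>z. if h \<in> N then P h z $ (N - {h}) else - P h z $ insert h N)" for N
      by (cases "h \<in> N") (auto intro!: continuous_intros cP)
    ultimately show ?thesis by (simp add: continuous_on_vec_lambda)
  qed
  have der: "((\<lambda>t. cpair c h L (F (z + t *\<^sub>R axis h v))) has_vector_derivative v * cd c h L z) (at 0)"
    if "z \<in> D" "h \<notin> L" for c h L z v
  proof -
    have "((\<lambda>u. cpair c h L (F (z + axis h u))) has_field_derivative cd c h L z) (at 0)"
      using holo_along_has_derivative [of h "\<lambda>z. cpair c h L (F z)" z 0] ha that by (simp add: cd_def)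
    moreover have "((\<lambda>t. t *\<^sub>R v) has_vector_derivative v) (at 0)"
      by (auto intro!: derivative_eq_intros)
    ultimately have "(((\<lambda>u. cpair c h L (F (z + axis h u))) \<circ> (\<lambda>t. t *\<^sub>R v)) has_vector_derivative v * cd c h L z) (at 0)"
      by (intro field_vector_diff_chain_at) auto
    moreover have "axis h (t *\<^sub>R v) = t *\<^sub>R (axis h v :: 'n cvec)" for t by (simp add: vec_eq_iff axis_def)
    ultimately show ?thesis by (simp add: o_def)
  qed
  have partial: "((\<lambda>t. F (z + t *\<^sub>R axis h v)) has_vector_derivative
      (if v = 1 then P h z else stem_J h (P h z))) (at 0)" (is "(_ has_vector_derivative ?d) _")
    if z: "z \<in> D" and v: "v = 1 \<or> v = \<i>" for z h v
  proof -
    have "((\<lambda>t. F (z + t *\<^sub>R axis h v) $ N \<bullet> c) has_vector_derivative ?d $ N \<bullet> c) (at 0)"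
      if c: "c \<in> Basis" for N c
    proof (cases "h \<in> N")
      case True
      have "((\<lambda>t. Im (cpair c h (N - {h}) (F (z + t *\<^sub>R axis h v)))) has_vector_derivative Im (v * cd c h (N - {h}) z)) (at 0)"
        by (intro bounded_linear.has_vector_derivative [OF bounded_linear_Im] der z) simp
      then show ?thesis using True v c by (auto simp: cpair_def insert_absorb stem_J_nth P_inner P_inner' inner_commute)
    next
      case False
      have "((\<lambda>t. Re (cpair c h N (F (z + t *\<^sub>R axis h v)))) has_vector_derivative Re (v * cd c h N z)) (at 0)"
        by (intro bounded_linear.has_vector_derivative [OF bounded_linear_Re] der z False)
      then show ?thesis using False v c by (auto simp: cpair_def stem_J_nth P_inner P_inner' inner_commute)
    qed
    then show ?thesis
      unfolding has_vector_derivative_def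
      by (subst has_derivative_componentwise_within) (auto simp: Basis_vec_def inner_axis)
  qed
  have Bas: "\<exists>h v. b = axis h v \<and> (v = 1 \<or> v = \<i>)" if "b \<in> Basis" for b :: "'n cvec"
    using that by (auto simp: Basis_vec_def Basis_complex_def)
  have dd: "directional_deriv (axis h v) F z = (if v = 1 then P h z else stem_J h (P h z))"
    if "z \<in> D" "v = 1 \<or> v = \<i>" for z h v
    unfolding directional_deriv_def using partial [OF that] by (rule vector_derivative_at)
  have "C1_on D F"
  proof (rule C1_on_continuous_partials [OF D])
    fix b :: "'n cvec" assume "b \<in> Basis"
    then obtain h v where b: "b = axis h v" "v = 1 \<or> v = \<i>" using Bas by blast
    show "((\<lambda>t. F (z + t *\<^sub>R b)) has_vector_derivative directional_deriv b F z) (at 0)" if "z \<in> D" for z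
      using partial [OF that b(2)] dd [OF that b(2)] by (simp add: b(1))
    have "continuous_on D (\<lambda>z. if v = 1 then P h z else stem_J h (P h z))"
      by (cases "v = 1") (auto intro: cP cJP)
    then show "continuous_on D (directional_deriv b F)"
      by (rule continuous_on_eq) (use dd b in simp)
  qed
  moreover have "dbar h F z = 0" if "z \<in> D" for z h
    using that by (simp add: dbar_def dd stem_J_stem_J)
  ultimately show ?thesis using F by (simp add: holomorphic_stem_def)
qed

lemma conj_at_nth: "conj_at h z $ k = (if k = h then cnj (z $ k) else z $ k)"
  by (simp add: conj_at_def)

lemma invariantD: "invariant D \<Longrightarrow> z \<in> D \<Longrightarrow> conj_at h z \<in> D"
  by (simp add: invariant_def)

lemma invariant_nonreal_part: "invariant D \<Longrightarrow> invariant (nonreal_part D H)"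
  unfolding invariant_def nonreal_part_def by (auto simp: conj_at_nth split: if_splits)

lemma nonreal_part_subset: "nonreal_part D H \<subseteq> D"
  by (auto simp: nonreal_part_def)

text \<open>Adding the same small positive amount to all imaginary parts leads from any point of an open set
into its nonreal part, so closed conditions extend by continuity.\<close>

lemma nonreal_part_dense:
  fixes \<phi> :: "'n::finite cvec \<Rightarrow> 'a::t2_space"
  assumes D: "open D" and cont: "continuous_on D \<phi>" and C: "closed C"
    and nonreal: "\<And>z. z \<in> nonreal_part D H \<Longrightarrow> \<phi> z \<in> C" and z: "z \<in> D"
  shows "\<phi> z \<in> C"
proof -
  let ?p = "\<lambda>t. z + t *\<^sub>R (\<chi> h. \<i>) :: 'n cvec"
  have lim: "(?p \<longlongrightarrow> z + 0 *\<^sub>R (\<chi> h. \<i>)) (at_right 0)"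
    by (intro tendsto_intros)
  then have "((\<lambda>t. \<phi> (?p t)) \<longlongrightarrow> \<phi> z) (at_right 0)"
    using cont D z by (intro isCont_tendsto_compose [of z \<phi>]) (auto simp: continuous_on_eq_continuous_at)
  moreover have "\<forall>\<^sub>F t in at_right 0. \<phi> (?p t) \<in> C"
  proof -
    have "\<forall>\<^sub>F t in at_right 0. ?p t \<in> D"
      using lim D z by (intro topological_tendstoD) auto
    moreover have "\<forall>\<^sub>F t in at_right 0. \<forall>h\<in>UNIV. Im (z $ h) + t \<noteq> 0"
    proof (rule eventually_ball_finite)
      show "\<forall>h\<in>UNIV. \<forall>\<^sub>F t in at_right 0. Im (z $ h) + t \<noteq> 0"
      proof
        fix h
        show "\<forall>\<^sub>F t in at_right 0. Im (z $ h) + t \<noteq> 0"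
        proof (cases "Im (z $ h) = 0")
          case True
          then show ?thesis by (simp add: eventually_at_right_less [THEN eventually_mono])
        next
          case False
          have "((\<lambda>t. Im (z $ h) + t) \<longlongrightarrow> Im (z $ h) + 0) (at_right 0)" by (intro tendsto_intros)
          from tendsto_imp_eventually_ne [OF this, of 0] False show ?thesis by simp
        qed
      qed
    qed simp
    ultimately show ?thesis
      by eventually_elim (auto intro!: nonreal simp: nonreal_part_def)
  qed
  ultimately show ?thesis using C by (intro Lim_in_closed_set [of C _ "at_right (0::real)"]) auto
qed

lemma nonreal_part_eq:
  fixes \<phi> \<psi> :: "'n::finite cvec \<Rightarrow> 'a::real_normed_vector"
  assumes "open D" "continuous_on D \<phi>" "continuous_on D \<psi>"
    and "\<And>z. z \<in> nonreal_part D H \<Longrightarrow> \<phi> z = \<psi> z" "z \<in> D"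
  shows "\<phi> z = \<psi> z"
proof -
  have "\<phi> z - \<psi> z \<in> {0}"
    by (rule nonreal_part_dense [where D = D and H = H]) (use assms in \<open>auto intro!: continuous_intros\<close>)
  then show ?thesis by simp
qed

lemma stem_conj: "stem D F \<Longrightarrow> z \<in> D \<Longrightarrow> F (conj_at h z) $ K = (if h \<in> K then - F z $ K else F z $ K)"
  by (simp add: stem_def)

lemma stemI:
  assumes "continuous_on D F"
    and "\<And>z h K. z \<in> D \<Longrightarrow> F (conj_at h z) $ K = (if h \<in> K then - F z $ K else F z $ K)"
  shows "stem D F"
  using assms unfolding stem_def by simp

lemma stem_subset: "stem D F \<Longrightarrow> E \<subseteq> D \<Longrightarrow> stem E F"
  unfolding stem_def by (auto intro: continuous_on_subset)

text \<open>The spherical derivative in one variable on the level of stem functions, with its continuous extension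
to \<open>Im z_h = 0\<close>; the extension is taken coordinatewise.\<close>

definition spherical_quotient :: "'n::finite \<Rightarrow> ('n cvec \<Rightarrow> 'n stem_val) \<Rightarrow> 'n cvec \<Rightarrow> 'n stem_val" where
  "spherical_quotient h F z = (\<chi> L. if h \<in> L then 0
     else \<Sum>c\<in>Basis. Im_quotient h (\<lambda>z. cpair c h L (F z)) z *\<^sub>R c)"

lemma spherical_quotient_nonreal:
  assumes "Im (z $ h) \<noteq> 0"
  shows "spherical_quotient h F z $ L = (if h \<in> L then 0 else inverse (Im (z $ h)) *\<^sub>R F z $ insert h L)"
proof -
  have "(\<Sum>c\<in>Basis. Im_quotient h (\<lambda>z. cpair c h L (F z)) z *\<^sub>R c)
     = inverse (Im (z $ h)) *\<^sub>R (\<Sum>c\<in>Basis. (F z $ insert h L \<bullet> c) *\<^sub>R c)"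
    using assms by (simp add: Im_quotient_def cpair_def scaleR_sum_right divide_inverse inner_commute mult.commute)
  then show ?thesis by (simp add: spherical_quotient_def euclidean_representation)
qed

lemma continuous_on_spherical_quotient:
  assumes D: "open D" and F: "stem D F" and hol: "holo_var D h F"
  shows "continuous_on D (spherical_quotient h F)"
  unfolding spherical_quotient_def
proof (intro continuous_on_vec_lambda)
  have cont: "continuous_on D F" using F by (simp add: stem_def)
  show "continuous_on D (\<lambda>z. if h \<in> L then 0 else \<Sum>c\<in>Basis. Im_quotient h (\<lambda>z. cpair c h L (F z)) z *\<^sub>R c)" for L
  proof (cases "h \<in> L")
    case False
    have "continuous_on D (Im_quotient h (\<lambda>z. cpair c h L (F z)))" for c
    proof (rule continuous_on_Im_quotient [OF D])
      show "holo_along h (\<lambda>z. cpair c h L (F z)) z" if "z \<in> D" for z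
        using hol False that by (simp add: holo_var_def)
      show "Im (cpair c h L (F z)) = 0" if "z \<in> D" "Im (z $ h) = 0" for z
        using stem_eq_0 [OF F that(1) _ that(2)] by (simp add: cpair_def)
    qed (intro continuous_intros cont)
    then show ?thesis using False by (auto intro!: continuous_intros)
  qed simp
qed

text \<open>The parity relations hold by inspection where \<open>Im z_h \<noteq> 0\<close>, and they pass to real \<open>z_h\<close> by density.\<close>

lemma stem_spherical_quotient:
  fixes D :: "'n::finite cvec set"
  assumes D: "open D" "invariant D" and F: "stem D F" and hol: "holo_var D h F"
  shows "stem D (spherical_quotient h F)"
proof (rule stemI)
  show cont: "continuous_on D (spherical_quotient h F)" by (rule continuous_on_spherical_quotient [OF D(1) F hol])
  fix z :: "'n cvec" and k K assume z: "z \<in> D"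
  have "continuous_on UNIV (conj_at k :: 'n cvec \<Rightarrow> _)"
    unfolding conj_at_def
  proof (intro continuous_on_vec_lambda)
    show "continuous_on UNIV (\<lambda>z :: 'n cvec. if j = k then cnj (z $ j) else z $ j)" for j
      by (cases "j = k") (auto intro!: continuous_intros)
  qed
  then have cc: "continuous_on D (\<lambda>z. spherical_quotient h F (conj_at k z) $ K)"
    using invariantD [OF D(2)]
    by (intro continuous_on_component continuous_on_compose2 [OF cont]) (auto intro: continuous_on_subset)
  show "spherical_quotient h F (conj_at k z) $ K = (if k \<in> K then - spherical_quotient h F z $ K else spherical_quotient h F z $ K)"
  proof (rule nonreal_part_eq [OF D(1) cc _ _ z, where H = "{h}"])
    show "continuous_on D (\<lambda>z. if k \<in> K then - spherical_quotient h F z $ K else spherical_quotient h F z $ K)"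
      by (cases "k \<in> K") (auto intro!: continuous_intros cont)
    fix z assume "z \<in> nonreal_part D {h}"
    then have z: "z \<in> D" "Im (z $ h) \<noteq> 0" "Im (conj_at k z $ h) \<noteq> 0"
      by (auto simp: nonreal_part_def conj_at_nth)
    show "spherical_quotient h F (conj_at k z) $ K = (if k \<in> K then - spherical_quotient h F z $ K else spherical_quotient h F z $ K)"
      using z by (auto simp: spherical_quotient_nonreal stem_conj [OF F] conj_at_nth)
  qed
qed

text \<open>Where \<open>Im z_h \<noteq> 0\<close>, the quotient is \<open>F\<close> divided by a number that does not depend on \<open>z_k\<close>; the
remaining points are covered by the limit argument.\<close>

lemma holo_var_spherical_quotient:
  assumes D: "open D" and F: "stem D F" and hol: "holo_var D h F" and k: "holo_var D k F" "k \<noteq> h"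
  shows "holo_var D k (spherical_quotient h F)"
  unfolding holo_var_def
proof (intro ballI allI impI)
  fix z L c assume z: "z \<in> D" and L: "k \<notin> L"
  show "holo_along k (\<lambda>z. cpair c k L (spherical_quotient h F z)) z"
  proof (rule holo_along_real_limit [OF D _ k(2) _ z])
    show "continuous_on D (\<lambda>z. cpair c k L (spherical_quotient h F z))"
      by (intro continuous_intros continuous_on_spherical_quotient assms)
    fix z assume z: "z \<in> D" "Im (z $ h) \<noteq> 0"
    have im: "Im ((z + axis k u) $ h) = Im (z $ h)" for u using k(2) by (simp add: axis_def)
    show "holo_along k (\<lambda>z. cpair c k L (spherical_quotient h F z)) z"
    proof (cases "h \<in> L")
      case True
      then show ?thesis by (simp add: holo_along_def cpair_def spherical_quotient_def zero_complex.code[symmetric])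
    next
      case False
      have "holo_along k (\<lambda>z. cpair c k (insert h L) (F z)) z"
        using k L z unfolding holo_var_def by auto
      then have "(\<lambda>u. of_real (inverse (Im (z $ h))) * cpair c k (insert h L) (F (z + axis k u))) field_differentiable at 0"
        unfolding holo_along_def by (intro derivative_intros) auto
      moreover have "of_real (inverse (Im (z $ h))) * cpair c k (insert h L) (F (z + axis k u)) = cpair c k L (spherical_quotient h F (z + axis k u))" for u
      proof -
        have "spherical_quotient h F (z + axis k u) $ M = (if h \<in> M then 0 else inverse (Im (z $ h)) *\<^sub>R F (z + axis k u) $ insert h M)" for M
          using spherical_quotient_nonreal [of "z + axis k u" h F M] z(2) unfolding im .
        then show ?thesis
          using z(2) False k(2) by (simp add: cpair_def insert_commute complex_eq_iff power2_eq_square field_simps)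
      qed
      ultimately show ?thesis by (simp add: holo_along_def)
    qed
  qed
qed

definition spherical_stem :: "'n::finite set \<Rightarrow> ('n cvec \<Rightarrow> 'n stem_val) \<Rightarrow> 'n cvec \<Rightarrow> 'n stem_val" where
  "spherical_stem H F z = (\<chi> L. if L \<inter> H = {} then inverse (\<Prod>h\<in>H. Im (z $ h)) *\<^sub>R F z $ (L \<union> H) else 0)"

text \<open>Spherical derivatives with respect to a set of variables are iterated spherical quotients. Each step
uses up the holomorphy in its own variable and preserves that in the others.\<close>

lemma spherical_stem_extends:
  fixes D :: "'n::finite cvec set"
  assumes D: "open D" "invariant D" and F: "stem D F" and hol: "\<And>h. h \<in> B \<Longrightarrow> holo_var D h F" and H: "H \<subseteq> B"
  obtains G where "stem D G" "\<And>z. z \<in> nonreal_part D H \<Longrightarrow> G z = spherical_stem H F z"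
    "\<And>h. h \<in> B - H \<Longrightarrow> holo_var D h G"
proof -
  have "finite H" by simp
  then have "\<exists>G. stem D G \<and> (\<forall>z\<in>nonreal_part D H. G z = spherical_stem H F z) \<and> (\<forall>h\<in>B - H. holo_var D h G)"
    using H
  proof (induction H rule: finite_induct)
    case empty
    then show ?case using F hol by (intro exI [of _ F]) (auto simp: spherical_stem_def vec_eq_iff)
  next
    case (insert h H)
    then obtain G where G: "stem D G" "\<forall>z\<in>nonreal_part D H. G z = spherical_stem H F z" "\<forall>h\<in>B - H. holo_var D h G"
      by auto
    have h: "holo_var D h G" using G insert by auto
    show ?case
    proof (intro exI conjI ballI)
      show "stem D (spherical_quotient h G)" by (rule stem_spherical_quotient [OF D G(1) h])
      show "holo_var D k (spherical_quotient h G)" if "k \<in> B - insert h H" for k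
        using that G(3) by (intro holo_var_spherical_quotient D G h) auto
      fix z assume "z \<in> nonreal_part D (insert h H)"
      then have "Im (z $ h) \<noteq> 0" "G z = spherical_stem H F z" using G(2) by (auto simp: nonreal_part_def)
      then show "spherical_quotient h G z = spherical_stem (insert h H) F z"
        using insert.hyps by (auto simp: vec_eq_iff spherical_quotient_nonreal spherical_stem_def)
    qed
  qed
  then show thesis using that by blast
qed

section \<open>Slice functions and their stem functions\<close>

abbreviation unit_dirs :: "'n::finite qvec \<Rightarrow> bool" where
  "unit_dirs J \<equiv> \<forall>h. J $ h \<in> imag_units"

lemma imag_units_uminus: "J \<in> imag_units \<Longrightarrow> - J \<in> imag_units"
  by (simp add: imag_units_def)

lemma quat_i_imag_unit: "Quat 0 1 0 0 \<in> imag_units"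
  by (simp add: imag_units_def power2_eq_square quat_eq_iff)

lemma imag_unit_nonzero: "J \<in> imag_units \<Longrightarrow> J \<noteq> 0"
  using imag_unitsD(2) by force

lemma ordered_prod_nonzero:
  "\<forall>k. J k \<in> imag_units \<Longrightarrow> ordered_prod J K \<noteq> 0"
  unfolding ordered_prod_def by (auto simp: prod_list_zero_iff imag_unit_nonzero)

text \<open>The imaginary unit that represents \<open>y\<close> over its slice point. On the reals every unit would do, and
one is chosen arbitrarily.\<close>

definition direction :: "quat \<Rightarrow> quat" where
  "direction y = (if Im (slice_point y) = 0 then Quat 0 1 0 0
     else inverse (Im (slice_point y)) *\<^sub>R (y - of_real (qRe y)))"

lemma direction_imag_unit: "direction y \<in> imag_units"
proof (cases "Im (slice_point y) = 0")
  case False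
  let ?s = "(qI y)\<^sup>2 + (qJ y)\<^sup>2 + (qK y)\<^sup>2"
  have s: "(Im (slice_point y))\<^sup>2 = ?s" by (simp add: slice_point_def)
  have "(direction y)\<^sup>2 = (inverse (Im (slice_point y)))\<^sup>2 *\<^sub>R (- of_real ?s)"
    using False by (simp add: direction_def quat_eq_iff power2_eq_square algebra_simps)
  also have "\<dots> = -1"
    using False unfolding s [symmetric] by (simp add: quat_eq_iff power2_eq_square field_simps)
  finally show ?thesis by (simp add: imag_units_def)
qed (simp add: direction_def quat_i_imag_unit)

lemma slice_point_direction:
  "of_real (Re (slice_point y)) + direction y * of_real (Im (slice_point y)) = y"
proof (cases "Im (slice_point y) = 0")
  case True
  then have "(qI y)\<^sup>2 + (qJ y)\<^sup>2 + (qK y)\<^sup>2 = 0" by (simp add: slice_point_def)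
  then have "qI y = 0" "qJ y = 0" "qK y = 0" by (simp_all add: add_nonneg_eq_0_iff)
  then show ?thesis by (simp add: slice_point_def direction_def quat_eq_iff)
next
  case False
  then show ?thesis by (simp add: direction_def quat_eq_iff) (simp add: slice_point_def)
qed

lemma embed_slice_point: "embed (\<chi> h. direction (x $ h)) (\<chi> h. slice_point (x $ h)) = x"
  by (simp add: embed_def vec_eq_iff slice_point_direction)

lemma invariant_conj_set:
  assumes "invariant D" "z \<in> D"
  shows "(\<chi> k. if k \<in> A then cnj (z $ k) else z $ k) \<in> D"
proof -
  have "finite A" by simp
  then show ?thesis
  proof (induction A rule: finite_induct)
    case (insert h A)
    have "(\<chi> k. if k \<in> insert h A then cnj (z $ k) else z $ k) = conj_at h (\<chi> k. if k \<in> A then cnj (z $ k) else z $ k)"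
      using insert.hyps by (simp add: vec_eq_iff conj_at_nth)
    then show ?case using invariantD [OF assms(1) insert.IH] by simp
  qed (simp add: assms(2))
qed

text \<open>Two representations of a point differ by changing the signs of \<open>J_h\<close> and \<open>\<beta>_h\<close> simultaneously in some
of the variables, apart from the choice of \<open>J_h\<close> where \<open>\<beta>_h = 0\<close>. An invariant set contains both of the
underlying points or neither.\<close>

lemma embed_in_circularization:
  assumes D: "invariant D" and J: "unit_dirs J"
  shows "embed J z \<in> circularization D \<longleftrightarrow> z \<in> D"
proof
  assume "embed J z \<in> circularization D"
  then obtain J' z' where z': "z' \<in> D" "unit_dirs J'" "embed J z = embed J' z'"
    by (auto simp: circularization_def)
  have "z $ h = z' $ h \<or> z $ h = cnj (z' $ h)" for h
  proof -
    have "of_real (Re (z' $ h)) + J' $ h * of_real (Im (z' $ h)) = of_real (Re (z $ h)) + J $ h * of_real (Im (z $ h))"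
      using z'(3) by (simp add: embed_def vec_eq_iff)
    from embed_component_eq [OF z'(2)[rule_format] J[rule_format] this] show ?thesis
      by (auto simp: complex_eq_iff)
  qed
  then have "z = (\<chi> k. if k \<in> {h. z $ h \<noteq> z' $ h} then cnj (z' $ k) else z' $ k)"
    by (auto simp: vec_eq_iff)
  then show "z \<in> D" using invariant_conj_set [OF D z'(1)] by metis
qed (use J in \<open>auto simp: circularization_def\<close>)

lemma circularization_iff_slice_point:
  "invariant D \<Longrightarrow> x \<in> circularization D \<longleftrightarrow> (\<chi> h. slice_point (x $ h)) \<in> D"
  using embed_in_circularization [of D "\<chi> h. direction (x $ h)" "\<chi> h. slice_point (x $ h)"]
  by (simp add: embed_slice_point direction_imag_unit)

definition slice_sum :: "'n::{finite,linorder} qvec \<Rightarrow> 'n stem_val \<Rightarrow> quat" where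
  "slice_sum J w = (\<Sum>K\<in>UNIV. ordered_prod (($) J) K * w $ K)"

lemma slice_fun_eq_slice_sum:
  "stem D F \<Longrightarrow> invariant D \<Longrightarrow> z \<in> D \<Longrightarrow> unit_dirs J \<Longrightarrow>
    slice_fun D F (embed J z) = slice_sum J (F z)"
  by (simp add: slice_fun_embed slice_sum_def)

lemma slice_fun_cong: "(\<And>z. z \<in> D \<Longrightarrow> F z = G z) \<Longrightarrow> slice_fun D F = slice_fun D G"
  unfolding slice_fun_def by (intro ext arg_cong [where f = The]) auto

lemma circularizationE:
  assumes "x \<in> circularization D"
  obtains J z where "x = embed J z" "z \<in> D" "unit_dirs J"
  using assms by (auto simp: circularization_def)

definition flip :: "'n set \<Rightarrow> 'n::finite qvec \<Rightarrow> 'n qvec" where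
  "flip A J = (\<chi> k. if k \<in> A then - J $ k else J $ k)"

lemma flip_imag_units: "unit_dirs J \<Longrightarrow> unit_dirs (flip A J)"
  by (simp add: flip_def imag_units_uminus)

lemma ordered_prod_flip_set:
  "ordered_prod (($) (flip A J)) K = (-1) ^ card (A \<inter> K) * ordered_prod (($) J) K"
proof -
  have "finite A" by simp
  then show ?thesis
  proof (induction A rule: finite_induct)
    case empty
    have "flip {} J = J" by (simp add: flip_def vec_eq_iff)
    then show ?case by simp
  next
    case (insert h A)
    have "ordered_prod (($) (flip (insert h A) J)) K = (-1) ^ card (K \<inter> {h}) * ordered_prod (($) (flip A J)) K"
      by (rule ordered_prod_flip) (use insert.hyps in \<open>auto simp: flip_def\<close>)
    also have "\<dots> = (-1) ^ card (insert h A \<inter> K) * ordered_prod (($) J) K"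
      using insert by (cases "h \<in> K") (auto simp: Int_insert_left)
    finally show ?case .
  qed
qed

text \<open>Orthogonality of the characters of the group of sign changes. For \<open>K \<noteq> L\<close>, toggling an element of
\<open>sym_diff K L\<close> changes the sign of every summand.\<close>

lemma sum_characters:
  fixes K L :: "'n::finite set"
  shows "(\<Sum>A\<in>UNIV. (-1) ^ card (A \<inter> K) * (-1) ^ card (A \<inter> L) :: real) = (if K = L then card (UNIV :: 'n set set) else 0)"
proof (cases "K = L")
  case True
  then show ?thesis by (simp flip: power_add)
next
  case False
  then obtain m where m: "m \<in> sym_diff K L" by blast
  let ?f = "\<lambda>A. (-1) ^ card (A \<inter> K) * (-1) ^ card (A \<inter> L) :: real"
  have "?f (sym_diff A {m}) = - ?f A" for A
  proof -
    have *: "(-1) ^ card (sym_diff A {m} \<inter> M) = (if m \<in> M then -1 else 1) * ((-1) ^ card (A \<inter> M) :: real)" for M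
    proof (cases "m \<in> A")
      case True
      then obtain B where B: "A = insert m B" "m \<notin> B" by (rule Set.set_insert)
      then have "sym_diff A {m} = B" by auto
      then show ?thesis using B by (simp add: Int_insert_left)
    next
      case False
      then have "sym_diff A {m} = insert m A" by auto
      then show ?thesis using False by (simp add: Int_insert_left)
    qed
    show ?thesis using m unfolding * by auto
  qed
  moreover have inv: "sym_diff (sym_diff A {m}) {m} = A" for A by auto
  have "(\<Sum>A\<in>UNIV. ?f A) = (\<Sum>A\<in>UNIV. ?f (sym_diff A {m}))"
    by (rule sum.reindex_bij_witness [where i = "\<lambda>A. sym_diff A {m}" and j = "\<lambda>A. sym_diff A {m}"]) (simp_all only: inv UNIV_I)
  ultimately have "(\<Sum>A\<in>UNIV. ?f A) = - (\<Sum>A\<in>UNIV. ?f A)"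
    by (simp add: sum_negf)
  then show ?thesis using False by simp
qed

text \<open>Averaging over all sign changes against the character of \<open>K\<close> isolates the summand \<open>J_K F_K\<close>, and
\<open>J_K\<close> is invertible. In particular a stem function is determined by its slice function.\<close>

lemma slice_sum_inversion:
  fixes J :: "'n::{finite,linorder} qvec"
  assumes J: "unit_dirs J"
  shows "w $ K = inverse (of_nat (card (UNIV :: 'n set set)) * ordered_prod (($) J) K) *
    (\<Sum>A\<in>UNIV. (-1) ^ card (A \<inter> K) *\<^sub>R slice_sum (flip A J) w)"
proof -
  let ?N = "card (UNIV :: 'n set set)"
  have "(\<Sum>A\<in>UNIV. (-1) ^ card (A \<inter> K) *\<^sub>R slice_sum (flip A J) w)
     = (\<Sum>A\<in>UNIV. \<Sum>L\<in>UNIV. ((-1) ^ card (A \<inter> K) * (-1) ^ card (A \<inter> L)) *\<^sub>R (ordered_prod (($) J) L * w $ L))"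
    unfolding slice_sum_def scaleR_sum_right
    by (intro sum.cong refl) (simp add: ordered_prod_flip_set scaleR_conv_of_real mult.assoc)
  also have "\<dots> = (\<Sum>L\<in>UNIV. (\<Sum>A\<in>UNIV. (-1) ^ card (A \<inter> K) * (-1) ^ card (A \<inter> L)) *\<^sub>R (ordered_prod (($) J) L * w $ L))"
    by (subst sum.swap) (simp add: scaleR_sum_left)
  also have "\<dots> = (\<Sum>L\<in>UNIV. if L = K then real ?N *\<^sub>R (ordered_prod (($) J) L * w $ L) else 0)"
    unfolding sum_characters by (intro sum.cong) auto
  also have "\<dots> = of_nat ?N * ordered_prod (($) J) K * w $ K"
    by (simp add: scaleR_conv_of_real mult.assoc)
  finally have e: "(\<Sum>A\<in>UNIV. (-1) ^ card (A \<inter> K) *\<^sub>R slice_sum (flip A J) w) = of_nat ?N * ordered_prod (($) J) K * w $ K" .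
  have "of_nat ?N * ordered_prod (($) J) K \<noteq> 0" using ordered_prod_nonzero [OF J] by simp
  from left_inverse [OF this]
  have "inverse (of_nat ?N * ordered_prod (($) J) K) * (of_nat ?N * ordered_prod (($) J) K) * w $ K = w $ K"
    by (simp only: mult_1_left)
  then show ?thesis unfolding e by (simp only: mult.assoc)
qed

lemma stem_unique:
  fixes D :: "'n::{finite,linorder} cvec set"
  assumes F: "stem D F" "stem D G" and D: "invariant D"
    and eq: "\<And>x. x \<in> circularization D \<Longrightarrow> slice_fun D F x = slice_fun D G x" and z: "z \<in> D"
  shows "F z = G z"
proof -
  define J :: "'n qvec" where "J = (\<chi> k. Quat 0 1 0 0)"
  have J: "unit_dirs J" by (simp add: J_def quat_i_imag_unit)
  have "slice_sum (flip A J) (F z) = slice_sum (flip A J) (G z)" for A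
    using eq [of "embed (flip A J) z"] flip_imag_units [OF J, of A]
    by (simp add: embed_in_circularization D z slice_fun_eq_slice_sum F)
  then show ?thesis by (simp add: vec_eq_iff slice_sum_inversion [OF J])
qed

lemma stem_of_stem:
  assumes "f \<in> slice_functions D"
  shows "stem D (stem_of D f)" "induces D (stem_of D f) f"
  using someI_ex [of "\<lambda>F. stem D F \<and> induces D F f"] assms
  unfolding slice_functions_def stem_of_def by auto

lemma stem_of_eq:
  assumes "stem D F" "induces D F f" "invariant D" "z \<in> D"
  shows "stem_of D f z = F z"
proof -
  have f: "f \<in> slice_functions D" using assms by (auto simp: slice_functions_def)
  show ?thesis
    by (rule stem_unique [OF stem_of_stem(1) [OF f] assms(1) assms(3) _ assms(4)])
       (use stem_of_stem(2) [OF f] assms(2) in \<open>simp add: induces_def\<close>)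
qed

lemma induces_slice_fun: "induces D F (slice_fun D F)"
  by (simp add: induces_def)

section \<open>Products with coordinates and Moebius inversion\<close>

lemma sum_Pow_insert:
  assumes "finite K" "m \<notin> K"
  shows "(\<Sum>L\<in>Pow (insert m K). g L) = (\<Sum>L\<in>Pow K. g L) + (\<Sum>L\<in>Pow K. g (insert m L))"
proof -
  have "inj_on (insert m) (Pow K)" using assms(2) by (auto simp: inj_on_def)
  then have "sum g (insert m ` Pow K) = (\<Sum>L\<in>Pow K. g (insert m L))" by (simp add: sum.reindex)
  moreover have "sum g (Pow K \<union> insert m ` Pow K) = sum g (Pow K) + sum g (insert m ` Pow K)"
    using assms by (intro sum.union_disjoint) auto
  ultimately show ?thesis by (simp add: Pow_insert)
qed

text \<open>The sums over \<open>M \<subseteq> K\<close> are the coefficients that arise on multiplication by the coordinates \<open>k \<in> K\<close>. In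
the induction the sets \<open>K\<close> and \<open>insert m K\<close> are paired; the terms with the factor \<open>a m\<close> cancel.\<close>

lemma moebius_inversion:
  fixes a :: "'n \<Rightarrow> real" and b :: "'n set \<Rightarrow> 'v::real_vector"
  assumes "finite Y"
  shows "(\<Sum>K\<in>Pow Y. ((-1) ^ card (Y - K) * prod a (Y - K)) *\<^sub>R (\<Sum>M\<in>Pow K. prod a (K - M) *\<^sub>R b M)) = b Y"
  using assms
proof (induction Y arbitrary: b rule: finite_induct)
  case (insert m Y)
  let ?s = "\<lambda>Y K. (-1) ^ card (Y - K) * prod a (Y - K)"
  let ?G = "\<lambda>b K. \<Sum>M\<in>Pow K. prod a (K - M) *\<^sub>R b M"
  have K: "finite K" "m \<notin> K" "insert m Y - K = insert m (Y - K)" "insert m Y - insert m K = Y - K" if "K \<in> Pow Y" for K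
    using that insert.hyps finite_subset by auto
  have G: "?G b (insert m K) = a m *\<^sub>R ?G b K + ?G (\<lambda>M. b (insert m M)) K" if "K \<in> Pow Y" for K
  proof -
    have P: "prod a (insert m K - M) = a m * prod a (K - M)" "prod a (insert m K - insert m M) = prod a (K - M)" if M: "M \<in> Pow K" for M
    proof -
      have "m \<notin> M" using M K(2) [OF \<open>K \<in> Pow Y\<close>] by auto
      then have "insert m K - M = insert m (K - M)" "insert m K - insert m M = K - M"
        using K(2) [OF \<open>K \<in> Pow Y\<close>] by auto
      then show "prod a (insert m K - M) = a m * prod a (K - M)" "prod a (insert m K - insert m M) = prod a (K - M)"
        using K(1,2) [OF \<open>K \<in> Pow Y\<close>] by simp_all
    qed
    have "?G b (insert m K) = (\<Sum>M\<in>Pow K. prod a (insert m K - M) *\<^sub>R b M)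
        + (\<Sum>M\<in>Pow K. prod a (insert m K - insert m M) *\<^sub>R b (insert m M))"
      using K(1,2) [OF that] by (rule sum_Pow_insert)
    also have "(\<Sum>M\<in>Pow K. prod a (insert m K - M) *\<^sub>R b M) = a m *\<^sub>R ?G b K"
      unfolding scaleR_sum_right by (rule sum.cong [OF refl]) (simp only: P scaleR_scaleR)
    also have "(\<Sum>M\<in>Pow K. prod a (insert m K - insert m M) *\<^sub>R b (insert m M)) = ?G (\<lambda>M. b (insert m M)) K"
      by (rule sum.cong [OF refl]) (simp only: P)
    finally show ?thesis .
  qed
  have "(\<Sum>K\<in>Pow (insert m Y). ?s (insert m Y) K *\<^sub>R ?G b K)
     = (\<Sum>K\<in>Pow Y. ?s (insert m Y) K *\<^sub>R ?G b K) + (\<Sum>K\<in>Pow Y. ?s (insert m Y) (insert m K) *\<^sub>R ?G b (insert m K))"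
    using insert.hyps by (rule sum_Pow_insert)
  also have "\<dots> = (\<Sum>K\<in>Pow Y. ?s Y K *\<^sub>R ?G (\<lambda>M. b (insert m M)) K)"
    unfolding sum.distrib [symmetric]
  proof (rule sum.cong [OF refl])
    fix K assume K': "K \<in> Pow Y"
    have "?s (insert m Y) K = - (?s Y K * a m)" "?s (insert m Y) (insert m K) = ?s Y K"
      using K [OF K'] insert.hyps by simp_all
    then show "?s (insert m Y) K *\<^sub>R ?G b K + ?s (insert m Y) (insert m K) *\<^sub>R ?G b (insert m K)
       = ?s Y K *\<^sub>R ?G (\<lambda>M. b (insert m M)) K"
      unfolding G [OF K'] by (simp only: scaleR_add_right scaleR_scaleR scaleR_minus_left) simp
  qed
  also have "\<dots> = b (insert m Y)" by (rule insert.IH)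
  finally show ?case .
qed simp

lemma ordered_prod_insert_min:
  assumes "\<forall>k\<in>K. m < k"
  shows "ordered_prod q (insert m K) = q m * ordered_prod q K"
proof -
  have "m \<notin> K" using assms by auto
  then have "sorted_list_of_set (insert m K) = insort m (sorted_list_of_set K)"
    by (simp add: sorted_list_of_set_insert)
  also have "\<dots> = m # sorted_list_of_set K"
    using assms by (intro insort_is_Cons) auto
  finally show ?thesis by (simp add: ordered_prod_def)
qed

lemma ordered_prod_sum_expand:
  fixes a b :: "'n::{finite,linorder} \<Rightarrow> real" and J :: "'n \<Rightarrow> quat"
  shows "ordered_prod (\<lambda>k. of_real (a k) + J k * of_real (b k)) K
     = (\<Sum>L\<in>Pow K. ordered_prod J L * of_real (prod a (K - L) * prod b L))"
proof -
  have "finite K" by simp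
  then show ?thesis
  proof (induction K rule: finite_linorder_min_induct)
    case empty
    then show ?case by (simp add: ordered_prod_def)
  next
    case (insert m K)
    let ?u = "\<lambda>K L. ordered_prod J L * of_real (prod a (K - L) * prod b L)"
    let ?v = "\<lambda>L. ordered_prod J L * of_real (a m * prod a (K - L) * prod b L)"
    let ?w = "\<lambda>L. (J m * ordered_prod J L) * of_real (prod a (K - L) * (b m * prod b L))"
    have m: "m \<notin> K" using insert.hyps by auto
    have "ordered_prod (\<lambda>k. of_real (a k) + J k * of_real (b k)) (insert m K)
       = (of_real (a m) + J m * of_real (b m)) * (\<Sum>L\<in>Pow K. ?u K L)"
      using insert by (simp add: ordered_prod_insert_min)
    also have "\<dots> = (\<Sum>L\<in>Pow K. ?v L)
       + (\<Sum>L\<in>Pow K. ?w L)"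
      by (simp add: distrib_right sum_distrib_left scaleR_conv_of_real [symmetric] mult_scaleR_right mult_scaleR_left of_real_def mult.assoc mult_ac scaleR_add_right sum.distrib)
    also have "(\<Sum>L\<in>Pow K. ?v L)
       = (\<Sum>L\<in>Pow K. ?u (insert m K) L)"
    proof (rule sum.cong [OF refl])
      fix L assume "L \<in> Pow K"
      then have "insert m K - L = insert m (K - L)" "m \<notin> K - L" using m by auto
      then show "?v L = ?u (insert m K) L"
        by simp
    qed
    also have "(\<Sum>L\<in>Pow K. ?w L)
       = (\<Sum>L\<in>Pow K. ?u (insert m K) (insert m L))"
    proof (rule sum.cong [OF refl])
      fix L assume "L \<in> Pow K"
      then have "insert m K - insert m L = K - L" "m \<notin> L" "\<forall>k\<in>L. m < k" using m insert.hyps by auto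
      then show "?w L = ?u (insert m K) (insert m L)"
        by (simp add: ordered_prod_insert_min)
    qed
    also have "(\<Sum>L\<in>Pow K. ?u (insert m K) L) + \<dots>
       = (\<Sum>L\<in>Pow (insert m K). ?u (insert m K) L)"
      using m by (simp add: sum_Pow_insert)
    finally show ?case .
  qed
qed

text \<open>The stem function of the ordered product of the \<open>x_k\<close>, \<open>k \<in> K\<close>, for \<open>s = 1\<close>, and of the ordered
product of their conjugates for \<open>s = -1\<close>. It is real valued, which makes products with it insensitive to
the noncommutativity of the quaternions.\<close>

definition power_stem :: "real \<Rightarrow> 'n::finite set \<Rightarrow> 'n cvec \<Rightarrow> 'n stem_val" where
  "power_stem s K z = (\<chi> L. if L \<subseteq> K then of_real ((\<Prod>k\<in>K - L. Re (z $ k)) * (\<Prod>k\<in>L. s * Im (z $ k))) else 0)"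

lemma prod_Im_conj_at:
  "(\<Prod>k\<in>L. Im (conj_at h z $ k)) = (if h \<in> L then -1 else 1) * (\<Prod>k\<in>L. Im (z $ k))"
proof (cases "h \<in> L")
  case True
  have "(\<Prod>k\<in>L - {h}. Im (conj_at h z $ k)) = (\<Prod>k\<in>L - {h}. Im (z $ k))"
    by (intro prod.cong) (auto simp: conj_at_nth)
  then show ?thesis using True by (simp add: prod.remove [of L h] conj_at_nth)
next
  case False
  then show ?thesis by (auto simp: conj_at_nth intro!: prod.cong)
qed

lemma stem_power_stem: "stem D (power_stem s K)"
proof (rule stemI)
  show "continuous_on D (power_stem s K)"
    unfolding power_stem_def
  proof (intro continuous_on_vec_lambda)
    show "continuous_on D (\<lambda>z. if L \<subseteq> K then of_real ((\<Prod>k\<in>K - L. Re (z $ k)) * (\<Prod>k\<in>L. s * Im (z $ k))) else 0 :: quat)" for L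
      by (cases "L \<subseteq> K") (auto intro!: continuous_intros)
  qed
  fix z h L
  have "(\<Prod>k\<in>K - L. Re (conj_at h z $ k)) = (\<Prod>k\<in>K - L. Re (z $ k))"
    by (intro prod.cong) (auto simp: conj_at_nth)
  moreover have "(\<Prod>k\<in>L. s * Im (conj_at h z $ k)) = (if h \<in> L then -1 else 1) * (\<Prod>k\<in>L. s * Im (z $ k))"
    by (simp add: prod.distrib prod_Im_conj_at)
  ultimately show "power_stem s K (conj_at h z) $ L = (if h \<in> L then - power_stem s K z $ L else power_stem s K z $ L)"
    by (simp add: power_stem_def)
qed

lemma slice_sum_power_stem:
  "slice_sum J (power_stem s K z) = ordered_prod (\<lambda>k. of_real (Re (z $ k)) + J $ k * of_real (s * Im (z $ k))) K"
proof -
  have "slice_sum J (power_stem s K z) = (\<Sum>L\<in>Pow K. ordered_prod (($) J) L * power_stem s K z $ L)"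
    unfolding slice_sum_def by (rule sum.mono_neutral_right) (auto simp: power_stem_def)
  also have "\<dots> = ordered_prod (\<lambda>k. of_real (Re (z $ k)) + J $ k * of_real (s * Im (z $ k))) K"
    unfolding ordered_prod_sum_expand by (intro sum.cong) (auto simp: power_stem_def)
  finally show ?thesis .
qed

lemma induces_coord_prod:
  assumes D: "invariant D"
  shows "induces D (power_stem 1 K) (coord_prod D K)"
  unfolding induces_def
proof
  fix x assume x: "x \<in> circularization D"
  then obtain J z where z: "x = embed J z" "z \<in> D" "unit_dirs J" by (rule circularizationE)
  have "coord_prod D K x = ordered_prod (\<lambda>k. x $ k) K"
    unfolding coord_prod_def using coord_eq [OF D x] by simp
  also have "\<dots> = slice_fun D (power_stem 1 K) x"
    unfolding z(1) slice_fun_eq_slice_sum [OF stem_power_stem D z(2,3)] slice_sum_power_stem by (simp add: embed_def)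
  finally show "coord_prod D K x = slice_fun D (power_stem 1 K) x" .
qed

lemma induces_conj_coord_prod:
  assumes D: "invariant D"
  shows "induces D (power_stem (-1) K) (conj_coord_prod D K)"
  unfolding induces_def
proof
  fix x assume x: "x \<in> circularization D"
  then obtain J z where z: "x = embed J z" "z \<in> D" "unit_dirs J" by (rule circularizationE)
  have "conj_coord D j x = of_real (Re (z $ j)) + J $ j * of_real (- 1 * Im (z $ j))" for j
  proof -
    have "(\<lambda>z. axis {} (of_real (Re (z $ j))) - axis {j} (of_real (Im (z $ j)))) = power_stem (-1) {j}"
      by (intro ext) (auto simp: vec_eq_iff power_stem_def axis_def subset_singleton_iff)
    then have "conj_coord D j x = slice_fun D (power_stem (-1) {j}) (embed J z)"
      by (simp add: conj_coord_def z(1))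
    also have "\<dots> = ordered_prod (\<lambda>k. of_real (Re (z $ k)) + J $ k * of_real (- 1 * Im (z $ k))) {j}"
      unfolding slice_fun_eq_slice_sum [OF stem_power_stem D z(2,3)] slice_sum_power_stem ..
    finally show ?thesis by (simp add: ordered_prod_def)
  qed
  then show "conj_coord_prod D K x = slice_fun D (power_stem (-1) K) x"
    unfolding conj_coord_prod_def z(1) slice_fun_eq_slice_sum [OF stem_power_stem D z(2,3)] slice_sum_power_stem by simp
qed

lemma stem_mult_nth:
  "stem_mult F G z $ N = (\<Sum>M\<in>UNIV. (-1) ^ card (M - N) * (F z $ M * G z $ sym_diff M N))"
proof -
  have "stem_mult F G z $ N = (\<Sum>M\<in>UNIV. \<Sum>H\<in>UNIV. if H = sym_diff M N then (-1) ^ card (H \<inter> M) * (F z $ M * G z $ H) else 0)"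
    unfolding stem_mult_def
    by (subst sum.swap) (auto simp: axis_def intro!: sum.cong)
  also have "\<dots> = (\<Sum>M\<in>UNIV. (-1) ^ card (sym_diff M N \<inter> M) * (F z $ M * G z $ sym_diff M N))"
    by simp
  also have "\<dots> = (\<Sum>M\<in>UNIV. (-1) ^ card (M - N) * (F z $ M * G z $ sym_diff M N))"
  proof -
    have "sym_diff M N \<inter> M = M - N" for M by auto
    then show ?thesis by simp
  qed
  finally show ?thesis .
qed

lemma stem_stem_mult:
  assumes F: "stem D F" and G: "stem D G"
  shows "stem D (stem_mult F G)"
proof (rule stemI)
  have "continuous_on D F" "continuous_on D G" using assms by (simp_all add: stem_def)
  then have "continuous_on D (\<lambda>z. \<chi> N. stem_mult F G z $ N)"
    unfolding stem_mult_nth by (intro continuous_on_vec_lambda continuous_intros)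
  then show "continuous_on D (stem_mult F G)" by simp
  fix z h N assume z: "z \<in> D"
  have "F (conj_at h z) $ M * G (conj_at h z) $ sym_diff M N = (if h \<in> N then -1 else 1) *\<^sub>R (F z $ M * G z $ sym_diff M N)" for M
    using z by (auto simp: stem_conj [OF F] stem_conj [OF G])
  then have "stem_mult F G (conj_at h z) $ N = (if h \<in> N then -1 else 1) *\<^sub>R stem_mult F G z $ N"
    by (simp add: stem_mult_nth scaleR_sum_right)
  then show "stem_mult F G (conj_at h z) $ N = (if h \<in> N then - stem_mult F G z $ N else stem_mult F G z $ N)"
    by simp
qed

lemma stem_mult_power_stem_nth:
  "stem_mult (power_stem s K) F z $ N = (\<Sum>M\<in>Pow K. ((-1) ^ card (M - N) * ((\<Prod>k\<in>K - M. Re (z $ k)) * (\<Prod>k\<in>M. s * Im (z $ k)))) *\<^sub>R F z $ sym_diff M N)"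
proof -
  have "stem_mult (power_stem s K) F z $ N = (\<Sum>M\<in>Pow K. (-1) ^ card (M - N) * (power_stem s K z $ M * F z $ sym_diff M N))"
    unfolding stem_mult_nth by (rule sum.mono_neutral_right) (auto simp: power_stem_def)
  also have "\<dots> = (\<Sum>M\<in>Pow K. ((-1) ^ card (M - N) * ((\<Prod>k\<in>K - M. Re (z $ k)) * (\<Prod>k\<in>M. s * Im (z $ k)))) *\<^sub>R F z $ sym_diff M N)"
    by (intro sum.cong) (auto simp: power_stem_def scaleR_conv_of_real mult.assoc)
  finally show ?thesis .
qed

section \<open>Spherical components\<close>

definition component_stem :: "'n::finite set \<Rightarrow> 'n set \<Rightarrow> ('n cvec \<Rightarrow> 'n stem_val) \<Rightarrow> 'n cvec \<Rightarrow> 'n stem_val" where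
  "component_stem H K F = spherical_stem H (stem_mult (power_stem 1 K) F)"

text \<open>For \<open>M \<subseteq> K \<subseteq> H\<close> the sets \<open>M\<close> and \<open>sym_diff M (L \<union> H) = L \<union> (H - M)\<close> are disjoint, so no signs occur in
the product.\<close>

lemma component_stem_nth:
  assumes "L \<inter> H = {}" "K \<subseteq> H"
  shows "component_stem H K F z $ L = inverse (\<Prod>h\<in>H. Im (z $ h)) *\<^sub>R
    (\<Sum>M\<in>Pow K. (\<Prod>k\<in>K - M. Re (z $ k)) *\<^sub>R (\<Prod>k\<in>M. Im (z $ k)) *\<^sub>R F z $ (L \<union> (H - M)))"
proof -
  have "stem_mult (power_stem 1 K) F z $ (L \<union> H) =
      (\<Sum>M\<in>Pow K. (\<Prod>k\<in>K - M. Re (z $ k)) *\<^sub>R (\<Prod>k\<in>M. Im (z $ k)) *\<^sub>R F z $ (L \<union> (H - M)))"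
    unfolding stem_mult_power_stem_nth
  proof (rule sum.cong [OF refl])
    fix M assume "M \<in> Pow K"
    then have e: "M - (L \<union> H) = {}" "sym_diff M (L \<union> H) = L \<union> (H - M)" using assms by auto
    show "((-1) ^ card (M - (L \<union> H)) * ((\<Prod>k\<in>K - M. Re (z $ k)) * (\<Prod>k\<in>M. 1 * Im (z $ k)))) *\<^sub>R F z $ sym_diff M (L \<union> H)
        = (\<Prod>k\<in>K - M. Re (z $ k)) *\<^sub>R (\<Prod>k\<in>M. Im (z $ k)) *\<^sub>R F z $ (L \<union> (H - M))"
      unfolding e(2) unfolding e(1) by simp
  qed
  then show ?thesis using assms(1) by (simp add: component_stem_def spherical_stem_def)
qed

lemma component_stem_nth_zero: "L \<inter> H \<noteq> {} \<Longrightarrow> component_stem H K F z $ L = 0"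
  by (simp add: component_stem_def spherical_stem_def)

lemma stem_spherical_stem:
  assumes F: "stem D F"
  shows "stem (nonreal_part D H) (spherical_stem H F)"
proof (rule stemI)
  have cont: "continuous_on (nonreal_part D H) F"
    using stem_subset [OF F nonreal_part_subset] by (simp add: stem_def)
  show "continuous_on (nonreal_part D H) (spherical_stem H F)"
    unfolding spherical_stem_def
  proof (intro continuous_on_vec_lambda)
    show "continuous_on (nonreal_part D H) (\<lambda>z. if L \<inter> H = {} then inverse (\<Prod>h\<in>H. Im (z $ h)) *\<^sub>R F z $ (L \<union> H) else 0)" for L
    proof -
      have "(\<Prod>h\<in>H. Im (z $ h)) \<noteq> 0" if "z \<in> nonreal_part D H" for z
        using that by (simp add: nonreal_part_def)
      then show ?thesis
        by (cases "L \<inter> H = {}") (auto intro!: continuous_intros cont simp del: prod_zero_iff)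
    qed
  qed
  fix z h L assume "z \<in> nonreal_part D H"
  then have "z \<in> D" by (simp add: nonreal_part_def)
  then show "spherical_stem H F (conj_at h z) $ L = (if h \<in> L then - spherical_stem H F z $ L else spherical_stem H F z $ L)"
    by (auto simp: spherical_stem_def prod_Im_conj_at stem_conj [OF F])
qed

lemma stem_component_stem: "stem D F \<Longrightarrow> stem (nonreal_part D H) (component_stem H K F)"
  unfolding component_stem_def by (intro stem_spherical_stem stem_stem_mult stem_power_stem)

lemma slice_mult_eq:
  assumes "stem D F" "induces D F f" "stem D G" "induces D G g" "invariant D"
  shows "slice_mult D f g = slice_fun D (stem_mult F G)"
  unfolding slice_mult_def
proof (rule slice_fun_cong)
  fix z assume z: "z \<in> D"
  show "stem_mult (stem_of D f) (stem_of D g) z = stem_mult F G z"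
    using stem_of_eq [OF assms(1,2,5) z] stem_of_eq [OF assms(3,4,5) z] by (simp add: stem_mult_def)
qed

lemma spherical_component_eq:
  assumes D: "invariant D" and F: "stem D F" "induces D F f"
  shows "spherical_component D H K f = slice_fun (nonreal_part D H) (component_stem H K F)"
proof -
  let ?G = "stem_mult (power_stem 1 K) F"
  have g: "slice_mult D (coord_prod D K) f = slice_fun D ?G"
    by (rule slice_mult_eq [OF stem_power_stem induces_coord_prod F D]) (rule D)
  have "stem D ?G" by (intro stem_stem_mult stem_power_stem F)
  then have so: "stem_of D (slice_fun D ?G) z = ?G z" if "z \<in> D" for z
    by (rule stem_of_eq [OF _ induces_slice_fun D that])
  show ?thesis unfolding spherical_component_def spherical_deriv_def g
  proof (rule slice_fun_cong)
    fix z assume "z \<in> nonreal_part D H"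
    then have z: "z \<in> D" by (simp add: nonreal_part_def)
    have "(\<Sum>K\<in>Pow (- H). axis K (w $ (K \<union> H)) :: 'a stem_val) $ L = (if L \<inter> H = {} then w $ (L \<union> H) else 0)" for w :: "'a stem_val" and L
    proof -
      have "(\<Sum>K\<in>Pow (- H). axis K (w $ (K \<union> H)) :: 'a stem_val) $ L = (\<Sum>K\<in>Pow (- H). if K = L then w $ (K \<union> H) else 0)"
        by (auto simp: axis_def intro!: sum.cong)
      also have "\<dots> = (if L \<in> Pow (- H) then w $ (L \<union> H) else 0)" by (simp add: sum.delta)
      also have "L \<in> Pow (- H) \<longleftrightarrow> L \<inter> H = {}" by auto
      finally show ?thesis .
    qed
    then show "inverse (\<Prod>h\<in>H. Im (z $ h)) *\<^sub>R (\<Sum>K\<in>Pow (- H). axis K (stem_of D (slice_fun D ?G) z $ (K \<union> H))) = component_stem H K F z"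
      unfolding so [OF z] by (simp add: vec_eq_iff component_stem_def spherical_stem_def)
  qed
qed

text \<open>Moebius inversion with \<open>b M = \<beta>_M F_{L \<union> (H-M)}\<close> on the set \<open>H - N\<close> yields
\<open>\<beta>_{H-N} F_{N \<union> L}\<close>, and the factors \<open>\<beta>_N \<beta>_{H-N}\<close> cancel against \<open>\<beta>_H\<close>.\<close>

lemma stem_from_components:
  assumes z: "z \<in> nonreal_part D H" and N: "N \<subseteq> H" and L: "L \<inter> H = {}"
  shows "F z $ (N \<union> L) = (\<Sum>K\<in>Pow (H - N). ((-1) ^ card (H - K) * ((\<Prod>k\<in>H - K - N. Re (z $ k)) * (\<Prod>k\<in>N. - Im (z $ k))))
     *\<^sub>R component_stem H K F z $ L)"
proof -
  let ?\<beta> = "\<lambda>A. \<Prod>k\<in>A. Im (z $ k)" and ?\<alpha> = "\<lambda>A. \<Prod>k\<in>A. Re (z $ k)"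
  let ?Y = "H - N"
  have \<beta>: "?\<beta> A \<noteq> 0" if "A \<subseteq> H" for A using z that by (auto simp: nonreal_part_def)
  have H: "?\<beta> H = ?\<beta> N * ?\<beta> ?Y"
    using N by (simp add: prod.subset_diff mult.commute)
  have "(\<Sum>K\<in>Pow ?Y. ((-1) ^ card (H - K) * (?\<alpha> (H - K - N) * (\<Prod>k\<in>N. - Im (z $ k)))) *\<^sub>R component_stem H K F z $ L)
     = (\<Sum>K\<in>Pow ?Y. (?\<beta> N * inverse (?\<beta> H)) *\<^sub>R ((-1) ^ card (?Y - K) * ?\<alpha> (?Y - K)) *\<^sub>R
          (\<Sum>M\<in>Pow K. ?\<alpha> (K - M) *\<^sub>R ?\<beta> M *\<^sub>R F z $ (L \<union> (H - M))))"
  proof (rule sum.cong [OF refl])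
    fix K assume K: "K \<in> Pow ?Y"
    \<comment> \<open>The sign \<open>(-1)^|N|\<close> from \<open>H - K\<close> cancels against the signs of the conjugated coordinates.\<close>
    then have "H - K = (?Y - K) \<union> N" "(?Y - K) \<inter> N = {}" using N by auto
    then have "card (H - K) = card (?Y - K) + card N" by (simp add: card_Un_disjoint)
    moreover have "(\<Prod>k\<in>N. - Im (z $ k)) = (-1) ^ card N * ?\<beta> N"
      using prod.distrib [of "\<lambda>_. -1" "\<lambda>k. Im (z $ k)" N] by simp
    moreover have "H - K - N = ?Y - K" by auto
    moreover have "(-1) ^ card N * ((-1) ^ card N :: real) = 1" by (simp flip: power_mult_distrib)
    ultimately have "(-1) ^ card (H - K) * (?\<alpha> (H - K - N) * (\<Prod>k\<in>N. - Im (z $ k))) = ?\<beta> N * ((-1) ^ card (?Y - K) * ?\<alpha> (?Y - K))"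
      by (simp add: power_add)
    moreover have "K \<subseteq> H" using K by auto
    ultimately show "((-1) ^ card (H - K) * (?\<alpha> (H - K - N) * (\<Prod>k\<in>N. - Im (z $ k)))) *\<^sub>R component_stem H K F z $ L
       = (?\<beta> N * inverse (?\<beta> H)) *\<^sub>R ((-1) ^ card (?Y - K) * ?\<alpha> (?Y - K)) *\<^sub>R
          (\<Sum>M\<in>Pow K. ?\<alpha> (K - M) *\<^sub>R ?\<beta> M *\<^sub>R F z $ (L \<union> (H - M)))"
      by (simp add: component_stem_nth [OF L] mult_ac)
  qed
  also have "\<dots> = (?\<beta> N * inverse (?\<beta> H)) *\<^sub>R ?\<beta> ?Y *\<^sub>R F z $ (L \<union> (H - ?Y))"
    unfolding scaleR_sum_right [symmetric] by (subst moebius_inversion) simp_all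
  also have "\<dots> = F z $ (N \<union> L)"
  proof -
    have "L \<union> (H - ?Y) = N \<union> L" using N by auto
    moreover have "?\<beta> N * inverse (?\<beta> H) * ?\<beta> ?Y = 1" unfolding H using \<beta> [of N] \<beta> [of ?Y] N by (simp add: field_simps)
    ultimately show ?thesis by simp
  qed
  finally show ?thesis by simp
qed

text \<open>A component has no part at \<open>e_L\<close> unless \<open>L\<close> is disjoint from \<open>H\<close>. In the product with a stem
function supported on subsets of \<open>H\<close>, the part at \<open>e_P\<close> therefore comes from the single pair
\<open>P \<inter> H\<close>, \<open>P - H\<close>, and the sum is the inversion formula for \<open>F\<close> at \<open>e_P\<close>.\<close>

lemma stem_decomposition:
  assumes z: "z \<in> nonreal_part D H"
  shows "(\<Sum>K\<in>Pow H. (-1) ^ card (H - K) *\<^sub>R stem_mult (power_stem (-1) (H - K)) (component_stem H K F) z) = F z"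
  unfolding vec_eq_iff
proof
  fix P
  let ?N = "P \<inter> H" and ?L = "P - H"
  let ?a = "\<lambda>K. (\<Prod>k\<in>H - K - ?N. Re (z $ k)) * (\<Prod>k\<in>?N. - Im (z $ k))"
  let ?C = "\<lambda>K. component_stem H K F z"
  let ?X = "\<lambda>K. stem_mult (power_stem (-1) (H - K)) (component_stem H K F) z"
  let ?S = "\<Sum>K\<in>Pow H. (-1) ^ card (H - K) *\<^sub>R ?X K"
  have P: "?N \<union> ?L = P" by auto
  have "?X K $ P =
     (if ?N \<subseteq> H - K then ?a K *\<^sub>R ?C K $ ?L else 0)"
    if "K \<in> Pow H" for K
  proof -
    let ?t = "\<lambda>M. ((-1) ^ card (M - P) * ((\<Prod>k\<in>H - K - M. Re (z $ k)) * (\<Prod>k\<in>M. - 1 * Im (z $ k)))) *\<^sub>R component_stem H K F z $ sym_diff M P"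
    have "?X K $ P = (\<Sum>M\<in>Pow (H - K). ?t M)"
      by (rule stem_mult_power_stem_nth)
    also have "\<dots> = (\<Sum>M\<in>Pow (H - K). if M = ?N then ?t M else 0)"
    proof (rule sum.cong [OF refl])
      fix M assume "M \<in> Pow (H - K)"
      then have "sym_diff M P \<inter> H \<noteq> {}" if "M \<noteq> ?N" using that by auto
      then show "?t M = (if M = ?N then ?t M else 0)" by (simp add: component_stem_nth_zero)
    qed
    also have "\<dots> = (if ?N \<in> Pow (H - K) then ?t ?N else 0)" by (simp add: sum.delta)
    also have "\<dots> = (if ?N \<subseteq> H - K then ?a K *\<^sub>R ?C K $ ?L else 0)"
    proof -
      have e: "?N - P = {}" "sym_diff ?N P = ?L" by auto
      show ?thesis unfolding e(2) unfolding e(1) by simp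
    qed
    finally show ?thesis .
  qed
  then have "?S $ P
    = (\<Sum>K\<in>Pow H. if ?N \<subseteq> H - K then ((-1) ^ card (H - K) * ?a K) *\<^sub>R ?C K $ ?L else 0)"
    by (auto intro!: sum.cong)
  also have "\<dots> = (\<Sum>K\<in>Pow (H - ?N). ((-1) ^ card (H - K) * ?a K) *\<^sub>R ?C K $ ?L)"
    by (rule sum.mono_neutral_cong_right) auto
  also have "\<dots> = F z $ (?N \<union> ?L)"
    by (rule stem_from_components [OF z, symmetric]) auto
  finally show "?S $ P = F z $ P"
    unfolding P .
qed

lemma slice_sum_add: "slice_sum J (v + w) = slice_sum J v + slice_sum J w"
  by (simp add: slice_sum_def distrib_left sum.distrib)

lemma slice_sum_scaleR: "slice_sum J (r *\<^sub>R w) = r *\<^sub>R slice_sum J w"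
  by (simp add: slice_sum_def scaleR_sum_right)

lemma slice_sum_sum: "slice_sum J (\<Sum>i\<in>A. w i) = (\<Sum>i\<in>A. slice_sum J (w i))"
proof (cases "finite A")
  case True
  then show ?thesis by (induction A rule: finite_induct) (simp_all add: slice_sum_add, simp add: slice_sum_def)
qed (simp add: slice_sum_def)

lemma spherical_decomposition:
  assumes D: "invariant D" and F: "stem D F" "induces D F f" and x: "x \<in> circularization (nonreal_part D H)"
  shows "f x = (\<Sum>K\<in>Pow H. (-1) ^ card (H - K) *
          slice_mult (nonreal_part D H)
            (conj_coord_prod (nonreal_part D H) (H - K)) (spherical_component D H K f) x)"
proof -
  let ?D = "nonreal_part D H"
  have inv: "invariant ?D" by (rule invariant_nonreal_part [OF D])
  obtain J z where z: "x = embed J z" "z \<in> ?D" "unit_dirs J"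
    using x by (rule circularizationE)
  have zD: "z \<in> D" using z by (simp add: nonreal_part_def)
  have "(-1) ^ card (H - K) * slice_mult ?D (conj_coord_prod ?D (H - K)) (spherical_component D H K f) x
    = slice_sum J ((-1) ^ card (H - K) *\<^sub>R stem_mult (power_stem (-1) (H - K)) (component_stem H K F) z)" for K
  proof -
    have "slice_mult ?D (conj_coord_prod ?D (H - K)) (spherical_component D H K f)
      = slice_fun ?D (stem_mult (power_stem (-1) (H - K)) (component_stem H K F))"
      unfolding spherical_component_eq [OF D F]
      by (intro slice_mult_eq stem_power_stem induces_conj_coord_prod inv stem_component_stem F induces_slice_fun)
    moreover have "stem ?D (stem_mult (power_stem (-1) (H - K)) (component_stem H K F))"
      by (intro stem_stem_mult stem_power_stem stem_component_stem F)
    ultimately show ?thesis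
      unfolding z(1) by (simp add: slice_fun_eq_slice_sum inv z(2,3) slice_sum_scaleR)
        (simp add: scaleR_conv_of_real)
  qed
  then have "(\<Sum>K\<in>Pow H. (-1) ^ card (H - K) * slice_mult ?D (conj_coord_prod ?D (H - K)) (spherical_component D H K f) x)
     = slice_sum J (F z)"
    by (simp add: slice_sum_sum [symmetric] stem_decomposition [OF z(2)])
  also have "\<dots> = f x"
    using F(2) zD z by (simp add: induces_def embed_in_circularization D slice_fun_eq_slice_sum [OF F(1)])
  finally show ?thesis by simp
qed

text \<open>Multiplication of stem functions by the stem function \<open>\<alpha>_m + e_m \<beta>_m\<close> of the coordinate \<open>x_m\<close>.\<close>

definition coord_mult :: "'n::finite \<Rightarrow> ('n cvec \<Rightarrow> 'n stem_val) \<Rightarrow> 'n cvec \<Rightarrow> 'n stem_val" where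
  "coord_mult m F z = (\<chi> N. Re (z $ m) *\<^sub>R F z $ N + ((if m \<in> N then 1 else -1) * Im (z $ m)) *\<^sub>R F z $ sym_diff N {m})"

lemma stem_mult_power_stem_insert:
  assumes "m \<notin> K"
  shows "stem_mult (power_stem 1 (insert m K)) F = coord_mult m (stem_mult (power_stem 1 K) F)"
proof (intro ext, unfold vec_eq_iff, intro allI)
  fix z :: "'a cvec" and N
  let ?t = "\<lambda>K N M. ((-1) ^ card (M - N) * ((\<Prod>k\<in>K - M. Re (z $ k)) * (\<Prod>k\<in>M. 1 * Im (z $ k)))) *\<^sub>R F z $ sym_diff M N"
  have "stem_mult (power_stem 1 (insert m K)) F z $ N = (\<Sum>M\<in>Pow K. ?t (insert m K) N M) + (\<Sum>M\<in>Pow K. ?t (insert m K) N (insert m M))"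
    unfolding stem_mult_power_stem_nth using assms by (intro sum_Pow_insert) auto
  also have "(\<Sum>M\<in>Pow K. ?t (insert m K) N M) = Re (z $ m) *\<^sub>R (\<Sum>M\<in>Pow K. ?t K N M)"
    unfolding scaleR_sum_right
  proof (rule sum.cong [OF refl])
    fix M assume "M \<in> Pow K"
    then have "insert m K - M = insert m (K - M)" "m \<notin> K - M" using assms by auto
    then show "?t (insert m K) N M = Re (z $ m) *\<^sub>R ?t K N M" by simp
  qed
  also have "(\<Sum>M\<in>Pow K. ?t (insert m K) N (insert m M)) = ((if m \<in> N then 1 else -1) * Im (z $ m)) *\<^sub>R (\<Sum>M\<in>Pow K. ?t K (sym_diff N {m}) M)"
    unfolding scaleR_sum_right
  proof (rule sum.cong [OF refl])
    fix M assume "M \<in> Pow K"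
    then have m: "m \<notin> M" and e: "insert m K - insert m M = K - M" "sym_diff (insert m M) N = sym_diff M (sym_diff N {m})" "M - sym_diff N {m} = M - N"
      using assms by auto
    have "(-1 :: real) ^ card (insert m M - N) = (if m \<in> N then 1 else -1) * (-1) ^ card (M - N)"
      using m by (simp add: insert_Diff_if)
    then show "?t (insert m K) N (insert m M) = ((if m \<in> N then 1 else -1) * Im (z $ m)) *\<^sub>R ?t K (sym_diff N {m}) M"
      unfolding e using m by simp
  qed
  finally show "stem_mult (power_stem 1 (insert m K)) F z $ N = coord_mult m (stem_mult (power_stem 1 K) F) z $ N"
    by (simp add: coord_mult_def stem_mult_power_stem_nth)
qed

text \<open>On the pairs belonging to \<open>h = m\<close>, multiplication by the coordinate is multiplication by the complex
number \<open>z_h\<close>; for \<open>h \<noteq> m\<close> it is a linear combination whose coefficients do not depend on \<open>z_h\<close>.\<close>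

lemma holo_var_coord_mult:
  assumes "holo_var D h F"
  shows "holo_var D h (coord_mult m F)"
  unfolding holo_var_def
proof (intro ballI allI impI)
  fix z L c assume z: "z \<in> D" and L: "h \<notin> L"
  have hol: "(\<lambda>u. cpair c h M (F (z + axis h u))) field_differentiable at 0" if "h \<notin> M" for M
    using assms z that unfolding holo_var_def holo_along_def by blast
  show "holo_along h (\<lambda>z. cpair c h L (coord_mult m F z)) z"
  proof (cases "m = h")
    case True
    have "sym_diff (insert h L) {h} = L" "sym_diff L {h} = insert h L" using L by auto
    then have "cpair c h L (coord_mult m F (z + axis h u)) = (z $ h + u) * cpair c h L (F (z + axis h u))" for u
      using True L by (simp add: cpair_def coord_mult_def axis_def complex_eq_iff inner_add_right algebra_simps)
    moreover have "(\<lambda>u. (z $ h + u) * cpair c h L (F (z + axis h u))) field_differentiable at 0"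
      by (intro derivative_intros hol L)
    ultimately show ?thesis by (simp add: holo_along_def)
  next
    case False
    then have "sym_diff (insert h L) {m} = insert h (sym_diff L {m})" and h: "h \<notin> sym_diff L {m}" using L by auto
    then have "cpair c h L (coord_mult m F (z + axis h u)) = of_real (Re (z $ m)) * cpair c h L (F (z + axis h u))
        + of_real ((if m \<in> L then 1 else -1) * Im (z $ m)) * cpair c h (sym_diff L {m}) (F (z + axis h u))" for u
      using False L by (simp add: cpair_def coord_mult_def axis_def complex_eq_iff inner_add_right algebra_simps)
    moreover have "(\<lambda>u. of_real (Re (z $ m)) * cpair c h L (F (z + axis h u))
        + of_real ((if m \<in> L then 1 else -1) * Im (z $ m)) * cpair c h (sym_diff L {m}) (F (z + axis h u))) field_differentiable at 0"
      by (intro derivative_intros hol L h)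
    ultimately show ?thesis by (simp add: holo_along_def)
  qed
qed

lemma stem_mult_power_stem_empty: "stem_mult (power_stem s {}) F = F"
  by (intro ext) (simp add: vec_eq_iff stem_mult_power_stem_nth)

lemma holo_var_stem_mult_power_stem:
  assumes "holo_var D h F"
  shows "holo_var D h (stem_mult (power_stem 1 K) F)"
proof -
  have "finite K" by simp
  then show ?thesis
  proof (induction K rule: finite_induct)
    case empty
    then show ?case using assms by (simp add: stem_mult_power_stem_empty)
  next
    case (insert m K)
    then show ?case by (simp add: stem_mult_power_stem_insert holo_var_coord_mult)
  qed
qed

text \<open>For \<open>h \<in> H\<close> the extension is also a spherical quotient in \<open>z_h\<close>: both this quotient, formed after all the
others, and the extension are continuous, and they agree where all variables of \<open>H\<close> are nonreal.\<close>

lemma component_stem_extends: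
  fixes D :: "'n::finite cvec set"
  assumes D: "open D" "invariant D" and F: "stem D F" and hol: "\<And>h. holo_var D h F"
  obtains G where "stem D G" "\<And>z. z \<in> nonreal_part D H \<Longrightarrow> G z = component_stem H K F z"
    "\<And>h. h \<notin> H \<Longrightarrow> holo_var D h G"
    "\<And>h. h \<in> H \<Longrightarrow> \<exists>G0. stem D G0 \<and> holo_var D h G0 \<and> (\<forall>z\<in>D. G z = spherical_quotient h G0 z)"
proof -
  let ?X = "stem_mult (power_stem 1 K) F"
  have X: "stem D ?X" by (intro stem_stem_mult stem_power_stem F)
  have hX: "holo_var D h ?X" for h by (rule holo_var_stem_mult_power_stem [OF hol])
  obtain G where G: "stem D G" "\<And>z. z \<in> nonreal_part D H \<Longrightarrow> G z = spherical_stem H ?X z" "\<And>h. h \<in> UNIV - H \<Longrightarrow> holo_var D h G"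
    by (rule spherical_stem_extends [OF D X hX subset_UNIV [of H]]) (rule that)
  have "\<exists>G0. stem D G0 \<and> holo_var D h G0 \<and> (\<forall>z\<in>D. G z = spherical_quotient h G0 z)" if h: "h \<in> H" for h
  proof -
    obtain G0 where G0: "stem D G0" "\<And>z. z \<in> nonreal_part D (H - {h}) \<Longrightarrow> G0 z = spherical_stem (H - {h}) ?X z"
      "\<And>k. k \<in> UNIV - (H - {h}) \<Longrightarrow> holo_var D k G0"
      by (rule spherical_stem_extends [OF D X hX subset_UNIV [of "H - {h}"]]) (rule that)
    have h0: "holo_var D h G0" by (rule G0(3)) simp
    have "G z = spherical_quotient h G0 z" if z: "z \<in> D" for z
    proof (rule nonreal_part_eq [OF D(1) _ _ _ z, where H = H])
      show "continuous_on D G" using G(1) by (simp add: stem_def)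
      show "continuous_on D (spherical_quotient h G0)" by (rule continuous_on_spherical_quotient [OF D(1) G0(1) h0])
      fix z assume z: "z \<in> nonreal_part D H"
      then have "z \<in> nonreal_part D (H - {h})" and im: "Im (z $ h) \<noteq> 0" using h by (auto simp: nonreal_part_def)
      have H: "H = insert h (H - {h})" using h by auto
      have e1: "insert h L \<inter> (H - {h}) = L \<inter> H" "insert h L \<union> (H - {h}) = L \<union> H" "insert h (L \<union> (H - {h})) = L \<union> H" if "h \<notin> L" for L
        using h that by auto
      have e2: "L \<inter> H \<noteq> {}" if "h \<in> L" for L using h that by auto
      have p: "(\<Prod>k\<in>H. Im (z $ k)) = Im (z $ h) * (\<Prod>k\<in>H - {h}. Im (z $ k))"
        using h by (simp add: prod.remove)
      show "G z = spherical_quotient h G0 z"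
        unfolding G(2) [OF z] vec_eq_iff spherical_quotient_nonreal [OF im] G0(2) [OF \<open>z \<in> nonreal_part D (H - {h})\<close>]
        by (auto simp: spherical_stem_def e1 e2 p)
    qed
    with G0(1) h0 show ?thesis by blast
  qed
  with G show thesis by (intro that [of G]) (auto simp: component_stem_def)
qed

section \<open>Restriction to one quaternion variable\<close>

definition vary :: "'n::finite \<Rightarrow> 'n cvec \<Rightarrow> complex \<Rightarrow> 'n cvec" where
  "vary h z w = z + axis h (w - z $ h)"

lemma vary_nth: "vary h z w $ k = (if k = h then w else z $ k)"
  by (simp add: vary_def axis_def)

lemma vary_self [simp]: "vary h z (z $ h) = z"
  by (simp add: vary_def)

lemma vary_add: "vary h z (w + u) = vary h z w + axis h u"
  by (simp add: vary_def axis_plus [symmetric] algebra_simps)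

lemma conj_at_vary: "conj_at h (vary h z w) = vary h z (cnj w)"
  by (simp add: vec_eq_iff conj_at_nth vary_nth)

lemma continuous_on_vary [continuous_intros]:
  "continuous_on A g \<Longrightarrow> continuous_on A (\<lambda>x. vary h z (g x))"
  unfolding vary_def by (intro continuous_intros)

definition with_dir :: "'n::finite \<Rightarrow> quat \<Rightarrow> 'n qvec \<Rightarrow> 'n qvec" where
  "with_dir h I J = (\<chi> k. if k = h then I else J $ k)"

lemma with_dir_imag_units:
  "unit_dirs J \<Longrightarrow> I \<in> imag_units \<Longrightarrow> unit_dirs (with_dir h I J)"
  by (simp add: with_dir_def)

lemma replace_at_embed:
  "replace_at (embed J z) h (of_real (Re w) + I * of_real (Im w)) = embed (with_dir h I J) (vary h z w)"
  by (simp add: replace_at_def embed_def with_dir_def vary_nth vec_eq_iff)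

lemma replace_at_slice_point:
  "replace_at (embed J z) h y = embed (with_dir h (direction y) J) (vary h z (slice_point y))"
  using replace_at_embed [of J z h "slice_point y" "direction y"] by (simp add: slice_point_direction)

lemma ordered_prod_with_dir: "h \<notin> L \<Longrightarrow> ordered_prod (($) (with_dir h I J)) L = ordered_prod (($) J) L"
  by (rule ordered_prod_cong) (auto simp: with_dir_def)

lemma in_section_dom:
  assumes "invariant D" "unit_dirs J"
  shows "y \<in> section_dom D h (embed J z) \<longleftrightarrow> vary h z (slice_point y) \<in> D"
  by (simp add: section_dom_def replace_at_slice_point embed_in_circularization assms with_dir_imag_units direction_imag_unit)

text \<open>On a sphere only the unit \<open>J_h\<close> varies, and it occurs in none of the nonzero summands.\<close>

lemma circular_of_no_component:
  fixes D :: "'n::{finite,linorder} cvec set"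
  assumes D: "invariant D" and G: "stem D G" and zero: "\<And>z L. z \<in> D \<Longrightarrow> h \<in> L \<Longrightarrow> G z $ L = 0"
  shows "slice_fun D G \<in> circular_functions_wrt D h"
  unfolding circular_functions_wrt_def mem_Collect_eq
proof (intro conjI ballI allI impI)
  show "slice_fun D G \<in> slice_functions D" using G induces_slice_fun by (auto simp: slice_functions_def)
  fix y \<alpha> \<beta> assume "y \<in> circularization D" and sub: "quat_sphere \<alpha> \<beta> \<subseteq> section_dom D h y"
  then obtain J z where z: "y = embed J z" "z \<in> D" "unit_dirs J" by (blast elim: circularizationE)
  let ?w = "Complex \<alpha> \<beta>"
  have "slice_fun D G (replace_at y h (of_real \<alpha> + I * of_real \<beta>)) = slice_sum J (G (vary h z ?w))" if I: "I \<in> imag_units" for I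
  proof -
    have r: "replace_at y h (of_real \<alpha> + I * of_real \<beta>) = embed (with_dir h I J) (vary h z ?w)"
      using replace_at_embed [of J z h ?w I] by (simp add: z(1))
    have u: "unit_dirs (with_dir h I J)" using z(3) I by (rule with_dir_imag_units)
    have "of_real \<alpha> + I * of_real \<beta> \<in> section_dom D h y"
      using sub I by (auto simp: quat_sphere_def)
    then have w: "vary h z ?w \<in> D"
      by (simp add: section_dom_def r embed_in_circularization [OF D u])
    have "slice_sum (with_dir h I J) (G (vary h z ?w)) = slice_sum J (G (vary h z ?w))"
      unfolding slice_sum_def
    proof (rule sum.cong [OF refl])
      fix L
      show "ordered_prod (($) (with_dir h I J)) L * G (vary h z ?w) $ L = ordered_prod (($) J) L * G (vary h z ?w) $ L"
        using zero [OF w, of L] by (cases "h \<in> L") (simp_all add: ordered_prod_with_dir)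
    qed
    then show ?thesis unfolding r by (simp add: slice_fun_eq_slice_sum [OF G D w u])
  qed
  then show "(\<lambda>x. slice_fun D G (replace_at y h x)) constant_on quat_sphere \<alpha> \<beta>"
    by (auto simp: constant_on_def quat_sphere_def)
qed

definition plane_section :: "'n::finite cvec set \<Rightarrow> 'n \<Rightarrow> 'n cvec \<Rightarrow> (1 cvec) set" where
  "plane_section D h z = {w. vary h z (w $ 1) \<in> D}"

text \<open>The stem function, in the single variable \<open>x_h\<close>, of a slice function whose ordered products begin with
\<open>J_h\<close> whenever they contain it: the factors \<open>J_L\<close> of the other variables are absorbed as constants.\<close>

definition section_stem ::
    "('n::{finite,linorder} cvec \<Rightarrow> 'n stem_val) \<Rightarrow> 'n \<Rightarrow> 'n qvec \<Rightarrow> 'n cvec \<Rightarrow> 1 cvec \<Rightarrow> 1 stem_val" where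
  "section_stem G h J z w = (\<chi> P. \<Sum>L\<in>Pow (- {h}).
     ordered_prod (($) J) L * G (vary h z (w $ 1)) $ (if 1 \<in> P then insert h L else L))"

lemma invariant_plane_section: "invariant D \<Longrightarrow> invariant (plane_section D h z)"
proof -
  assume D: "invariant D"
  have "conj_at k w $ 1 = cnj (w $ 1)" for k :: 1 and w :: "1 cvec"
    by (simp add: conj_at_nth)
  moreover have "vary h z u \<in> D \<longleftrightarrow> vary h z (cnj u) \<in> D" for u
    using D unfolding conj_at_vary [symmetric] invariant_def by blast
  ultimately show ?thesis unfolding invariant_def plane_section_def by simp
qed

lemma open_plane_section: "open D \<Longrightarrow> open (plane_section D h z)"
proof -
  assume D: "open D"
  have "continuous_on UNIV (\<lambda>w :: 1 cvec. vary h z (w $ 1))" by (intro continuous_intros)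
  from open_vimage [OF D this] show ?thesis by (simp add: plane_section_def vimage_def)
qed

lemma circularization_plane_section:
  assumes D: "invariant D" and J: "unit_dirs J"
  shows "circularization (plane_section D h z) = {v. v $ 1 \<in> section_dom D h (embed J z)}"
  unfolding set_eq_iff
proof
  fix v :: "1 qvec"
  have "(\<chi> k. slice_point (v $ k)) $ 1 = slice_point (v $ 1)" by simp
  then show "v \<in> circularization (plane_section D h z) \<longleftrightarrow> v \<in> {v. v $ 1 \<in> section_dom D h (embed J z)}"
    unfolding circularization_iff_slice_point [OF invariant_plane_section [OF D]]
    by (simp add: in_section_dom [OF D J] plane_section_def)
qed

text \<open>The plane set over which a one-variable domain is circular is unique; this identifies the domain of any
representation of a section as a slice regular function.\<close>

lemma circularization_inj:
  assumes "invariant D" "invariant E" "circularization D = circularization E"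
  shows "D = E"
proof -
  have "z \<in> D \<longleftrightarrow> z \<in> E" for z
    using embed_in_circularization [OF assms(1), of "\<chi> k. Quat 0 1 0 0" z]
      embed_in_circularization [OF assms(2), of "\<chi> k. Quat 0 1 0 0" z] assms(3)
    by (simp add: quat_i_imag_unit)
  then show ?thesis by blast
qed

lemma stem_section_stem:
  fixes D :: "'n::{finite,linorder} cvec set"
  assumes G: "stem D G"
  shows "stem (plane_section D h z) (section_stem G h J z)"
proof (rule stemI)
  have "continuous_on D G" using G by (simp add: stem_def)
  then have "continuous_on (plane_section D h z) (\<lambda>w. G (vary h z (w $ 1)))"
    by (rule continuous_on_compose2) (auto simp: plane_section_def intro!: continuous_intros)
  then show "continuous_on (plane_section D h z) (section_stem G h J z)"
    unfolding section_stem_def by (intro continuous_on_vec_lambda continuous_intros)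
  fix w :: "1 cvec" and k :: 1 and P assume w: "w \<in> plane_section D h z"
  have k: "k = 1" by simp
  have "vary h z (conj_at 1 w $ 1) = conj_at h (vary h z (w $ 1))"
    by (simp add: conj_at_vary conj_at_nth)
  then have c: "G (vary h z (conj_at 1 w $ 1)) $ M = (if h \<in> M then - G (vary h z (w $ 1)) $ M else G (vary h z (w $ 1)) $ M)" for M
    using w by (simp add: stem_conj [OF G] plane_section_def)
  have "h \<notin> L" if "L \<in> Pow (- {h})" for L using that by auto
  then show "section_stem G h J z (conj_at k w) $ P = (if k \<in> P then - section_stem G h J z w $ P else section_stem G h J z w $ P)"
    unfolding k section_stem_def vec_lambda_beta c by (auto simp: sum_negf [symmetric] intro!: sum.cong)
qed

text \<open>In every summand \<open>J_L G_L\<close> with \<open>h \<in> L\<close> and nonzero \<open>G_L\<close>, the unit \<open>J_h\<close> stands in front. Without this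
the restriction to \<open>x_h\<close> need not be a slice function, because coefficients of slice functions stand on
the right of the imaginary units.\<close>

definition left_supported :: "'n::{finite,linorder} cvec set \<Rightarrow> 'n \<Rightarrow> ('n cvec \<Rightarrow> 'n stem_val) \<Rightarrow> bool" where
  "left_supported D h G \<longleftrightarrow> (\<forall>z\<in>D. \<forall>L. (\<exists>k\<in>L. k < h) \<longrightarrow> G z $ L = 0)"

lemma UNIV_set_1: "(UNIV :: 1 set set) = {{}, {1}}"
proof -
  have "P = {} \<or> P = {1}" for P :: "1 set"
    by (metis (full_types) empty_iff insertI1 singletonD subsetI subset_antisym subset_singletonD num1_eq1 equals0I)
  then show ?thesis by auto
qed

lemma induces_section_stem:
  fixes D :: "'n::{finite,linorder} cvec set"
  assumes D: "invariant D" and G: "stem D G" and supp: "left_supported D h G"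
    and J: "unit_dirs J" and g: "induces D G g"
  shows "induces (plane_section D h z) (section_stem G h J z) (\<lambda>v. g (replace_at (embed J z) h (v $ 1)))"
  unfolding induces_def
proof
  fix v assume "v \<in> circularization (plane_section D h z)"
  then obtain I w where w: "v = embed I w" "w \<in> plane_section D h z" "unit_dirs I" by (rule circularizationE)
  let ?J = "with_dir h (I $ 1) J" and ?z = "vary h z (w $ 1)"
  have v: "v $ 1 = of_real (Re (w $ 1)) + I $ 1 * of_real (Im (w $ 1))" by (simp add: w(1) embed_def)
  have r: "replace_at (embed J z) h (v $ 1) = embed ?J ?z" unfolding v by (rule replace_at_embed)
  have z: "?z \<in> D" using w(2) by (simp add: plane_section_def)
  have u: "unit_dirs ?J" using J w(3) by (simp add: with_dir_imag_units)
  have "g (embed ?J ?z) = slice_sum ?J (G ?z)"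
    using g z by (simp add: induces_def embed_in_circularization [OF D u] slice_fun_eq_slice_sum [OF G D z u])
  also have "\<dots> = (\<Sum>L\<in>Pow (insert h (- {h})). ordered_prod (($) ?J) L * G ?z $ L)"
    unfolding slice_sum_def by (rule sum.cong) auto
  also have "\<dots> = (\<Sum>L\<in>Pow (- {h}). ordered_prod (($) ?J) L * G ?z $ L)
      + (\<Sum>L\<in>Pow (- {h}). ordered_prod (($) ?J) (insert h L) * G ?z $ insert h L)"
    by (rule sum_Pow_insert) auto
  also have "(\<Sum>L\<in>Pow (- {h}). ordered_prod (($) ?J) L * G ?z $ L) = section_stem G h J z w $ {}"
    unfolding section_stem_def by (auto intro!: sum.cong simp: ordered_prod_with_dir)
  also have "(\<Sum>L\<in>Pow (- {h}). ordered_prod (($) ?J) (insert h L) * G ?z $ insert h L) = I $ 1 * section_stem G h J z w $ {1}"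
    unfolding section_stem_def vec_lambda_beta sum_distrib_left
  proof (rule sum.cong [OF refl])
    fix L assume "L \<in> Pow (- {h})"
    then have L: "h \<notin> L" by auto
    show "ordered_prod (($) ?J) (insert h L) * G ?z $ insert h L =
        I $ 1 * (ordered_prod (($) J) L * G ?z $ (if 1 \<in> {1 :: 1} then insert h L else L))"
    proof (cases "\<exists>k\<in>L. k < h")
      case True
      then have "G ?z $ insert h L = 0" using supp z by (auto simp: left_supported_def)
      then show ?thesis by simp
    next
      case False
      then have "\<forall>k\<in>L. h < k" using L by (metis linorder_neqE)
      then have "ordered_prod (($) ?J) (insert h L) = ?J $ h * ordered_prod (($) ?J) L"
        by (rule ordered_prod_insert_min)
      then show ?thesis using L by (simp add: ordered_prod_with_dir mult.assoc) (simp add: with_dir_def)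
    qed
  qed
  also have "section_stem G h J z w $ {} + I $ 1 * section_stem G h J z w $ {1} = slice_sum I (section_stem G h J z w)"
    unfolding slice_sum_def UNIV_set_1 by (simp add: ordered_prod_def)
  also have "\<dots> = slice_fun (plane_section D h z) (section_stem G h J z) v"
    unfolding w(1) by (rule slice_fun_eq_slice_sum [symmetric, OF stem_section_stem [OF G] invariant_plane_section [OF D] w(2,3)])
  finally show "g (replace_at (embed J z) h (v $ 1)) = slice_fun (plane_section D h z) (section_stem G h J z) v"
    unfolding r .
qed

lemma slice_wrt_of_left_supported:
  assumes D: "invariant D" and G: "stem D G" "left_supported D h G" and g: "induces D G g"
  shows "g \<in> slice_functions_wrt D h"
  unfolding slice_functions_wrt_def mem_Collect_eq
proof (intro conjI ballI)
  show "g \<in> slice_functions D" using G g by (auto simp: slice_functions_def)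
  fix y assume "y \<in> circularization D"
  then obtain J z where z: "y = embed J z" "z \<in> D" "unit_dirs J" by (rule circularizationE)
  have "(\<lambda>v. g (replace_at y h (v $ 1))) \<in> slice_functions (plane_section D h z)"
    unfolding z(1) slice_functions_def using stem_section_stem [OF G(1)] induces_section_stem [OF D G z(3) g] by blast
  then show "(\<lambda>x. g (replace_at y h x)) \<in> slice_functions_1 (section_dom D h y)"
    unfolding slice_functions_1_def using invariant_plane_section [OF D, of h z] circularization_plane_section [OF D z(3), of h z]
    by (auto simp: z(1))
qed

text \<open>Quaternionic conjugation; it gives the adjoint of left multiplication.\<close>

definition qconj :: "quat \<Rightarrow> quat" where
  "qconj p = Quat (qRe p) (- qI p) (- qJ p) (- qK p)"

lemma inner_mult_qconj: "c \<bullet> (p * q) = (qconj p * c) \<bullet> q"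
  by (simp add: qconj_def inner_quat_def algebra_simps)

lemma cpair_section_stem:
  "cpair c 1 {} (section_stem G h J z w) = (\<Sum>L\<in>Pow (- {h}). cpair (qconj (ordered_prod (($) J) L) * c) h L (G (vary h z (w $ 1))))"
  by (simp add: cpair_def section_stem_def inner_sum_right inner_mult_qconj complex_eq_iff)

lemma vary_axis_1: "vary h z ((w + axis 1 u) $ (1 :: 1)) = vary h z (w $ 1) + axis h u"
  by (simp add: vary_add)

lemma holo_var_section_stem:
  assumes "holo_var D h G"
  shows "holo_var (plane_section D h z) 1 (section_stem G h J z)"
  unfolding holo_var_def
proof (intro ballI allI impI)
  fix w P c assume w: "w \<in> plane_section D h z" and P: "(1 :: 1) \<notin> P"
  then have P: "P = {}" using UNIV_set_1 by blast
  have "(\<lambda>u. \<Sum>L\<in>Pow (- {h}). cpair (qconj (ordered_prod (($) J) L) * c) h L (G (vary h z (w $ 1) + axis h u))) field_differentiable at 0"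
    using assms w by (intro field_differentiable_sum) (auto simp: holo_var_def holo_along_def plane_section_def)
  then show "holo_along 1 (\<lambda>w. cpair c 1 P (section_stem G h J z w)) w"
    unfolding holo_along_def P cpair_section_stem vary_axis_1 .
qed

text \<open>Varying the signs of the fixed units recovers each component from the sections.\<close>

lemma section_stem_inversion:
  fixes J :: "'n::{finite,linorder} qvec"
  assumes J: "unit_dirs J" and L: "h \<notin> L"
  shows "G (vary h z (w $ 1)) $ (if 1 \<in> P then insert h L else L) =
    inverse (of_nat (card (UNIV :: 'n set set)) * ordered_prod (($) J) L) *
      (\<Sum>A\<in>UNIV. (-1) ^ card (A \<inter> L) *\<^sub>R section_stem G h (flip A J) z w $ P)"
proof -
  let ?q = "(\<chi> M. if h \<in> M then 0 else G (vary h z (w $ 1)) $ (if 1 \<in> P then insert h M else M)) :: 'n stem_val"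
  have "slice_sum (flip A J) ?q = section_stem G h (flip A J) z w $ P" for A
  proof -
    have "slice_sum (flip A J) ?q = (\<Sum>M\<in>Pow (- {h}). ordered_prod (($) (flip A J)) M * ?q $ M)"
      unfolding slice_sum_def by (rule sum.mono_neutral_right) auto
    also have "\<dots> = section_stem G h (flip A J) z w $ P"
      unfolding section_stem_def by (auto intro!: sum.cong)
    finally show ?thesis .
  qed
  then show ?thesis using slice_sum_inversion [OF J, of ?q L] L by simp
qed

lemma holo_var_from_section_stems:
  fixes D :: "'n::{finite,linorder} cvec set"
  assumes sec: "\<And>J z. unit_dirs J \<Longrightarrow> z \<in> D \<Longrightarrow> holo_var (plane_section D h z) 1 (section_stem G h J z)"
  shows "holo_var D h G"
  unfolding holo_var_def
proof (intro ballI allI impI)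
  fix z L c assume z: "z \<in> D" and L: "h \<notin> L"
  \<comment> \<open>One choice of the units suffices, as the hypothesis covers all its sign changes.\<close>
  define J :: "'n qvec" where "J = (\<chi> k. Quat 0 1 0 0)"
  have J: "unit_dirs J" by (simp add: J_def quat_i_imag_unit)
  define w :: "1 cvec" where "w = (\<chi> k. z $ h)"
  have w: "w \<in> plane_section D h z" using z by (simp add: plane_section_def w_def)
  define p where "p = inverse (of_nat (card (UNIV :: 'n set set)) * ordered_prod (($) J) L)"
  let ?S = "\<lambda>A u. section_stem G h (flip A J) z (w + axis 1 u)"
  have inv: "G (z + axis h u) $ (if 1 \<in> P then insert h L else L) = p * (\<Sum>A\<in>UNIV. (-1) ^ card (A \<inter> L) *\<^sub>R ?S A u $ P)" for u and P :: "1 set"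
  proof -
    have "vary h z ((w + axis 1 u) $ 1) = z + axis h u"
      unfolding vary_axis_1 by (simp add: w_def)
    then show ?thesis using section_stem_inversion [OF J L, of G z "w + axis 1 u" P] by (simp add: p_def)
  qed
  have e: "cpair c h L (G (z + axis h u)) = (\<Sum>A\<in>UNIV. (-1) ^ card (A \<inter> L) * cpair (qconj p * c) 1 {} (?S A u))" for u
  proof -
    have re: "(- 1 :: complex) ^ n = of_real ((-1) ^ n)" for n by simp
    have i: "c \<bullet> (p * (\<Sum>A\<in>UNIV. (-1) ^ card (A \<inter> L) *\<^sub>R ?S A u $ P)) = (\<Sum>A\<in>UNIV. (-1) ^ card (A \<inter> L) * ((qconj p * c) \<bullet> ?S A u $ P))" for P :: "1 set"
      unfolding inner_mult_qconj inner_sum_right by simp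
    show ?thesis
      unfolding re using inv [of u "{}"] inv [of u "{1}"]
      by (simp add: cpair_def complex_eq_iff i)
  qed
  have "(\<lambda>u. \<Sum>A\<in>UNIV. (-1) ^ card (A \<inter> L) * cpair (qconj p * c) 1 {} (?S A u)) field_differentiable at 0"
  proof (intro field_differentiable_sum field_differentiable_mult field_differentiable_const)
    fix A
    have "holo_along 1 (\<lambda>w. cpair (qconj p * c) 1 {} (section_stem G h (flip A J) z w)) w"
      using sec [OF flip_imag_units [OF J] z] w unfolding holo_var_def by blast
    then show "(\<lambda>u. cpair (qconj p * c) 1 {} (?S A u)) field_differentiable at 0"
      by (simp add: holo_along_def)
  qed
  then show "holo_along h (\<lambda>z. cpair c h L (G z)) z"
    unfolding holo_along_def e .
qed

text \<open>Regularity of all sections amounts to holomorphy of all section stem functions, by uniqueness of stem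
functions and because in one variable the two notions of holomorphy coincide. The
section stem functions are constant linear combinations of the components of \<open>G\<close>, and conversely.\<close>

lemma slice_regular_wrt_iff:
  fixes D :: "'n::{finite,linorder} cvec set"
  assumes D: "open D" "invariant D" and G: "stem D G" "left_supported D h G" and g: "induces D G g"
  shows "g \<in> slice_regular_functions_wrt D h \<longleftrightarrow> holo_var D h G"
proof
  assume hol: "holo_var D h G"
  show "g \<in> slice_regular_functions_wrt D h"
    unfolding slice_regular_functions_wrt_def mem_Collect_eq
  proof (intro conjI ballI)
    show "g \<in> slice_functions D" using G g by (auto simp: slice_functions_def)
    fix y assume "y \<in> circularization D"
    then obtain J z where z: "y = embed J z" "z \<in> D" "unit_dirs J" by (rule circularizationE)
    have one: "holo_var (plane_section D h z) k (section_stem G h J z)" for k :: 1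
    proof -
      have k: "k = 1" by (rule num1_eqI)
      show ?thesis unfolding k by (rule holo_var_section_stem [OF hol])
    qed
    have "holomorphic_stem (plane_section D h z) (section_stem G h J z)"
      by (rule holo_var_imp_holomorphic_stem [OF open_plane_section [OF D(1)] stem_section_stem [OF G(1)] one])
    then have "(\<lambda>v. g (replace_at y h (v $ 1))) \<in> slice_regular_functions (plane_section D h z)"
      unfolding z(1) slice_regular_functions_def using induces_section_stem [OF D(2) G z(3) g] by blast
    then show "(\<lambda>x. g (replace_at y h x)) \<in> slice_regular_functions_1 (section_dom D h y)"
      unfolding slice_regular_functions_1_def
      using invariant_plane_section [OF D(2), of h z] circularization_plane_section [OF D(2) z(3), of h z]
      by (auto simp: z(1))
  qed
next
  assume reg: "g \<in> slice_regular_functions_wrt D h"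
  show "holo_var D h G"
  proof (rule holo_var_from_section_stems)
    fix J :: "'n qvec" and z assume J: "unit_dirs J" and z: "z \<in> D"
    let ?E = "plane_section D h z" and ?g = "\<lambda>v :: 1 qvec. g (replace_at (embed J z) h (v $ 1))"
    have inv: "invariant ?E" by (rule invariant_plane_section [OF D(2)])
    have "embed J z \<in> circularization D" using J z by (auto simp: circularization_def)
    then obtain E where E: "invariant E" "circularization E = {v. v $ 1 \<in> section_dom D h (embed J z)}"
      "?g \<in> slice_regular_functions E"
      using reg unfolding slice_regular_functions_wrt_def slice_regular_functions_1_def by blast
    have EE: "E = ?E"
      by (rule circularization_inj [OF E(1) inv]) (simp add: E(2) circularization_plane_section [OF D(2) J])
    then obtain F1 where F1: "holomorphic_stem ?E F1" "induces ?E F1 ?g"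
      using E(3) by (auto simp: slice_regular_functions_def)
    have "section_stem G h J z w = F1 w" if "w \<in> ?E" for w
    proof (rule stem_unique [OF stem_section_stem [OF G(1)] _ inv _ that])
      show "stem ?E F1" using F1(1) by (simp add: holomorphic_stem_def)
      show "slice_fun ?E (section_stem G h J z) x = slice_fun ?E F1 x" if "x \<in> circularization ?E" for x
        using F1(2) induces_section_stem [OF D(2) G J g, of z] that by (simp add: induces_def)
    qed
    then show "holo_var ?E 1 (section_stem G h J z)"
      by (rule holo_var_cong [OF open_plane_section [OF D(1)]]) (use holomorphic_stem_imp_holo_var [OF F1(1)] in auto)
  qed
qed

section \<open>Continuity and harmonicity of slice functions\<close>

lemma continuous_direction:
  assumes "Im (slice_point y) \<noteq> 0"
  shows "isCont direction y"
proof -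
  have cs: "isCont slice_point y" for y
    using continuous_on_slice_point [of UNIV] by (simp add: continuous_on_eq_continuous_at)
  have cr: "isCont qRe y"
    using bounded_linear_quat_parts(1) by (rule linear_continuous_at)
  have "isCont (\<lambda>y. inverse (Im (slice_point y)) *\<^sub>R (y - of_real (qRe y))) y"
    using assms tendsto_Im [OF cs [unfolded isCont_def]] by (intro continuous_intros cr) (auto simp: isCont_def)
  moreover have "\<forall>\<^sub>F y in nhds y. direction y = inverse (Im (slice_point y)) *\<^sub>R (y - of_real (qRe y))"
  proof -
    have "\<forall>\<^sub>F y in at y. Im (slice_point y) \<noteq> 0"
      using tendsto_imp_eventually_ne [OF tendsto_Im [OF cs [unfolded isCont_def]] assms] .
    then have "\<forall>\<^sub>F y in nhds y. Im (slice_point y) \<noteq> 0" using assms by (simp add: eventually_nhds_conv_at)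
    then show ?thesis by eventually_elim (simp add: direction_def)
  qed
  ultimately show ?thesis by (simp add: isCont_cong)
qed

lemma norm_ordered_prod:
  assumes "\<forall>k. J k \<in> imag_units"
  shows "norm (ordered_prod J K) = 1"
proof -
  have "norm (prod_list (map J xs)) = 1" for xs
    using assms by (induction xs) (auto simp: norm_mult imag_unitsD(2))
  then show ?thesis by (simp add: ordered_prod_def)
qed

lemma tendsto_ordered_prod:
  assumes "\<And>k. k \<in> K \<Longrightarrow> ((\<lambda>x. q x k) \<longlongrightarrow> l k) F"
  shows "((\<lambda>x. ordered_prod (q x) K) \<longlongrightarrow> ordered_prod l K) F"
proof -
  have "((\<lambda>x. prod_list (map (q x) xs)) \<longlongrightarrow> prod_list (map l xs)) F" if "set xs \<subseteq> K" for xs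
    using that assms by (induction xs) (auto intro!: tendsto_intros)
  then show ?thesis by (simp add: ordered_prod_def)
qed

lemma slice_fun_canonical:
  assumes "stem D G" "invariant D" "x \<in> circularization D"
  shows "slice_fun D G x = (\<Sum>K\<in>UNIV. ordered_prod (\<lambda>k. direction (x $ k)) K * G (\<chi> h. slice_point (x $ h)) $ K)"
proof -
  have d: "($) (\<chi> h. direction (x $ h)) = (\<lambda>k. direction (x $ k))" by (rule ext) simp
  show ?thesis
    using slice_fun_eq_slice_sum [OF assms(1,2), of "\<chi> h. slice_point (x $ h)" "\<chi> h. direction (x $ h)"] assms(2,3)
    by (simp add: embed_slice_point direction_imag_unit circularization_iff_slice_point slice_sum_def d)
qed

text \<open>The imaginary unit of \<open>x_k\<close> is discontinuous at real \<open>x_k\<close>, but there the stem components \<open>G_K\<close> with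
\<open>k \<in> K\<close> vanish, and the ordered products of units have norm 1.\<close>

lemma continuous_on_slice_fun:
  fixes D :: "'n::{finite,linorder} cvec set"
  assumes G: "stem D G" and D: "invariant D"
  shows "continuous_on (circularization D) (slice_fun D G)"
proof -
  let ?z = "\<lambda>x :: 'n qvec. \<chi> h. slice_point (x $ h)"
  have cont: "continuous_on D G" using G by (simp add: stem_def)
  have "continuous_on (circularization D) ?z"
    by (intro continuous_on_vec_lambda continuous_on_compose2 [OF continuous_on_slice_point [of UNIV]] continuous_intros) auto
  then have cG: "continuous_on (circularization D) (\<lambda>x. G (?z x))"
    by (rule continuous_on_compose2 [OF cont]) (auto simp: circularization_iff_slice_point [OF D])
  have "continuous_on (circularization D) (\<lambda>x. ordered_prod (\<lambda>k. direction (x $ k)) K * G (?z x) $ K)" for K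
    unfolding continuous_on_def
  proof
    fix x0 :: "'n qvec" assume x0: "x0 \<in> circularization D"
    let ?F = "at x0 within circularization D"
    have GK: "((\<lambda>x. G (?z x) $ K) \<longlongrightarrow> G (?z x0) $ K) ?F"
      using cG x0 unfolding continuous_on_def by (intro tendsto_vec_nth) auto
    show "((\<lambda>x. ordered_prod (\<lambda>k. direction (x $ k)) K * G (?z x) $ K) \<longlongrightarrow>
        ordered_prod (\<lambda>k. direction (x0 $ k)) K * G (?z x0) $ K) ?F"
    proof (cases "\<exists>k\<in>K. Im (slice_point (x0 $ k)) = 0")
      case True
      then obtain k where k: "k \<in> K" "Im (slice_point (x0 $ k)) = 0" by blast
      have 0: "G (?z x0) $ K = 0"
        by (rule stem_eq_0 [OF G _ k(1)]) (use k(2) x0 in \<open>auto simp: circularization_iff_slice_point [OF D]\<close>)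
      have "((\<lambda>x. ordered_prod (\<lambda>k. direction (x $ k)) K * G (?z x) $ K) \<longlongrightarrow> 0) ?F"
        by (rule tendsto_norm_zero_cancel)
           (use tendsto_norm [OF GK] in \<open>simp add: norm_mult norm_ordered_prod direction_imag_unit 0\<close>)
      then show ?thesis by (simp add: 0)
    next
      case False
      have "((\<lambda>x. direction (x $ k)) \<longlongrightarrow> direction (x0 $ k)) ?F" if "k \<in> K" for k
        using False that by (intro isCont_tendsto_compose [OF continuous_direction] tendsto_intros) auto
      then show ?thesis by (intro tendsto_mult tendsto_ordered_prod GK)
    qed
  qed
  then have "continuous_on (circularization D) (\<lambda>x. \<Sum>K\<in>UNIV. ordered_prod (\<lambda>k. direction (x $ k)) K * G (?z x) $ K)"
    by (intro continuous_on_sum)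
  then show ?thesis
    by (rule continuous_on_eq) (simp add: slice_fun_canonical [OF G D])
qed

lemma has_laplacian_of_harmonic:
  assumes "harmonic_at (\<lambda>y. g (replace_at x h y)) (x $ h)"
  shows "has_laplacian_wrt h g 0 x"
proof -
  have "replace_at x h (x $ h + t *\<^sub>R b) = x + t *\<^sub>R axis h b" for t b
    by (simp add: vec_eq_iff replace_at_def axis_def)
  with assms show ?thesis unfolding has_laplacian_wrt_def harmonic_at_def by (elim exE conjE) (intro exI conjI, auto)
qed

text \<open>With the other variables fixed, the function of \<open>x_h\<close> is a linear combination, with constant
quaternion coefficients, of plane quotients \<open>Im \<phi>(w) / Im w\<close> at the slice point \<open>w\<close> of \<open>x_h\<close>. The symmetry
of \<open>\<phi>\<close> under conjugation is the parity of the stem function in \<open>z_h\<close>.\<close>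

lemma harmonic_slice_fun_spherical_quotient:
  fixes D :: "'n::{finite,linorder} cvec set"
  assumes D: "open D" "invariant D" and G: "stem D G"
    and G0: "stem D G0" "holo_var D h G0" "\<And>z. z \<in> D \<Longrightarrow> G z = spherical_quotient h G0 z"
    and x: "x \<in> circularization D"
  shows "has_laplacian_wrt h (slice_fun D G) 0 x"
proof (rule has_laplacian_of_harmonic)
  obtain J z where z: "x = embed J z" "z \<in> D" "unit_dirs J"
    using x by (rule circularizationE)
  define S where "S = {w. vary h z w \<in> D}"
  have S: "open S"
  proof -
    have "continuous_on UNIV (vary h z)" by (intro continuous_intros continuous_on_id)
    from open_vimage [OF D(1) this] show ?thesis by (simp add: S_def vimage_def)
  qed
  have cnjS: "cnj w \<in> S" if "w \<in> S" for w
    using that invariantD [OF D(2)] by (auto simp: S_def conj_at_vary [symmetric])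
  have xS: "slice_point (x $ h) \<in> S"
  proof -
    have "replace_at x h (x $ h) = x" by (simp add: replace_at_def vec_eq_iff)
    then have "x $ h \<in> section_dom D h (embed J z)" using x by (simp add: section_dom_def z(1))
    then show ?thesis by (simp add: in_section_dom D z(3) S_def)
  qed
  let ?q = "\<lambda>c L y. Im_quotient h (\<lambda>z. cpair c h L (G0 z)) (vary h z (slice_point y))"
  have harm: "harmonic_at (\<lambda>y. ?q c L y) (x $ h)"
    if L: "h \<notin> L" for c L
  proof -
    let ?\<phi> = "\<lambda>w. cpair c h L (G0 (vary h z w))"
    have der: "(?\<phi> has_field_derivative cderiv h (\<lambda>z. cpair c h L (G0 z)) (vary h z w)) (at w)" if "w \<in> S" for w
    proof -
      have "holo_along h (\<lambda>z. cpair c h L (G0 z)) (vary h z w + axis h 0)"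
        using G0(2) that L by (simp add: holo_var_def S_def)
      from holo_along_has_derivative [OF this]
      have "((\<lambda>u. ?\<phi> (u + w)) has_field_derivative cderiv h (\<lambda>z. cpair c h L (G0 z)) (vary h z w)) (at 0)"
        using vary_add [of h z w] by (simp add: add.commute [of _ w])
      then show ?thesis using DERIV_shift [of ?\<phi> _ 0 w] by simp
    qed
    have "?\<phi> holomorphic_on S"
      using der S by (auto simp: holomorphic_on_open)
    moreover have "?\<phi> (cnj w) = cnj (?\<phi> w)" if "w \<in> S" for w
      using that L by (simp add: S_def cpair_def conj_at_vary [symmetric] stem_conj [OF G0(1)] complex_eq_iff)
    ultimately have "harmonic_at (\<lambda>y. if Im (slice_point y) = 0 then Re (deriv ?\<phi> (slice_point y))
        else Im (?\<phi> (slice_point y)) / Im (slice_point y)) (x $ h)"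
      using cnjS xS S by (intro harmonic_at_Im_quotient_plane) auto
    moreover have "\<forall>\<^sub>F y in nhds (x $ h). slice_point y \<in> S"
      using eventually_nhds_in_open [OF open_vimage [OF S continuous_on_slice_point], of "x $ h"] xS by (simp add: vimage_def)
    then have "\<forall>\<^sub>F y in nhds (x $ h). ?q c L y =
        (if Im (slice_point y) = 0 then Re (deriv ?\<phi> (slice_point y)) else Im (?\<phi> (slice_point y)) / Im (slice_point y))"
      by eventually_elim (simp add: Im_quotient_def vary_nth DERIV_imp_deriv [OF der])
    ultimately show ?thesis by (rule harmonic_at_cong)
  qed
  have "harmonic_at (\<lambda>y. \<Sum>L\<in>Pow (- {h}). \<Sum>c\<in>Basis. ordered_prod (($) J) L *
      (?q c L y *\<^sub>R c)) (x $ h)"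
  proof (intro harmonic_at_sum)
    fix L and c :: quat assume "L \<in> Pow (- {h})"
    then have "h \<notin> L" by auto
    have "bounded_linear (\<lambda>r. ordered_prod (($) J) L * (r *\<^sub>R c))"
      by (intro bounded_linear_const_mult bounded_linear_scaleR_left)
    then show "harmonic_at (\<lambda>y. ordered_prod (($) J) L *
      (?q c L y *\<^sub>R c)) (x $ h)"
      using harm [OF \<open>h \<notin> L\<close>] by (rule harmonic_at_bounded_linear)
  qed simp_all
  then show "harmonic_at (\<lambda>y. slice_fun D G (replace_at x h y)) (x $ h)"
  proof (rule harmonic_at_cong)
    have "\<forall>\<^sub>F y in nhds (x $ h). slice_point y \<in> S"
      using eventually_nhds_in_open [OF open_vimage [OF S continuous_on_slice_point], of "x $ h"] xS by (simp add: vimage_def)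
    then show "\<forall>\<^sub>F y in nhds (x $ h). slice_fun D G (replace_at x h y) = (\<Sum>L\<in>Pow (- {h}). \<Sum>c\<in>Basis. ordered_prod (($) J) L *
      (?q c L y *\<^sub>R c))"
    proof eventually_elim
      case (elim y)
      let ?J = "with_dir h (direction y) J" and ?z = "vary h z (slice_point y)"
      have u: "unit_dirs ?J" using z(3) direction_imag_unit by (rule with_dir_imag_units)
      have zD: "?z \<in> D" using elim by (simp add: S_def)
      have "slice_fun D G (replace_at x h y) = slice_sum ?J (G ?z)"
        unfolding z(1) replace_at_slice_point by (rule slice_fun_eq_slice_sum [OF G D(2) zD u])
      also have "\<dots> = (\<Sum>L\<in>Pow (- {h}). ordered_prod (($) ?J) L * G ?z $ L)"
        unfolding slice_sum_def by (rule sum.mono_neutral_right) (auto simp: G0(3) [OF zD] spherical_quotient_def)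
      also have "\<dots> = (\<Sum>L\<in>Pow (- {h}). \<Sum>c\<in>Basis. ordered_prod (($) J) L *
        (?q c L y *\<^sub>R c))"
      proof (rule sum.cong [OF refl])
        fix L assume "L \<in> Pow (- {h})"
        then have "h \<notin> L" by auto
        then show "ordered_prod (($) ?J) L * G ?z $ L = (\<Sum>c\<in>Basis. ordered_prod (($) J) L * (?q c L y *\<^sub>R c))"
          by (simp add: ordered_prod_with_dir G0(3) [OF zD] spherical_quotient_def sum_distrib_left)
      qed
      finally show ?case .
    qed
  qed
qed

section \<open>Decomposition of slice functions\<close>

lemma spherical_component_circular:
  assumes D: "invariant D" and F: "stem D F" "induces D F f"
  shows "spherical_component D H K f \<in> circular_functions_wrt_set (nonreal_part D H) H"
proof -
  have st: "stem (nonreal_part D H) (component_stem H K F)" by (rule stem_component_stem [OF F(1)])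
  have "slice_fun (nonreal_part D H) (component_stem H K F) \<in> circular_functions_wrt (nonreal_part D H) h" if "h \<in> H" for h
    by (rule circular_of_no_component [OF invariant_nonreal_part [OF D] st]) (use that in \<open>auto intro: component_stem_nth_zero\<close>)
  moreover have "slice_fun (nonreal_part D H) (component_stem H K F) \<in> slice_functions (nonreal_part D H)"
    using st induces_slice_fun by (auto simp: slice_functions_def)
  ultimately show ?thesis
    unfolding spherical_component_eq [OF D F] circular_functions_wrt_set_def by blast
qed

text \<open>A set disjoint from \<open>H\<close> has no element below the least element of the complement of \<open>H\<close>.\<close>

lemma left_supported_Min:
  fixes H :: "'n::{finite,linorder} set"
  assumes "\<And>z L. z \<in> D \<Longrightarrow> L \<inter> H \<noteq> {} \<Longrightarrow> G z $ L = 0"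
  shows "left_supported D (Min (- H)) G"
  unfolding left_supported_def
proof (intro ballI allI impI)
  fix z L assume z: "z \<in> D" and "\<exists>k\<in>L. k < Min (- H)"
  then obtain k where k: "k \<in> L" "k < Min (- H)" by blast
  then have "k \<in> H" by (metis ComplI Min_le finite not_le)
  with k(1) show "G z $ L = 0" by (intro assms z) auto
qed

lemma spherical_component_slice_wrt:
  assumes D: "invariant D" and F: "stem D F" "induces D F f"
  shows "spherical_component D H K f \<in> slice_functions_wrt (nonreal_part D H) (Min (- H))"
  unfolding spherical_component_eq [OF D F]
  by (intro slice_wrt_of_left_supported [OF invariant_nonreal_part [OF D] stem_component_stem [OF F(1)] _ induces_slice_fun]
      left_supported_Min component_stem_nth_zero)

lemma slice_fun_nonreal_part:
  assumes D: "invariant D" and G: "stem D G" and x: "x \<in> circularization (nonreal_part D H)"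
  shows "x \<in> circularization D" "slice_fun D G x = slice_fun (nonreal_part D H) G x"
proof -
  obtain J z where z: "x = embed J z" "z \<in> nonreal_part D H" "unit_dirs J"
    using x by (rule circularizationE)
  have zD: "z \<in> D" using z by (simp add: nonreal_part_def)
  show "x \<in> circularization D" using z zD by (simp add: embed_in_circularization D)
  show "slice_fun D G x = slice_fun (nonreal_part D H) G x"
    unfolding z(1) slice_fun_eq_slice_sum [OF G D zD z(3)]
      slice_fun_eq_slice_sum [OF stem_subset [OF G nonreal_part_subset] invariant_nonreal_part [OF D] z(2,3)] ..
qed

lemma slice_regular_harmonic:
  fixes D :: "'n::{finite,linorder} cvec set"
  assumes D: "open D" "invariant D" and f: "f \<in> slice_regular_functions D"
  shows "\<exists>g. continuous_extension (circularization (nonreal_part D H)) (circularization D) (spherical_component D H K f) g \<and>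
      (\<forall>h\<in>H. \<forall>x\<in>circularization D. has_laplacian_wrt h g 0 x)"
proof -
  obtain F where F: "holomorphic_stem D F" "induces D F f" using f by (auto simp: slice_regular_functions_def)
  then have st: "stem D F" by (simp add: holomorphic_stem_def)
  obtain G where G: "stem D G" "\<And>z. z \<in> nonreal_part D H \<Longrightarrow> G z = component_stem H K F z"
    "\<And>h. h \<in> H \<Longrightarrow> \<exists>G0. stem D G0 \<and> holo_var D h G0 \<and> (\<forall>z\<in>D. G z = spherical_quotient h G0 z)"
    by (rule component_stem_extends [OF D st holomorphic_stem_imp_holo_var [OF F(1)]]) (rule that)
  show ?thesis
  proof (intro exI conjI ballI)
    have "slice_fun D G x = spherical_component D H K f x" if "x \<in> circularization (nonreal_part D H)" for x
      unfolding slice_fun_nonreal_part(2) [OF D(2) G(1) that] spherical_component_eq [OF D(2) st F(2)]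
      using slice_fun_cong [OF G(2)] by simp
    then show "continuous_extension (circularization (nonreal_part D H)) (circularization D) (spherical_component D H K f) (slice_fun D G)"
      unfolding continuous_extension_def using continuous_on_slice_fun [OF G(1) D(2)] by blast
    show "has_laplacian_wrt h (slice_fun D G) 0 x" if "h \<in> H" "x \<in> circularization D" for h x
      using G(3) [OF that(1)] harmonic_slice_fun_spherical_quotient [OF D G(1) _ _ _ that(2)] by blast
  qed
qed

lemma slice_regular_components:
  fixes D :: "'n::{finite,linorder} cvec set"
  assumes D: "open D" "invariant D" and f: "f \<in> slice_regular_functions D" and H: "H \<noteq> UNIV"
  shows "\<exists>g\<in>slice_regular_functions_wrt D (Min (- H)).
            \<forall>x\<in>circularization (nonreal_part D H). g x = spherical_component D H K f x"
proof -
  obtain F where F: "holomorphic_stem D F" "induces D F f" using f by (auto simp: slice_regular_functions_def)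
  then have st: "stem D F" by (simp add: holomorphic_stem_def)
  obtain G where G: "stem D G" "\<And>z. z \<in> nonreal_part D H \<Longrightarrow> G z = component_stem H K F z"
    "\<And>h. h \<notin> H \<Longrightarrow> holo_var D h G"
    by (rule component_stem_extends [OF D st holomorphic_stem_imp_holo_var [OF F(1)]]) (rule that)
  have zero: "G z $ L = 0" if "z \<in> D" "L \<inter> H \<noteq> {}" for z L
  proof (rule nonreal_part_eq [OF D(1) _ continuous_on_const _ that(1)])
    show "continuous_on D (\<lambda>z. G z $ L)" using G(1) by (auto simp: stem_def intro!: continuous_intros)
    show "G z $ L = 0" if "z \<in> nonreal_part D H" for z
      using G(2) [OF that] component_stem_nth_zero [OF \<open>L \<inter> H \<noteq> {}\<close>] by simp
  qed
  have "- H \<noteq> {}" using H by auto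
  then have "Min (- H) \<notin> H" using Min_in [of "- H"] by auto
  then have "holo_var D (Min (- H)) G" by (rule G(3))
  then have "slice_fun D G \<in> slice_regular_functions_wrt D (Min (- H))"
    by (simp add: slice_regular_wrt_iff [OF D G(1) left_supported_Min [OF zero] induces_slice_fun])
  moreover have "slice_fun D G x = spherical_component D H K f x" if "x \<in> circularization (nonreal_part D H)" for x
    unfolding slice_fun_nonreal_part(2) [OF D(2) G(1) that] spherical_component_eq [OF D(2) st F(2)]
    using slice_fun_cong [OF G(2)] by simp
  ultimately show ?thesis by blast
qed

text \<open>The inversion formula holds on all of \<open>D\<close> for the extended components, by density. Its coefficients
involve only \<open>z_k\<close> with \<open>k < h\<close>, so holomorphy of the components in \<open>z_h\<close> is inherited by \<open>F\<close>.\<close>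

lemma holo_var_from_components:
  fixes D :: "'n::{finite,linorder} cvec set"
  assumes D: "open D" "invariant D" and F: "stem D F" "induces D F f"
    and comp: "\<And>K. K \<subseteq> {..<h} \<Longrightarrow> \<exists>g\<in>slice_regular_functions_wrt D h.
        \<forall>x\<in>circularization (nonreal_part D {..<h}). g x = spherical_component D {..<h} K f x"
  shows "holo_var D h F"
proof -
  let ?H = "{..<h}"
  let ?D = "nonreal_part D ?H"
  have inv: "invariant ?D" by (rule invariant_nonreal_part [OF D(2)])
  have "\<exists>G. stem D G \<and> (\<forall>z\<in>?D. G z = component_stem ?H K F z) \<and> holo_var D h G" if K: "K \<subseteq> ?H" for K
  proof -
    obtain g where g: "g \<in> slice_regular_functions_wrt D h" "\<And>x. x \<in> circularization ?D \<Longrightarrow> g x = spherical_component D ?H K f x"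
      using comp [OF K] by blast
    have "g \<in> slice_functions D" using g(1) by (simp add: slice_regular_functions_wrt_def)
    then obtain G where G: "stem D G" "induces D G g" by (auto simp: slice_functions_def)
    have eq: "G z = component_stem ?H K F z" if z: "z \<in> ?D" for z
    proof (rule stem_unique [OF stem_subset [OF G(1) nonreal_part_subset] stem_component_stem [OF F(1)] inv _ z])
      fix x assume x: "x \<in> circularization ?D"
      have "slice_fun ?D G x = g x"
        using slice_fun_nonreal_part [OF D(2) G(1) x] G(2) by (simp add: induces_def)
      then show "slice_fun ?D G x = slice_fun ?D (component_stem ?H K F) x"
        using g(2) [OF x] by (simp add: spherical_component_eq [OF D(2) F])
    qed
    have "left_supported D h G" unfolding left_supported_def
    proof (intro ballI allI impI)
      fix z L assume z: "z \<in> D" and "\<exists>k\<in>L. k < h"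
      then have L: "L \<inter> ?H \<noteq> {}" by auto
      show "G z $ L = 0"
      proof (rule nonreal_part_eq [OF D(1) _ continuous_on_const _ z])
        show "continuous_on D (\<lambda>z. G z $ L)" using G(1) by (auto simp: stem_def intro!: continuous_intros)
        show "G z $ L = 0" if "z \<in> ?D" for z
          using eq [OF that] component_stem_nth_zero [OF L] by simp
      qed
    qed
    then have "holo_var D h G" using g(1) slice_regular_wrt_iff [OF D G(1) _ G(2)] by blast
    with G(1) eq show ?thesis by blast
  qed
  then obtain G where G: "\<And>K. K \<subseteq> ?H \<Longrightarrow> stem D (G K)" "\<And>K z. K \<subseteq> ?H \<Longrightarrow> z \<in> ?D \<Longrightarrow> G K z = component_stem ?H K F z"
    "\<And>K. K \<subseteq> ?H \<Longrightarrow> holo_var D h (G K)"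
    by metis
  define a where "a = (\<lambda>N K (z :: 'n cvec). (-1) ^ card (?H - K) * ((\<Prod>k\<in>?H - K - N. Re (z $ k)) * (\<Prod>k\<in>N. - Im (z $ k))))"
  have F_eq: "F z $ (N \<union> L) = (\<Sum>K\<in>Pow (?H - N). a N K z *\<^sub>R G K z $ L)"
    if z: "z \<in> D" and N: "N \<subseteq> ?H" and L: "L \<inter> ?H = {}" for z N L
  proof (rule nonreal_part_eq [OF D(1) _ _ _ z])
    show "continuous_on D (\<lambda>z. F z $ (N \<union> L))" using F(1) by (auto simp: stem_def intro!: continuous_intros)
    have "continuous_on D (G K)" if "K \<in> Pow (?H - N)" for K using G(1) [of K] that by (auto simp: stem_def)
    then show "continuous_on D (\<lambda>z. \<Sum>K\<in>Pow (?H - N). a N K z *\<^sub>R G K z $ L)"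
      unfolding a_def by (intro continuous_intros) auto
    fix z assume z: "z \<in> ?D"
    have "G K z = component_stem ?H K F z" if "K \<in> Pow (?H - N)" for K
      using that by (intro G(2) z) auto
    then show "F z $ (N \<union> L) = (\<Sum>K\<in>Pow (?H - N). a N K z *\<^sub>R G K z $ L)"
      unfolding stem_from_components [OF z N L] a_def by (intro sum.cong) auto
  qed
  show ?thesis unfolding holo_var_def
  proof (intro ballI allI impI)
    fix z P c assume z: "z \<in> D" and P: "h \<notin> P"
    define N where "N = P \<inter> ?H"
    define L where "L = P - ?H"
    have NL: "N \<subseteq> ?H" "L \<inter> ?H = {}" "insert h L \<inter> ?H = {}" "P = N \<union> L" "insert h P = N \<union> insert h L" "h \<notin> L"
      using P by (auto simp: N_def L_def)
    show "holo_along h (\<lambda>z. cpair c h P (F z)) z"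
    proof (rule holo_along_cong [OF D(1) z])
      show "cpair c h P (F z) = (\<Sum>K\<in>Pow (?H - N). of_real (a N K z) * cpair c h L (G K z))" if "z \<in> D" for z
      proof -
        have "F z $ P = (\<Sum>K\<in>Pow (?H - N). a N K z *\<^sub>R G K z $ L)"
          "F z $ insert h P = (\<Sum>K\<in>Pow (?H - N). a N K z *\<^sub>R G K z $ insert h L)"
          unfolding NL(4,5) using F_eq [OF that NL(1,2)] F_eq [OF that NL(1,3)] by simp_all
        then show ?thesis by (simp add: cpair_def inner_sum_right complex_eq_iff)
      qed
      have a_const: "a N K (z + axis h u) = a N K z" for K u
        unfolding a_def using NL(1) by (auto simp: axis_def intro!: arg_cong2 [where f = "(*)"] prod.cong)
      have "(\<lambda>u. \<Sum>K\<in>Pow (?H - N). of_real (a N K z) * cpair c h L (G K (z + axis h u))) field_differentiable at 0"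
      proof (intro field_differentiable_sum field_differentiable_mult field_differentiable_const)
        fix K assume "K \<in> Pow (?H - N)"
        then have "holo_var D h (G K)" by (intro G(3)) auto
        then show "(\<lambda>u. cpair c h L (G K (z + axis h u))) field_differentiable at 0"
          using z NL(6) by (simp add: holo_var_def holo_along_def)
      qed
      then show "holo_along h (\<lambda>z. \<Sum>K\<in>Pow (?H - N). of_real (a N K z) * cpair c h L (G K z)) z"
        by (simp add: holo_along_def a_const)
    qed
  qed
qed

lemma spherical_component_UNIV:
  assumes D: "invariant D" and F: "stem D F" "induces D F f"
    and z: "z \<in> nonreal_part D UNIV" and J: "unit_dirs J"
  shows "spherical_component D UNIV K f (embed J z) = component_stem UNIV K F z $ {}"
proof -
  have "spherical_component D UNIV K f (embed J z) = slice_sum J (component_stem UNIV K F z)"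
    unfolding spherical_component_eq [OF D F]
    by (rule slice_fun_eq_slice_sum [OF stem_component_stem [OF F(1)] invariant_nonreal_part [OF D] z J])
  also have "\<dots> = (\<Sum>L\<in>{{}}. ordered_prod (($) J) L * component_stem UNIV K F z $ L)"
    unfolding slice_sum_def by (rule sum.mono_neutral_right) (auto simp: component_stem_nth_zero)
  finally show ?thesis by (simp add: ordered_prod_def)
qed

lemma Reals_scaleR: "q \<in> \<real> \<Longrightarrow> r *\<^sub>R q \<in> (\<real> :: quat set)"
  by (simp add: scaleR_conv_of_real)

lemma closed_quat_Reals: "closed (\<real> :: quat set)"
proof -
  have R: "(\<real> :: quat set) = {q. qI q = 0} \<inter> {q. qJ q = 0} \<inter> {q. qK q = 0}"
  proof -
    have "q \<in> \<real>" if "qI q = 0" "qJ q = 0" "qK q = 0" for q :: quat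
    proof -
      have "q = of_real (qRe q)" using that by (simp add: quat_eq_iff)
      then show ?thesis by (metis Reals_of_real)
    qed
    then show ?thesis by (auto elim!: Reals_cases)
  qed
  show ?thesis
    unfolding R by (intro closed_Int closed_Collect_eq continuous_intros)
qed

text \<open>The components with respect to all variables have only the part at \<open>e_\<emptyset>\<close>, so their values are the values
of their stem functions. Reality passes between these and \<open>F\<close> by the defining formula and by the
inversion formula; it extends to \<open>D\<close> since the reals are closed.\<close>

lemma slice_preserving_iff:
  fixes D :: "'n::{finite,linorder} cvec set"
  assumes D: "open D" "invariant D" and f: "f \<in> slice_functions D"
  shows "f \<in> slice_preserving_functions D \<longleftrightarrow>
     (\<forall>K. \<forall>x\<in>circularization (nonreal_part D UNIV). spherical_component D UNIV K f x \<in> \<real>)"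
proof
  assume "f \<in> slice_preserving_functions D"
  then obtain F where F: "stem D F" "induces D F f" "\<forall>z\<in>D. \<forall>K. F z $ K \<in> \<real>"
    by (auto simp: slice_preserving_functions_def)
  show "\<forall>K. \<forall>x\<in>circularization (nonreal_part D UNIV). spherical_component D UNIV K f x \<in> \<real>"
  proof (intro allI ballI)
    fix K x assume "x \<in> circularization (nonreal_part D UNIV)"
    then obtain J z where z: "x = embed J z" "z \<in> nonreal_part D UNIV" "unit_dirs J" by (rule circularizationE)
    have "z \<in> D" using z by (simp add: nonreal_part_def)
    then have "component_stem UNIV K F z $ {} \<in> \<real>"
      using F(3) by (simp add: component_stem_nth) (intro Reals_scaleR sum_in_Reals, simp)
    then show "spherical_component D UNIV K f x \<in> \<real>"
      unfolding z(1) spherical_component_UNIV [OF D(2) F(1,2) z(2,3)] .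
  qed
next
  assume R: "\<forall>K. \<forall>x\<in>circularization (nonreal_part D UNIV). spherical_component D UNIV K f x \<in> \<real>"
  obtain F where F: "stem D F" "induces D F f" using f by (auto simp: slice_functions_def)
  define J :: "'n qvec" where "J = (\<chi> k. Quat 0 1 0 0)"
  have J: "unit_dirs J" by (simp add: J_def quat_i_imag_unit)
  have "F z $ P \<in> \<real>" if z: "z \<in> D" for z P
  proof (rule nonreal_part_dense [where \<phi> = "\<lambda>z. F z $ P", OF D(1) _ closed_quat_Reals _ z])
    show "continuous_on D (\<lambda>z. F z $ P)" using F(1) by (auto simp: stem_def intro!: continuous_intros)
    fix z assume z: "z \<in> nonreal_part D UNIV"
    have "component_stem UNIV K F z $ {} \<in> \<real>" for K
    proof -
      have "embed J z \<in> circularization (nonreal_part D UNIV)" using J z by (auto simp: circularization_def)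
      with R show ?thesis using spherical_component_UNIV [OF D(2) F z J, of K] by metis
    qed
    then have "F z $ (P \<union> {}) \<in> \<real>"
      by (subst stem_from_components [OF z]) (auto intro!: Reals_scaleR sum_in_Reals)
    then show "F z $ P \<in> \<real>" by simp
  qed
  with F show "f \<in> slice_preserving_functions D" by (auto simp: slice_preserving_functions_def)
qed

theorem theorem3p1:
  fixes D :: "'n::{finite,linorder} cvec set"
    and f :: "'n qvec \<Rightarrow> quat"
    and H :: "'n set"
  assumes "open D" and "invariant D" and "f \<in> slice_functions D"
  shows
    "(\<forall>x\<in>circularization (nonreal_part D H).
        f x = (\<Sum>K\<in>Pow H. (-1) ^ card (H - K) *
          slice_mult (nonreal_part D H)
            (conj_coord_prod (nonreal_part D H) (H - K)) (spherical_component D H K f) x))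
   \<and> (\<forall>K\<in>Pow H.
        spherical_component D H K f \<in> circular_functions_wrt_set (nonreal_part D H) H \<and>
        (H \<noteq> UNIV \<longrightarrow>
          spherical_component D H K f \<in> slice_functions_wrt (nonreal_part D H) (Min (- H))))
   \<and> (f \<in> slice_regular_functions D \<longrightarrow>
        (\<forall>K\<in>Pow H. \<exists>g.
          continuous_extension (circularization (nonreal_part D H)) (circularization D)
            (spherical_component D H K f) g \<and>
          (\<forall>h\<in>H. \<forall>x\<in>circularization D. has_laplacian_wrt h g 0 x)))
   \<and> (f \<in> slice_regular_functions D \<longleftrightarrow>
        (\<forall>H'. H' \<noteq> UNIV \<longrightarrow> (\<forall>K\<in>Pow H'.
          \<exists>g\<in>slice_regular_functions_wrt D (Min (- H')).
            \<forall>x\<in>circularization (nonreal_part D H'). g x = spherical_component D H' K f x)))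
   \<and> (f \<in> slice_preserving_functions D \<longleftrightarrow>
        (\<forall>K. \<forall>x\<in>circularization (nonreal_part D UNIV).
          spherical_component D UNIV K f x \<in> \<real>))"
proof -
  obtain F where F: "stem D F" "induces D F f" using assms(3) by (auto simp: slice_functions_def)
  have regular: "f \<in> slice_regular_functions D" if comp: "\<forall>H'. H' \<noteq> UNIV \<longrightarrow> (\<forall>K\<in>Pow H'.
          \<exists>g\<in>slice_regular_functions_wrt D (Min (- H')).
            \<forall>x\<in>circularization (nonreal_part D H'). g x = spherical_component D H' K f x)"
  proof -
    have "holo_var D h F" for h
    proof (rule holo_var_from_components [OF assms(1,2) F])
      fix K :: "'n set" assume K: "K \<subseteq> {..<h}"
      \<comment> \<open>For \<open>H' = {..<h}\<close> the least free variable is \<open>x_h\<close> itself.\<close>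
      have "{..<h} \<noteq> UNIV" by (metis UNIV_I lessThan_iff less_irrefl)
      moreover have "Min (- {..<h}) = h" by (rule Min_eqI) auto
      ultimately show "\<exists>g\<in>slice_regular_functions_wrt D h.
          \<forall>x\<in>circularization (nonreal_part D {..<h}). g x = spherical_component D {..<h} K f x"
        using comp K by (metis PowI)
    qed
    then have "holomorphic_stem D F" by (rule holo_var_imp_holomorphic_stem [OF assms(1) F(1)])
    with F(2) show ?thesis by (auto simp: slice_regular_functions_def)
  qed
  show ?thesis
  proof (intro conjI iffI ballI impI allI)
    show "f x = (\<Sum>K\<in>Pow H. (-1) ^ card (H - K) * slice_mult (nonreal_part D H)
        (conj_coord_prod (nonreal_part D H) (H - K)) (spherical_component D H K f) x)"
      if "x \<in> circularization (nonreal_part D H)" for x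
      by (rule spherical_decomposition [OF assms(2) F that])
    show "spherical_component D H K f \<in> circular_functions_wrt_set (nonreal_part D H) H" for K
      by (rule spherical_component_circular [OF assms(2) F])
    show "spherical_component D H K f \<in> slice_functions_wrt (nonreal_part D H) (Min (- H))" for K
      by (rule spherical_component_slice_wrt [OF assms(2) F])
    show "\<exists>g. continuous_extension (circularization (nonreal_part D H)) (circularization D)
            (spherical_component D H K f) g \<and>
          (\<forall>h\<in>H. \<forall>x\<in>circularization D. has_laplacian_wrt h g 0 x)"
      if "f \<in> slice_regular_functions D" for K
      by (rule slice_regular_harmonic [OF assms(1,2) that])
    show "\<exists>g\<in>slice_regular_functions_wrt D (Min (- H')).
            \<forall>x\<in>circularization (nonreal_part D H'). g x = spherical_component D H' K f x"
      if "f \<in> slice_regular_functions D" "H' \<noteq> UNIV" for H' K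
      by (rule slice_regular_components [OF assms(1,2) that])
    show "f \<in> slice_preserving_functions D"
      if "\<forall>K. \<forall>x\<in>circularization (nonreal_part D UNIV). spherical_component D UNIV K f x \<in> \<real>"
      using that slice_preserving_iff [OF assms] by simp
    show "spherical_component D UNIV K f x \<in> \<real>"
      if "f \<in> slice_preserving_functions D" "x \<in> circularization (nonreal_part D UNIV)" for K x
      using that slice_preserving_iff [OF assms] by simp
  qed (rule regular)
qed

end
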